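(* Let $W:\mathbb{R}^2\to[0,\infty)$ be of class $C^3$ and satisfy the standing conditions (1)--(4) listed in the context, with wells $\mathbf{p}_\pm$. Let $\gamma_0$ be an unconstrained minimizer of $E$ among locally Lipschitz curves $\gamma:[0,1]\to\mathbb{R}^2$ with $\gamma(0)=\mathbf{p}_-$, $\gamma(1)=\mathbf{p}_+$, and let $\varepsilon_0>0$ be the no-bubbling threshold described in the context. For any non-zero $\varepsilon\in(-\varepsilon_0,\varepsilon_0)$, let $\gamma_*:[0,1]\to\mathbb{R}^2$ be any minimizer of $$\inf\{E(\gamma):\ \gamma:[0,1]\to\mathbb{R}^2\text{ locally Lipschitz},\ \gamma(0)=\mathbf{p}_-,\ \gamma(1)=\mathbf{p}_+,\ \mathcal{P}(\gamma)=\mathcal{P}(\gamma_0)+\varepsilon\},$$ parametrized with constant speed $|\gamma_*'(t)|=L$, where $L$ is its Euclidean arclength. Let $U_*:\mathbb{R}\to\mathbb{R}^2$, $U_*(y):=\gamma_*(t(y))$, where $t(y)$ is the inverse function of $$y(t):=\frac{1}{\sqrt2}\int_{1/2}^t\frac{|\gamma_*'(\tau)|}{\sqrt{W(\gamma_*(\tau))}}\,d\tau=\frac{L}{\sqrt2}\int_{1/2}^t\frac{1}{\sqrt{W(\gamma_*(\tau))}}\,d\tau,\qquad t\in(0,1).$$ Then: (i) $U_*$ lies in $\mathcal{G}_A$ with $A=\mathcal{P}(\gamma_0)+\varepsilon$ and minimizes $H$ within this class, i.e. $H(U_* )=\inf_{\mathcal{G}_A}H$. (ii) Let $\mathcal{C}$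 denote the set of all heteroclinic connections between $\mathbf{p}_-$ and $\mathbf{p}_+$. Then for all non-zero $\varepsilon\in(-\varepsilon_0,\varepsilon_0)$ such that $\mathcal{P}(\gamma)\ne\mathcal{P}(\gamma_0)+\varepsilon$ for all $\gamma\in\mathcal{C}$, the function $U_*$ solves $$-\nu\,\mathbb{J}U'=U''-\nabla_uW(U)\ \text{ on }(-\infty,\infty),\qquad U(\pm\infty)=\mathbf{p}_\pm,$$ with non-zero speed $\nu$.
   Context: Notation. $F=\sqrt W$; $\mathbb{J}=\begin{pmatrix}0&1\\-1&0\end{pmatrix}$. For curves on $[0,1]$: $E(\gamma)=\int_0^1F(\gamma)|\gamma'|\,dt$, $\mathcal{P}(\gamma)=-\int_0^1\gamma^{(2)}(\gamma^{(1)})'\,dt$. For $u:\mathbb{R}\to\mathbb{R}^2$: $H(u)=\int_{-\infty}^\infty\frac12|u'|^2+W(u)\,dy$, $\mathcal{P}(u)=-\int_{-\infty}^\infty u^{(2)}(u^{(1)})'\,dy$ (as an improper integral). $\mathcal{G}_A=\{u:\mathbb{R}\to\mathbb{R}^2:\ u-g\in H^1(\mathbb{R};\mathbb{R}^2),\ \mathcal{P}(u)=A\}$, where $g$ is any fixed smooth function with $g\equiv\mathbf{p}_+$ for $y$ sufficiently large and $g\equiv\mathbf{p}_-$ for $y$ sufficiently negative. A heteroclinic connection is a solution $U:\mathbb{R}\to\mathbb{R}^2$ of $-\nu\,\mathbb{J}U'=U''-\nabla_uW(U)$ on $(-\infty,\infty)$, $U(\pm\infty)=\mathbf{p}_\pm$,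 with $\nu=0$, i.e. $U''=\nabla_uW(U)$, $U(\pm\infty)=\mathbf{p}_\pm$. Standing conditions on $W$: (1) $W$ is continuous, nonnegative and vanishes at precisely two distinct points $\mathbf{p}_+,\mathbf{p}_-$; (2) there are disjoint balls $B_\pm$ centered at $\mathbf{p}_\pm$ within which $W$ is smooth, with positive definite Hessian at $\mathbf{p}_\pm$; (3) Assumption A: for every $\mathbf{p}_0$ in either $B_+\setminus\{\mathbf{p}_+\}$ or $B_-\setminus\{\mathbf{p}_-\}$ and every $A\in\mathbb{R}$ there exists a minimizer of $E$ over all Lipschitz curves $\gamma:[0,1]\to B_+$ (resp. $B_-$) with $\gamma(0)=\mathbf{p}_0$, $\gamma(1)=\mathbf{p}_+$ (resp. $\mathbf{p}_-$), $\mathcal{P}(\gamma)=A$, and the Euclidean arclength of this minimizer can be bounded by a constant depending on $W,\mathbf{p}_0,A$; (4) $F\ge m_0$ on $\mathbb{R}^2\setminus(B_+\cup B_-)$ for some $m_0>0$. No-bubbling threshold: $\varepsilon_0>0$ is a number such that for every $\varepsilon$ with $0<|\varepsilon|<\varepsilon_0$, any minimizer $\gamma_*$ of $E$ among locally Lipschitz curves $\gamma:[0,1]\to\mathbb{R}^2$ with $\gamma(0)=\mathbf{p}_-$, $\gamma(1)=\mathbf{p}_+$ and $\mathcal{P}(\gamma)=\mathcal{P}(\gamma_0)+\varepsilon$, parametrized with constant speed, satisfies $\gamma_*(t)\notin\{\mathbf{p}_-,\mathbf{p}_+\}$ for all $t\in(0,1)$. Under the standing conditions such an $\varepsilon_0$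 exists, and minimizers exist for every constraint value. *)

theory Defs
  imports "HOL-Analysis.Analysis"
begin

section \<open>Calculus\<close>

text \<open>
  \<open>higher_differentiable_on S f k\<close>: for open \<open>S\<close> and a finite-dimensional domain this says that
  \<open>f\<close> is of class $C^k$ on \<open>S\<close>, all iterated directional derivatives being required to exist
  and the last ones to be continuous.
\<close>

fun higher_differentiable_on ::
  "'a::real_normed_vector set \<Rightarrow> ('a \<Rightarrow> 'b::real_normed_vector) \<Rightarrow> nat \<Rightarrow> bool" where
  "higher_differentiable_on S f 0 \<longleftrightarrow> continuous_on S f"
| "higher_differentiable_on S f (Suc k) \<longleftrightarrow>
     (\<forall>x\<in>S. f differentiable (at x)) \<and>
     (\<forall>v. higher_differentiable_on S (\<lambda>x. frechet_derivative f (at x) v) k)"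

definition smooth_on :: "'a::real_normed_vector set \<Rightarrow> ('a \<Rightarrow> 'b::real_normed_vector) \<Rightarrow> bool" where
  "smooth_on S f \<longleftrightarrow> (\<forall>k. higher_differentiable_on S f k)"

definition grad :: "(real^2 \<Rightarrow> real) \<Rightarrow> real^2 \<Rightarrow> real^2" where
  "grad W x = (\<chi> i. frechet_derivative W (at x) (axis i 1))"

definition hessian_pos_def :: "(real^2 \<Rightarrow> real) \<Rightarrow> real^2 \<Rightarrow> bool" where
  "hessian_pos_def W p \<longleftrightarrow>
     (\<forall>v. v \<noteq> 0 \<longrightarrow>
        frechet_derivative (\<lambda>x. frechet_derivative W (at x) v) (at p) v > 0)"

definition J_mat :: "real^2^2" where
  "J_mat = vector [vector [0, 1], vector [- 1, 0]]"


section \<open>Curves on the unit interval\<close>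

definition locally_lipschitz_on :: "real set \<Rightarrow> (real \<Rightarrow> real^2) \<Rightarrow> bool" where
  "locally_lipschitz_on S \<gamma> \<longleftrightarrow>
     (\<forall>t\<in>S. \<exists>d>0. \<exists>L. L-lipschitz_on (cball t d \<inter> S) \<gamma>)"

text \<open>
  Lipschitz curves are differentiable almost everywhere, so the unspecified value of
  \<^const>\<open>vector_derivative\<close> at the remaining points does not affect the integrals below.
\<close>

abbreviation curve_deriv :: "(real \<Rightarrow> real^2) \<Rightarrow> real \<Rightarrow> real^2" where
  "curve_deriv \<gamma> t \<equiv> vector_derivative \<gamma> (at t within {0..1})"

definition curve_E :: "(real^2 \<Rightarrow> real) \<Rightarrow> (real \<Rightarrow> real^2) \<Rightarrow> real" where
  "curve_E W \<gamma> = (LINT t:{0..1}|lebesgue. sqrt (W (\<gamma> t)) * norm (curve_deriv \<gamma> t))"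

definition curve_P :: "(real \<Rightarrow> real^2) \<Rightarrow> real" where
  "curve_P \<gamma> = - (LINT t:{0..1}|lebesgue. \<gamma> t $ 2 * curve_deriv \<gamma> t $ 1)"

definition arclength :: "(real \<Rightarrow> real^2) \<Rightarrow> real" where
  "arclength \<gamma> = (LINT t:{0..1}|lebesgue. norm (curve_deriv \<gamma> t))"

definition constant_speed :: "(real \<Rightarrow> real^2) \<Rightarrow> bool" where
  "constant_speed \<gamma> \<longleftrightarrow>
     (AE t in lebesgue. t \<in> {0..1} \<longrightarrow>
        (\<exists>v. (\<gamma> has_vector_derivative v) (at t within {0..1}) \<and> norm v = arclength \<gamma>))"

definition connecting_curves :: "real^2 \<Rightarrow> real^2 \<Rightarrow> (real \<Rightarrow> real^2) set" where
  "connecting_curves p q = {\<gamma>. locally_lipschitz_on {0..1} \<gamma> \<and> \<gamma> 0 = p \<and> \<gamma> 1 = q}"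

definition E_minimizer ::
  "(real^2 \<Rightarrow> real) \<Rightarrow> real^2 \<Rightarrow> real^2 \<Rightarrow> (real \<Rightarrow> real^2) \<Rightarrow> bool" where
  "E_minimizer W p q \<gamma> \<longleftrightarrow> is_arg_min (curve_E W) (\<lambda>\<gamma>. \<gamma> \<in> connecting_curves p q) \<gamma>"

definition constrained_E_minimizer ::
  "(real^2 \<Rightarrow> real) \<Rightarrow> real^2 \<Rightarrow> real^2 \<Rightarrow> real \<Rightarrow> (real \<Rightarrow> real^2) \<Rightarrow> bool" where
  "constrained_E_minimizer W p q A \<gamma> \<longleftrightarrow>
     is_arg_min (curve_E W) (\<lambda>\<gamma>. \<gamma> \<in> connecting_curves p q \<and> curve_P \<gamma> = A) \<gamma>"


section \<open>Conditions on the potential\<close>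

text \<open>Assumption A in the ball of radius \<open>r\<close> about the well \<open>p\<close>; \<open>C\<close> is the arclength bound.\<close>

definition assumption_A :: "(real^2 \<Rightarrow> real) \<Rightarrow> real^2 \<Rightarrow> real \<Rightarrow> bool" where
  "assumption_A W p r \<longleftrightarrow>
     (\<exists>C :: real^2 \<Rightarrow> real \<Rightarrow> real. \<forall>p0 \<in> ball p r - {p}. \<forall>A. \<exists>\<gamma>.
        is_arg_min (curve_E W)
          (\<lambda>\<gamma>. (\<exists>L. L-lipschitz_on {0..1} \<gamma>) \<and> \<gamma> ` {0..1} \<subseteq> ball p r \<and>
               \<gamma> 0 = p0 \<and> \<gamma> 1 = p \<and> curve_P \<gamma> = A) \<gamma> \<and>
        arclength \<gamma> \<le> C p0 A)"

text \<open>\<open>rp\<close> and \<open>rm\<close> are the radii of the balls $B_\pm$ about the wells \<open>pp\<close> and \<open>pm\<close>.\<close>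

definition standing_conditions ::
  "(real^2 \<Rightarrow> real) \<Rightarrow> real^2 \<Rightarrow> real^2 \<Rightarrow> real \<Rightarrow> real \<Rightarrow> bool" where
  "standing_conditions W pp pm rp rm \<longleftrightarrow>
     continuous_on UNIV W \<and> (\<forall>x. W x \<ge> 0) \<and> pp \<noteq> pm \<and> {x. W x = 0} = {pp, pm} \<and>
     rp > 0 \<and> rm > 0 \<and> ball pp rp \<inter> ball pm rm = {} \<and>
     smooth_on (ball pp rp) W \<and> smooth_on (ball pm rm) W \<and>
     hessian_pos_def W pp \<and> hessian_pos_def W pm \<and>
     assumption_A W pp rp \<and> assumption_A W pm rm \<and>
     (\<exists>m0>0. \<forall>x. x \<notin> ball pp rp \<union> ball pm rm \<longrightarrow> sqrt (W x) \<ge> m0)"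

definition no_bubbling_threshold ::
  "(real^2 \<Rightarrow> real) \<Rightarrow> real^2 \<Rightarrow> real^2 \<Rightarrow> (real \<Rightarrow> real^2) \<Rightarrow> real \<Rightarrow> bool" where
  "no_bubbling_threshold W pp pm \<gamma>0 \<epsilon>0 \<longleftrightarrow>
     \<epsilon>0 > 0 \<and>
     (\<forall>\<epsilon> \<gamma>. 0 < \<bar>\<epsilon>\<bar> \<and> \<bar>\<epsilon>\<bar> < \<epsilon>0 \<and>
        constrained_E_minimizer W pm pp (curve_P \<gamma>0 + \<epsilon>) \<gamma> \<and> constant_speed \<gamma> \<longrightarrow>
        (\<forall>t\<in>{0<..<1}. \<gamma> t \<notin> {pm, pp}))"


section \<open>Functions on the real line\<close>

definition locally_integrable :: "(real \<Rightarrow> real^2) \<Rightarrow> bool" where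
  "locally_integrable u \<longleftrightarrow> (\<forall>a b. set_integrable lebesgue {a..b} u)"

definition test_function :: "(real \<Rightarrow> real) \<Rightarrow> bool" where
  "test_function \<phi> \<longleftrightarrow> smooth_on UNIV \<phi> \<and> compact (closure {y. \<phi> y \<noteq> 0})"

definition has_weak_deriv :: "(real \<Rightarrow> real^2) \<Rightarrow> (real \<Rightarrow> real^2) \<Rightarrow> bool" where
  "has_weak_deriv u v \<longleftrightarrow>
     locally_integrable u \<and> locally_integrable v \<and>
     (\<forall>\<phi>. test_function \<phi> \<longrightarrow>
        (LINT y|lebesgue. deriv \<phi> y *\<^sub>R u y) = - (LINT y|lebesgue. \<phi> y *\<^sub>R v y))"

text \<open>A weak derivative is unique only up to null sets; \<open>weak_deriv\<close> picks a representative.\<close>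

definition weak_deriv :: "(real \<Rightarrow> real^2) \<Rightarrow> real \<Rightarrow> real^2" where
  "weak_deriv u = (SOME v. has_weak_deriv u v)"

definition square_integrable :: "(real \<Rightarrow> real^2) \<Rightarrow> bool" where
  "square_integrable u \<longleftrightarrow>
     u \<in> borel_measurable lebesgue \<and> integrable lebesgue (\<lambda>y. (norm (u y))\<^sup>2)"

definition H1 :: "(real \<Rightarrow> real^2) set" where
  "H1 = {u. square_integrable u \<and> (\<exists>v. has_weak_deriv u v \<and> square_integrable v)}"

definition line_H :: "(real^2 \<Rightarrow> real) \<Rightarrow> (real \<Rightarrow> real^2) \<Rightarrow> ennreal" where
  "line_H W u = (\<integral>\<^sup>+ y. ennreal ((norm (weak_deriv u y))\<^sup>2 / 2 + W (u y)) \<partial>lebesgue)"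

text \<open>
  \<open>has_line_P u A\<close>: the improper integral defining $\mathcal{P}(u)$ converges, with value \<open>A\<close>.
\<close>

definition has_line_P :: "(real \<Rightarrow> real^2) \<Rightarrow> real \<Rightarrow> bool" where
  "has_line_P u A \<longleftrightarrow>
     ((\<lambda>(a, b). - (LINT y:{a..b}|lebesgue. u y $ 2 * weak_deriv u y $ 1)) \<longlongrightarrow> A)
       (at_bot \<times>\<^sub>F at_top)"

definition transition_function :: "real^2 \<Rightarrow> real^2 \<Rightarrow> (real \<Rightarrow> real^2) \<Rightarrow> bool" where
  "transition_function pp pm g \<longleftrightarrow>
     smooth_on UNIV g \<and>
     eventually (\<lambda>y. g y = pp) at_top \<and> eventually (\<lambda>y. g y = pm) at_bot"

definition admissible_class :: "(real \<Rightarrow> real^2) \<Rightarrow> real \<Rightarrow> (real \<Rightarrow> real^2) set" where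
  "admissible_class g A = {u. (\<lambda>y. u y - g y) \<in> H1 \<and> has_line_P u A}"

definition travelling_wave ::
  "(real^2 \<Rightarrow> real) \<Rightarrow> real^2 \<Rightarrow> real^2 \<Rightarrow> real \<Rightarrow> (real \<Rightarrow> real^2) \<Rightarrow> bool" where
  "travelling_wave W pp pm \<nu> U \<longleftrightarrow>
     (\<exists>U' U''. \<forall>y.
        (U has_vector_derivative U' y) (at y) \<and>
        (U' has_vector_derivative U'' y) (at y) \<and>
        - \<nu> *\<^sub>R (J_mat *v U' y) = U'' y - grad W (U y)) \<and>
     (U \<longlongrightarrow> pp) at_top \<and> (U \<longlongrightarrow> pm) at_bot"

definition heteroclinics :: "(real^2 \<Rightarrow> real) \<Rightarrow> real^2 \<Rightarrow> real^2 \<Rightarrow> (real \<Rightarrow> real^2) set" where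
  "heteroclinics W pp pm = {U. travelling_wave W pp pm 0 U}"


section \<open>Reparametrization of a curve\<close>

text \<open>The interval integral is signed, so \<open>y_of_t W \<gamma> t\<close> is negative for \<open>t < 1/2\<close>.\<close>

definition y_of_t :: "(real^2 \<Rightarrow> real) \<Rightarrow> (real \<Rightarrow> real^2) \<Rightarrow> real \<Rightarrow> real" where
  "y_of_t W \<gamma> t =
     1 / sqrt 2 * (LINT \<tau>=ereal (1/2)..ereal t|lebesgue. (norm (curve_deriv \<gamma> \<tau>) / sqrt (W (\<gamma> \<tau>))))"

definition U_of_curve :: "(real^2 \<Rightarrow> real) \<Rightarrow> (real \<Rightarrow> real^2) \<Rightarrow> real \<Rightarrow> real^2" where
  "U_of_curve W \<gamma> y = \<gamma> (inv_into {0<..<1} (y_of_t W \<gamma>) y)"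

end

theory Submission
  imports Defs
begin

text \<open>
  The correspondence between the curve problem and the problem on the line rests on the inequality
  \<open>|u'|\<^sup>2 / 2 + W(u) \<ge> \<surd>2 \<surd>W(u) |u'|\<close>, which says that \<open>H(u)\<close> is at least \<open>\<surd>2\<close> times the
  energy \<open>E\<close> of the curve traced by \<open>u\<close>, with equality when \<open>|u'|\<^sup>2 / 2 = W(u)\<close>. The integral
  defining the area \<open>P\<close> does not depend on the parametrization.

  \<^emph>\<open>Upper bound.\<close> The function \<open>U\<close> is the constrained curve \<open>\<gamma>\<close> run at the speed that makes this an
  equality. As \<open>W\<close> vanishes to second order at the wells and \<open>\<gamma>\<close> does not meet them in between, the new
  parameter runs over the whole line. A change of variables turns \<open>H(U)\<close> into \<open>\<surd>2 E(\<gamma>)\<close>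
  (\<open>line_H_U\<close>) and \<open>P(U)\<close> into \<open>P(\<gamma>)\<close> (\<open>has_line_P_U\<close>). Since \<open>W\<close> controls the squared distance to the
  nearest well, the finite energy puts \<open>U - g\<close> into \<open>H\<^sup>1\<close> (\<open>U_minus_transition_H1\<close>).

  \<^emph>\<open>Lower bound.\<close> A competitor \<open>u\<close> may trace a curve of infinite length, may have an area that converges
  only conditionally, and is regular only in the weak sense. Hence \<open>u\<close> is replaced by the primitive of its
  weak derivative (\<open>has_weak_deriv_imp_primitive\<close>), cut off at two points where it is close to the
  wells and where the area is nearly right, made \<open>C\<^sup>1\<close> by approximating the derivative in \<open>L\<^sup>1\<close>, and joined
  to the wells by short segments. The remaining error in the area is corrected by a small loop at a well: a
  loop of diameter \<open>r\<close> encloses area of order \<open>r\<^sup>2\<close> and its energy tends to zero with \<open>r\<close>. The result is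
  a competitor of \<open>\<gamma>\<close>, so that \<open>\<surd>2 E(\<gamma>) \<le> H(u)\<close> (\<open>minimal_energy_le\<close>, \<open>line_H_ge_minimal_energy\<close>).

  \<^emph>\<open>Differential equation.\<close> The area is a quadratic functional, so the constraint along a
  two-parameter variation of \<open>U\<close> is a quadratic equation that can be solved for one parameter. This gives
  a Lagrange multiplier \<open>\<nu>\<close> (\<open>first_variation_zero\<close>, \<open>euler_lagrange_weak\<close>); it is available because
  the gradient \<open>J U'\<close> of the area does not vanish identically, \<open>U\<close> not being constant. The weak equation
  identifies the weak derivative of \<open>U'\<close>, and integrating it twice makes \<open>U\<close> a classical solution
  (\<open>minimizer_travelling_wave\<close>). If \<open>\<nu>\<close> were zero, \<open>U\<close> would be a heteroclinic connection with the
  excluded area.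
\<close>


section \<open>Smooth bump functions on the line\<close>

lemma higher_differentiable_on_real_SucI:
  fixes f f' :: "real \<Rightarrow> 'b::real_normed_vector"
  assumes d: "\<And>x. (f has_vector_derivative f' x) (at x)"
    and h: "\<And>v. higher_differentiable_on UNIV (\<lambda>x. v *\<^sub>R f' x) k"
  shows "higher_differentiable_on UNIV f (Suc k)"
proof -
  have "frechet_derivative f (at x) = (\<lambda>v. v *\<^sub>R f' x)" for x
    using d[of x] unfolding has_vector_derivative_def
    by (rule frechet_derivative_at[symmetric])
  then show ?thesis
    using d h by (auto simp: has_vector_derivative_def differentiable_def)
qed

text \<open>
  Bump functions are assembled by sums, products and affine substitutions. Each closure property goes by
  induction on the order with the function generalized, since the definition recurs on the directional
  derivatives.
\<close>

lemma higher_differentiable_on_scaleR: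
  fixes f :: "'a::real_normed_vector \<Rightarrow> 'b::real_normed_vector"
  assumes "higher_differentiable_on UNIV f k"
  shows "higher_differentiable_on UNIV (\<lambda>x. c *\<^sub>R f x) k"
  using assms
proof (induction k arbitrary: f)
  case 0
  then show ?case by (auto intro: continuous_intros)
next
  case (Suc k)
  then have "frechet_derivative (\<lambda>x. c *\<^sub>R f x) (at x) = (\<lambda>v. c *\<^sub>R frechet_derivative f (at x) v)" for x
    by (intro frechet_derivative_at[symmetric] has_derivative_scaleR_right)
       (auto simp: frechet_derivative_works[symmetric])
  then show ?case using Suc by auto
qed

lemma higher_differentiable_on_add:
  fixes f g :: "'a::real_normed_vector \<Rightarrow> 'b::real_normed_vector"
  assumes "higher_differentiable_on UNIV f k" "higher_differentiable_on UNIV g k"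
  shows "higher_differentiable_on UNIV (\<lambda>x. f x + g x) k"
  using assms
proof (induction k arbitrary: f g)
  case 0
  then show ?case by (auto intro: continuous_intros)
next
  case (Suc k)
  then have "frechet_derivative (\<lambda>x. f x + g x) (at x) =
     (\<lambda>v. frechet_derivative f (at x) v + frechet_derivative g (at x) v)" for x
    by (intro frechet_derivative_at[symmetric] has_derivative_add)
       (auto simp: frechet_derivative_works[symmetric])
  then show ?case using Suc by auto
qed

lemma higher_differentiable_on_SucD:
  assumes "higher_differentiable_on UNIV f (Suc k)"
  shows "higher_differentiable_on UNIV f k"
  using assms
proof (induction k arbitrary: f)
  case 0
  then show ?case
    by (auto simp: continuous_on_eq_continuous_at intro: differentiable_imp_continuous_within)
qed auto

lemma higher_differentiable_on_mult:
  fixes f g :: "'a::real_normed_vector \<Rightarrow> real"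
  assumes "higher_differentiable_on UNIV f k" "higher_differentiable_on UNIV g k"
  shows "higher_differentiable_on UNIV (\<lambda>x. f x * g x) k"
  using assms
proof (induction k arbitrary: f g)
  case 0
  then show ?case by (auto intro: continuous_intros)
next
  case (Suc k)
  have f: "higher_differentiable_on UNIV f k" and g: "higher_differentiable_on UNIV g k"
    using Suc.prems by (blast intro: higher_differentiable_on_SucD)+
  have "frechet_derivative (\<lambda>x. f x * g x) (at x) =
     (\<lambda>v. f x * frechet_derivative g (at x) v + frechet_derivative f (at x) v * g x)" for x
    using Suc.prems by (intro frechet_derivative_at[symmetric] has_derivative_mult)
       (auto simp: frechet_derivative_works[symmetric])
  then show ?case using Suc f g by (auto intro!: higher_differentiable_on_add)
qed

lemma higher_differentiable_on_affine:
  fixes f :: "real \<Rightarrow> 'b::real_normed_vector"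
  assumes "higher_differentiable_on UNIV f k"
  shows "higher_differentiable_on UNIV (\<lambda>x. f (c * x + d)) k"
  using assms
proof (induction k arbitrary: f)
  case 0
  then show ?case
    by (auto intro!: continuous_on_compose2[of UNIV f UNIV "\<lambda>x. c * x + d"] continuous_intros)
next
  case (Suc k)
  have *: "frechet_derivative (\<lambda>x. f (c * x + d)) (at x) = (\<lambda>v. frechet_derivative f (at (c * x + d)) (c * v))"
   and **: "(\<lambda>x. f (c * x + d)) differentiable (at x)" for x
  proof -
    have "(f has_derivative frechet_derivative f (at (c * x + d))) (at (c * x + d))"
      using Suc.prems by (simp add: frechet_derivative_works[symmetric])
    moreover have "((\<lambda>x. c * x + d) has_derivative (\<lambda>v. c * v)) (at x)"
      by (auto intro!: derivative_eq_intros)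
    ultimately have "((\<lambda>x. f (c * x + d)) has_derivative (\<lambda>v. frechet_derivative f (at (c * x + d)) (c * v))) (at x)"
      by (rule has_derivative_compose[rotated])
    then show "frechet_derivative (\<lambda>x. f (c * x + d)) (at x) = (\<lambda>v. frechet_derivative f (at (c * x + d)) (c * v))"
      and "(\<lambda>x. f (c * x + d)) differentiable (at x)"
      by (simp_all add: frechet_derivative_at[symmetric] differentiableI)
  qed
  have IH: "higher_differentiable_on UNIV (\<lambda>x. frechet_derivative f (at (c * x + d)) v) k" for v
    using Suc.IH[of "\<lambda>x. frechet_derivative f (at x) v"] Suc.prems by simp
  show ?case using ** IH by (simp add: *)
qed

text \<open>
  The derivative of each of these functions is a linear combination of two others, so that the smoothness
  of \<open>flat_bump 0\<close>, which is \<open>exp (- 1 / x)\<close> extended by zero, follows for the whole family at once.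
\<close>

definition flat_bump :: "nat \<Rightarrow> real \<Rightarrow> real" where
  "flat_bump k x = (if x \<le> 0 then 0 else (1 / x) ^ k * exp (- 1 / x))"

text \<open>
  Quadratic decay at the origin, from \<open>s ^ n / n! \<le> exp s\<close> with \<open>s = 1 / x\<close>. It provides the
  derivative at the only point where the two branches meet.
\<close>

lemma flat_bump_le: "\<bar>flat_bump k x\<bar> \<le> fact (k + 2) * x\<^sup>2"
proof (cases "x \<le> 0")
  case False
  define s where "s = 1 / x"
  have s: "s > 0" "x = 1 / s" using False by (auto simp: s_def)
  have *: "s ^ (k + 2) / fact (k + 2) \<le> exp s"
  proof -
    have "(\<Sum>n\<in>{k+2}. s ^ n / fact n) \<le> (\<Sum>n. s ^ n / fact n)"
      using s summable_exp[of s] by (intro sum_le_suminf) (auto simp: field_simps)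
    then show ?thesis
      by (simp add: exp_def divide_inverse scaleR_conv_of_real mult.commute)
  qed
  have "s ^ (k + 2) \<le> fact (k + 2) * exp s"
    using * by (simp add: pos_divide_le_eq mult.commute del: fact_Suc add_2_eq_Suc')
  then have "s ^ k * exp (- s) * s\<^sup>2 \<le> fact (k + 2)"
    by (simp add: exp_minus power_add field_simps power2_eq_square del: fact_Suc)
  then have "s ^ k * exp (- s) \<le> fact (k + 2) / s\<^sup>2"
    using s by (simp add: pos_le_divide_eq del: fact_Suc add_2_eq_Suc')
  then have "s ^ k * exp (- s) \<le> fact (k + 2) * x\<^sup>2"
    using s(2) by (simp add: power_one_over divide_inverse power_inverse del: fact_Suc add_2_eq_Suc')
  then show ?thesis using False s by (simp add: flat_bump_def del: fact_Suc)
qed (simp add: flat_bump_def)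

lemma flat_bump_derivative:
  "(flat_bump k has_vector_derivative (flat_bump (k + 2) x - real k * flat_bump (k + 1) x)) (at x)"
proof -
  consider "x < 0" | "x = 0" | "x > 0" by linarith
  then show ?thesis
  proof cases
    case 1
    have "((\<lambda>_. 0) has_vector_derivative 0) (at x)" by simp
    then have "(flat_bump k has_vector_derivative 0) (at x)"
      by (rule has_vector_derivative_transform_within_open[of _ _ _ "{..<0}"])
         (use 1 in \<open>auto simp: flat_bump_def\<close>)
    then show ?thesis using 1 by (simp add: flat_bump_def)
  next
    case 2
    have "((\<lambda>h. flat_bump k h / h) \<longlongrightarrow> 0) (at 0)"
    proof (rule Lim_null_comparison)
      show "\<forall>\<^sub>F h in at 0. norm (flat_bump k h / h) \<le> fact (k + 2) * \<bar>h\<bar>"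
      proof (rule eventually_mono[OF eventually_True])
        fix h :: real
        show "norm (flat_bump k h / h) \<le> fact (k + 2) * \<bar>h\<bar>"
        proof (cases "h = 0")
          case False
          then show ?thesis using flat_bump_le[of k h]
            by (simp add: abs_divide pos_divide_le_eq power2_eq_square abs_mult_self_eq mult.assoc del: fact_Suc)
        qed simp
      qed
      show "((\<lambda>h. fact (k + 2) * \<bar>h\<bar>) \<longlongrightarrow> (0::real)) (at 0)"
        by (auto intro!: tendsto_eq_intros)
    qed
    then have "(flat_bump k has_field_derivative 0) (at 0)"
      by (simp add: DERIV_def flat_bump_def)
    then show ?thesis using 2
      by (simp add: has_real_derivative_iff_has_vector_derivative[symmetric] flat_bump_def)
  next
    case 3
    define s where "s = 1 / x"
    have "((\<lambda>x. 1 / x) has_field_derivative - (s\<^sup>2)) (at x)"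
      using 3 by (auto intro!: derivative_eq_intros simp: s_def power2_eq_square)
    then have 1: "((\<lambda>x. (1 / x) ^ k) has_field_derivative real k * (- (s\<^sup>2) * s ^ (k - Suc 0))) (at x)"
      unfolding s_def by (rule DERIV_power)
    have 2: "((\<lambda>x. exp (- 1 / x)) has_field_derivative exp (- 1 / x) * s\<^sup>2) (at x)"
      using 3 by (auto intro!: derivative_eq_intros simp: s_def power2_eq_square)
    have "real k * (- (s\<^sup>2) * s ^ (k - Suc 0)) * exp (- 1 / x) + exp (- 1 / x) * s\<^sup>2 * (1 / x) ^ k
       = (1 / x) ^ (k + 2) * exp (- 1 / x) - real k * ((1 / x) ^ (k + 1) * exp (- 1 / x))"
      unfolding s_def[symmetric] by (cases k) (simp_all add: algebra_simps power2_eq_square)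
    with DERIV_mult[OF 1 2]
    have "((\<lambda>x. (1 / x) ^ k * exp (- 1 / x)) has_field_derivative
        ((1 / x) ^ (k + 2) * exp (- 1 / x) - real k * ((1 / x) ^ (k + 1) * exp (- 1 / x)))) (at x)"
      by (simp only:)
    then have "((\<lambda>x. (1 / x) ^ k * exp (- 1 / x)) has_vector_derivative
        ((1 / x) ^ (k + 2) * exp (- 1 / x) - real k * ((1 / x) ^ (k + 1) * exp (- 1 / x)))) (at x)"
      by (simp add: has_real_derivative_iff_has_vector_derivative)
    then have "(flat_bump k has_vector_derivative
        ((1 / x) ^ (k + 2) * exp (- 1 / x) - real k * ((1 / x) ^ (k + 1) * exp (- 1 / x)))) (at x)"
      by (rule has_vector_derivative_transform_within_open[of _ _ _ "{0<..}"])
         (use 3 in \<open>auto simp: flat_bump_def\<close>)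
    then show ?thesis using 3 by (simp add: flat_bump_def)
  qed
qed

lemma flat_bump_smooth: "higher_differentiable_on UNIV (flat_bump k) n"
proof (induction n arbitrary: k)
  case 0
  show ?case
    by (auto simp: continuous_on_eq_continuous_at
        intro: has_vector_derivative_continuous[OF flat_bump_derivative])
next
  case (Suc n)
  have "higher_differentiable_on UNIV
     (\<lambda>x. v *\<^sub>R (flat_bump (k + 2) x + (- real k) *\<^sub>R flat_bump (k + 1) x)) n" for v
    by (intro higher_differentiable_on_scaleR higher_differentiable_on_add Suc)
  then show ?case
    by (intro higher_differentiable_on_real_SucI[OF flat_bump_derivative]) simp
qed

text \<open>
  As the steepness \<open>n\<close> grows, these bumps increase to the indicator function of the open interval from
  \<open>a\<close> to \<open>b\<close>.
\<close>

definition plateau :: "real \<Rightarrow> real \<Rightarrow> real \<Rightarrow> real \<Rightarrow> real" where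
  "plateau a b n x = flat_bump 0 (n * x + n * - a) * flat_bump 0 ((- n) * x + n * b)"

lemma plateau_smooth: "smooth_on UNIV (plateau a b n)"
  unfolding smooth_on_def plateau_def
  by (intro allI higher_differentiable_on_mult higher_differentiable_on_affine flat_bump_smooth)

lemma flat_bump_0_bounds: "0 \<le> flat_bump 0 x" "flat_bump 0 x \<le> 1"
  by (auto simp: flat_bump_def)

lemma plateau_bounds: "0 \<le> plateau a b n x" "plateau a b n x \<le> 1"
  by (auto simp: plateau_def flat_bump_0_bounds mult_le_one)

lemma plateau_alt:
  "plateau a b n x = flat_bump 0 (n * (x - a)) * flat_bump 0 (n * (b - x))"
  by (simp add: plateau_def algebra_simps)

lemma plateau_outside: "n > 0 \<Longrightarrow> x \<notin> {a<..<b} \<Longrightarrow> plateau a b n x = 0"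
  by (auto simp: plateau_alt flat_bump_def mult_le_0_iff)

lemma plateau_pos: "n > 0 \<Longrightarrow> x \<in> {a<..<b} \<Longrightarrow> plateau a b n x > 0"
  by (auto simp: plateau_alt flat_bump_def mult_le_0_iff)

lemma plateau_tendsto: "x \<in> {a<..<b} \<Longrightarrow> (\<lambda>n. plateau a b (real (Suc n)) x) \<longlonglongrightarrow> 1"
proof -
  assume x: "x \<in> {a<..<b}"
  have *: "(\<lambda>n. exp (- 1 / (real (Suc n) * c))) \<longlonglongrightarrow> 1" if "c > 0" for c :: real
  proof -
    have "(\<lambda>n. (- 1 / c) * (1 / real (Suc n))) \<longlonglongrightarrow> (- 1 / c) * 0"
      using LIMSEQ_inverse_real_of_nat by (intro tendsto_mult_left) (simp add: inverse_eq_divide)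
    then have "(\<lambda>n. exp ((- 1 / c) * (1 / real (Suc n)))) \<longlonglongrightarrow> exp ((- 1 / c) * 0)"
      by (rule tendsto_exp)
    then show ?thesis by (simp add: mult.commute)
  qed
  have "plateau a b (real (Suc n)) x = exp (- 1 / (real (Suc n) * (x - a))) * exp (- 1 / (real (Suc n) * (b - x)))" for n
    using x by (auto simp: plateau_alt flat_bump_def mult_le_0_iff simp del: of_nat_Suc)
  then show ?thesis using tendsto_mult[OF *[of "x - a"] *[of "b - x"]] x by simp
qed

lemma test_functionI:
  assumes "smooth_on UNIV \<phi>" "\<And>y. y \<notin> {a..b} \<Longrightarrow> \<phi> y = 0"
  shows "test_function \<phi>"
proof -
  have "closure {y. \<phi> y \<noteq> 0} \<subseteq> {a..b}"
    by (rule closure_minimal) (use assms(2) in force, simp)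
  then show ?thesis unfolding test_function_def
    using assms(1) by (meson bounded_closed_interval bounded_subset closed_closure compact_eq_bounded_closed)
qed

lemma test_function_support:
  assumes "test_function \<phi>"
  obtains R where "R > 0" "\<And>y. y \<notin> {-R..R} \<Longrightarrow> \<phi> y = 0" "\<And>y. y \<notin> {-R..R} \<Longrightarrow> deriv \<phi> y = 0"
proof -
  have "bounded (closure {y. \<phi> y \<noteq> 0})"
    using assms unfolding test_function_def by (auto intro: compact_imp_bounded)
  then obtain R where R: "R > 0" "\<And>y. y \<in> closure {y. \<phi> y \<noteq> 0} \<Longrightarrow> \<bar>y\<bar> \<le> R"
    by (auto simp: bounded_pos)
  have 1: "\<phi> y = 0" if "y \<notin> {-R..R}" for y
    using that R(2)[of y] closure_subset[of "{y. \<phi> y \<noteq> 0}"] by (cases "\<phi> y = 0") auto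
  have "deriv \<phi> y = 0" if "y \<notin> {-R..R}" for y
  proof -
    have "((\<lambda>_. 0) has_field_derivative 0) (at y)" by simp
    then have "(\<phi> has_field_derivative 0) (at y)"
      by (rule has_field_derivative_transform_within_open[of _ _ _ "- {-R..R}"])
         (use that 1 in \<open>auto simp: open_Compl\<close>)
    then show ?thesis by (rule DERIV_imp_deriv)
  qed
  with 1 R that show ?thesis by blast
qed

lemma smooth_on_real_deriv:
  fixes \<phi> :: "real \<Rightarrow> real"
  assumes "smooth_on UNIV \<phi>"
  shows "(\<phi> has_vector_derivative deriv \<phi> y) (at y)" "continuous_on UNIV (deriv \<phi>)"
proof -
  have d: "\<phi> differentiable (at y)" for y
    using assms[unfolded smooth_on_def, rule_format, of "Suc 0"] by simp
  have *: "(\<phi> has_field_derivative deriv \<phi> y) (at y)" for y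
    using d[of y] by (metis DERIV_imp_deriv real_differentiable_def)
  then show "(\<phi> has_vector_derivative deriv \<phi> y) (at y)"
    by (simp add: has_real_derivative_iff_has_vector_derivative)
  have "deriv \<phi> = (\<lambda>x. frechet_derivative \<phi> (at x) 1)"
    using frechet_derivative_at[OF *[unfolded has_field_derivative_def]] by (metis mult.right_neutral)
  then show "continuous_on UNIV (deriv \<phi>)"
    using assms[unfolded smooth_on_def, rule_format, of "Suc 0"] by simp
qed

lemma smooth_on_continuous: "smooth_on UNIV f \<Longrightarrow> continuous_on UNIV f"
  by (metis higher_differentiable_on.simps(1) smooth_on_def)

lemma test_function_C1:
  assumes "test_function \<phi>"
  obtains R where "R > 0" "continuous_on UNIV \<phi>" "continuous_on UNIV (deriv \<phi>)"
    "\<And>y. (\<phi> has_vector_derivative deriv \<phi> y) (at y)"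
    "\<And>y. y \<notin> {-R..R} \<Longrightarrow> \<phi> y = 0" "\<And>y. y \<notin> {-R..R} \<Longrightarrow> deriv \<phi> y = 0"
proof -
  have sm: "smooth_on UNIV \<phi>" using assms by (simp add: test_function_def)
  obtain R where R: "R > 0" "\<And>y. y \<notin> {-R..R} \<Longrightarrow> \<phi> y = 0" "\<And>y. y \<notin> {-R..R} \<Longrightarrow> deriv \<phi> y = 0"
    using test_function_support[OF assms] by blast
  show thesis
    by (rule that[OF R(1) smooth_on_continuous[OF sm] smooth_on_real_deriv(2)[OF sm] smooth_on_real_deriv(1)[OF sm] R(2,3)])
qed


section \<open>The fundamental lemma and approximation of integrable functions\<close>

lemma absolutely_integrable_scaleR_continuous:
  fixes \<phi> :: "real \<Rightarrow> real" and f :: "real \<Rightarrow> 'b::euclidean_space"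
  assumes "continuous_on {a..b} \<phi>" "f absolutely_integrable_on {a..b}"
  shows "(\<lambda>y. \<phi> y *\<^sub>R f y) absolutely_integrable_on {a..b}"
proof (rule absolutely_integrable_bounded_measurable_product[where h = "(*\<^sub>R)" and f = \<phi> and g = f])
  show "bilinear ((*\<^sub>R) :: real \<Rightarrow> 'b \<Rightarrow> 'b)"
    by (simp add: bilinear_conv_bounded_bilinear bounded_bilinear_scaleR)
  show "\<phi> \<in> borel_measurable (lebesgue_on {a..b})"
    by (intro continuous_imp_measurable_on_sets_lebesgue assms) auto
  show "bounded (\<phi> ` {a..b})"
    by (intro compact_imp_bounded compact_continuous_image assms) auto
qed (use assms in auto)

lemma lebesgue_integral_eq_integral_support:
  fixes f :: "real \<Rightarrow> 'b::euclidean_space"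
  assumes "f absolutely_integrable_on {a..b}" "\<And>y. y \<notin> {a..b} \<Longrightarrow> f y = 0"
  shows "integrable lebesgue f" "(LINT y|lebesgue. f y) = integral {a..b} f"
proof -
  have *: "(\<lambda>y. indicator {a..b} y *\<^sub>R f y) = f"
    using assms(2) by (auto simp: fun_eq_iff indicator_def)
  show "integrable lebesgue f"
    using assms(1) unfolding set_integrable_def * .
  show "(LINT y|lebesgue. f y) = integral {a..b} f"
    using set_lebesgue_integral_eq_integral(2)[OF assms(1)]
    unfolding set_lebesgue_integral_def * .
qed

lemma locally_integrable_absolutely:
  "locally_integrable v \<Longrightarrow> v absolutely_integrable_on {a..b}"
  by (simp add: locally_integrable_def)

lemma locally_integrable_continuous: "continuous_on UNIV u \<Longrightarrow> locally_integrable u"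
  unfolding locally_integrable_def
  by (auto intro!: absolutely_integrable_continuous_real intro: continuous_on_subset)

lemma locally_integrable_diff:
  "locally_integrable u \<Longrightarrow> locally_integrable v \<Longrightarrow> locally_integrable (\<lambda>y. u y - v y)"
  by (simp add: locally_integrable_def)

lemma test_function_integral:
  assumes "continuous_on UNIV \<phi>" "locally_integrable f" "\<And>y. y \<notin> {-R..R} \<Longrightarrow> \<phi> y = 0"
  shows "integrable lebesgue (\<lambda>y. \<phi> y *\<^sub>R f y)"
    "(LINT y|lebesgue. \<phi> y *\<^sub>R f y) = integral {-R..R} (\<lambda>y. \<phi> y *\<^sub>R f y)"
    "(\<lambda>y. \<phi> y *\<^sub>R f y) absolutely_integrable_on {-R..R}"
proof -
  show *: "(\<lambda>y. \<phi> y *\<^sub>R f y) absolutely_integrable_on {-R..R}"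
    using assms(1,2)
    by (intro absolutely_integrable_scaleR_continuous)
       (auto intro: continuous_on_subset locally_integrable_absolutely)
  show "integrable lebesgue (\<lambda>y. \<phi> y *\<^sub>R f y)"
    "(LINT y|lebesgue. \<phi> y *\<^sub>R f y) = integral {-R..R} (\<lambda>y. \<phi> y *\<^sub>R f y)"
    by (rule lebesgue_integral_eq_integral_support[OF *]; use assms(3) in simp)+
qed

lemma test_function_integrable:
  assumes "test_function \<phi>" "locally_integrable f"
  shows "integrable lebesgue (\<lambda>y. \<phi> y *\<^sub>R f y)" "integrable lebesgue (\<lambda>y. deriv \<phi> y *\<^sub>R f y)"
proof -
  obtain R where R: "R > 0" "continuous_on UNIV \<phi>" "continuous_on UNIV (deriv \<phi>)"
    "\<And>y. y \<notin> {-R..R} \<Longrightarrow> \<phi> y = 0" "\<And>y. y \<notin> {-R..R} \<Longrightarrow> deriv \<phi> y = 0"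
    using test_function_C1[OF assms(1)] by metis
  show "integrable lebesgue (\<lambda>y. \<phi> y *\<^sub>R f y)" by (rule test_function_integral(1)[OF R(2) assms(2) R(4)])
  show "integrable lebesgue (\<lambda>y. deriv \<phi> y *\<^sub>R f y)" by (rule test_function_integral(1)[OF R(3) assms(2) R(5)])
qed

text \<open>
  The one-sided averages of \<open>f\<close> over shrinking intervals are all zero, and almost everywhere they
  converge to \<open>f\<close>.
\<close>

lemma AE_zero_if_integrals_zero:
  fixes f :: "real \<Rightarrow> 'b::euclidean_space"
  assumes int: "\<And>a b. f integrable_on {a..b}" and zero: "\<And>a b. a < b \<Longrightarrow> integral {a..b} f = 0"
  shows "AE y in lebesgue. f y = 0"
proof -
  obtain N where N: "negligible N"
     "\<And>x e. \<lbrakk>x \<notin> N; 0 < e\<rbrakk> \<Longrightarrow> \<exists>d>0. \<forall>h. 0 < h \<and> h < d \<longrightarrow>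
         norm (integral (cbox x (x + h *\<^sub>R One)) f /\<^sub>R h ^ DIM(real) - f x) < e"
    using integrable_ccontinuous_explicit[of f] int by auto
  have "f x = 0" if "x \<notin> N" for x
  proof (rule ccontr)
    assume "f x \<noteq> 0"
    then have "0 < norm (f x)" by simp
    from N(2)[OF \<open>x \<notin> N\<close> this] obtain d where "d > 0" "\<forall>h. 0 < h \<and> h < d \<longrightarrow>
         norm (integral (cbox x (x + h *\<^sub>R One)) f /\<^sub>R h ^ DIM(real) - f x) < norm (f x)"
      by blast
    then have "norm (integral (cbox x (x + (d/2) *\<^sub>R One)) f /\<^sub>R (d/2) ^ DIM(real) - f x) < norm (f x)"
      by (elim allE[of _ "d/2"]) simp
    moreover have "integral (cbox x (x + (d/2) *\<^sub>R One)) f = 0"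
      using zero[of x "x + d/2"] \<open>d > 0\<close> by simp
    ultimately show False by simp
  qed
  then show ?thesis
    using N(1) by (intro AE_I'[of N]) (auto simp: negligible_iff_null_sets)
qed

text \<open>
  Testing with the plateau functions of an interval and passing to the limit by dominated convergence
  shows that the integral of \<open>f\<close> over that interval vanishes.
\<close>

lemma fundamental_lemma_test_functions:
  assumes f: "locally_integrable f"
    and zero: "\<And>\<psi>. test_function \<psi> \<Longrightarrow> (LINT y|lebesgue. \<psi> y *\<^sub>R f y) = 0"
  shows "AE y in lebesgue. f y = 0"
proof (rule AE_zero_if_integrals_zero)
  fix a b :: real
  show "f integrable_on {a..b}"
    using f by (simp add: locally_integrable_def set_lebesgue_integral_eq_integral(1))
  assume "a < b"
  let ?s = "\<lambda>n y. plateau a b (real (Suc n)) y *\<^sub>R f y"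
  have pl: "continuous_on UNIV (plateau a b (real (Suc n)))" for n
    by (rule smooth_on_continuous[OF plateau_smooth])
  have out: "y \<notin> {a..b} \<Longrightarrow> plateau a b (real (Suc n)) y = 0" for n y
    by (rule plateau_outside) auto
  have ai: "f absolutely_integrable_on {a..b}" using f by (rule locally_integrable_absolutely)
  have ai': "f absolutely_integrable_on {a<..<b}"
    using ai by (rule set_integrable_subset) auto
  have lim: "(\<lambda>n. LINT y|lebesgue. ?s n y) \<longlonglongrightarrow> (LINT y|lebesgue. indicator {a<..<b} y *\<^sub>R f y)"
  proof (rule integral_dominated_convergence[where w = "\<lambda>y. norm (indicator {a..b} y *\<^sub>R f y)"])
    show "(\<lambda>y. indicator {a<..<b} y *\<^sub>R f y) \<in> borel_measurable lebesgue"
      using ai' by (simp add: set_integrable_def)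
    show "?s n \<in> borel_measurable lebesgue" for n
    proof -
      have "(\<lambda>y. plateau a b (real (Suc n)) y *\<^sub>R f y) absolutely_integrable_on {a..b}"
        by (intro absolutely_integrable_scaleR_continuous ai continuous_on_subset[OF pl]) auto
      from lebesgue_integral_eq_integral_support(1)[OF this] out show ?thesis
        by (simp add: borel_measurable_integrable)
    qed
    show "integrable lebesgue (\<lambda>y. norm (indicator {a..b} y *\<^sub>R f y))"
      using ai by (simp only: set_integrable_def integrable_norm)
    show "AE y in lebesgue. (\<lambda>n. ?s n y) \<longlonglongrightarrow> indicator {a<..<b} y *\<^sub>R f y"
    proof (intro always_eventually allI)
      fix y
      show "(\<lambda>n. ?s n y) \<longlonglongrightarrow> indicator {a<..<b} y *\<^sub>R f y"
      proof (cases "y \<in> {a<..<b}")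
        case True
        then show ?thesis
          using tendsto_scaleR[OF plateau_tendsto[OF True] tendsto_const[of "f y"]] by simp
      qed (use plateau_outside[of _ y a b] in simp)
    qed
    show "AE y in lebesgue. norm (?s n y) \<le> norm (indicator {a..b} y *\<^sub>R f y)" for n
    proof (intro always_eventually allI)
      fix y
      show "norm (?s n y) \<le> norm (indicator {a..b} y *\<^sub>R f y)"
        using plateau_bounds[of a b "real (Suc n)" y] out[of y n]
        by (auto simp: indicator_def intro: mult_left_le_one_le)
    qed
  qed
  have "(LINT y|lebesgue. ?s n y) = 0" for n
    by (rule zero, rule test_functionI[OF plateau_smooth, of a b]) (rule out)
  then have "(LINT y|lebesgue. indicator {a<..<b} y *\<^sub>R f y) = 0"
    using lim by (simp only: tendsto_const_iff[OF trivial_limit_sequentially])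
  then have "integral {a<..<b} f = 0"
    using set_lebesgue_integral_eq_integral(2)[OF ai'] by (simp add: set_lebesgue_integral_def)
  then show "integral {a..b} f = 0"
    by (simp add: integral_open_interval_real)
qed

text \<open>
  The function is first truncated where it is large. The truncation is a pointwise limit of continuous
  functions, and composing these with the retraction onto a ball makes them bounded, so that dominated
  convergence applies in both steps.
\<close>

lemma L1_continuous_approximation:
  fixes v :: "real \<Rightarrow> 'b::euclidean_space"
  assumes v: "v absolutely_integrable_on {a..b}" and "e > 0"
  obtains w where "continuous_on UNIV w" "integral {a..b} (\<lambda>y. norm (v y - w y)) < e"
proof -
  let ?M = "lebesgue_on {a..b}"
  have fin: "finite_measure ?M" by (intro finite_measure_lebesgue_on) auto
  have vM: "integrable ?M v" using v by (simp add: integrable_restrict_space set_integrable_def)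
  define tr where "tr k y = (if norm (v y) \<le> real k then v y else 0)" for k y
  have vm[measurable]: "v \<in> borel_measurable ?M" using vM by auto
  have trm[measurable]: "tr k \<in> borel_measurable ?M" for k
    unfolding tr_def by measurable
  have "(\<lambda>k. LINT y|?M. norm (v y - tr k y)) \<longlonglongrightarrow> (LINT y|?M. 0)"
  proof (rule integral_dominated_convergence[where w = "\<lambda>y. norm (v y)"])
    show "AE y in ?M. (\<lambda>k. norm (v y - tr k y)) \<longlonglongrightarrow> 0"
    proof (rule always_eventually, rule allI, rule tendsto_eventually)
      fix y
      obtain K :: nat where "norm (v y) \<le> real K" using real_arch_simple by blast
      then show "\<forall>\<^sub>F k in sequentially. norm (v y - tr k y) = 0"
        by (auto simp: eventually_sequentially tr_def intro!: exI[of _ K])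
    qed
  next
    show "integrable ?M (\<lambda>y. norm (v y))" using vM by simp
  next
    show "AE y in ?M. norm (norm (v y - tr k y)) \<le> norm (v y)" for k
      by (auto simp: tr_def)
  qed measurable
  then have "(\<lambda>k. LINT y|?M. norm (v y - tr k y)) \<longlonglongrightarrow> 0" by simp
  then have "\<forall>\<^sub>F k in sequentially. (LINT y|?M. norm (v y - tr k y)) < e / 2"
    using \<open>e > 0\<close> by (intro order_tendstoD) auto
  then obtain k0 where "\<forall>k\<ge>k0. (LINT y|?M. norm (v y - tr k y)) < e / 2"
    by (auto simp: eventually_sequentially)
  then obtain k where k: "k > 0" "(LINT y|?M. norm (v y - tr k y)) < e / 2"
    by (metis le_add2 zero_less_Suc plus_1_eq_Suc add.commute le_Suc_eq)
  \<comment> \<open>The retraction onto the ball of radius \<open>k\<close> fixes the truncation and bounds its approximations.\<close>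
  define cl where "cl x = (real k / max (real k) (norm x)) *\<^sub>R x" for x :: 'b
  have clc: "continuous_on UNIV cl"
  proof -
    have "max (real k) (norm x) \<noteq> 0" for x :: 'b using k(1) by linarith
    then show ?thesis unfolding cl_def by (intro continuous_intros) simp
  qed
  have cln: "norm (cl x) \<le> real k" for x
    using k(1) by (auto simp: cl_def max_def pos_divide_le_eq)
  have clid: "norm x \<le> real k \<Longrightarrow> cl x = x" for x
    using k(1) by (auto simp: cl_def max_def)
  have trn: "norm (tr k y) \<le> real k" for y by (auto simp: tr_def)
  have "tr k measurable_on {a..b}"
    using trm by (simp add: measurable_on_iff_borel_measurable)
  then obtain N g where N: "negligible N" and g: "\<And>n. continuous_on UNIV (g n)"
    "\<And>x. x \<notin> N \<Longrightarrow> (\<lambda>n. g n x) \<longlonglongrightarrow> (if x \<in> {a..b} then tr k x else 0)"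
    unfolding measurable_on_def by auto
  have cg: "continuous_on UNIV (\<lambda>y. cl (g n y))" for n
    by (rule continuous_on_compose2[OF clc g(1)]) auto
  have cgm[measurable]: "(\<lambda>y. cl (g n y)) \<in> borel_measurable ?M" for n
    by (intro continuous_imp_measurable_on_sets_lebesgue continuous_on_subset[OF cg]) auto
  have "(\<lambda>n. LINT y|?M. norm (tr k y - cl (g n y))) \<longlonglongrightarrow> (LINT y|?M. 0)"
  proof (rule integral_dominated_convergence[where w = "\<lambda>y. 2 * real k"])
    show "integrable ?M (\<lambda>y. 2 * real k)"
      using fin by (rule finite_measure.integrable_const)
    show "AE y in ?M. norm (norm (tr k y - cl (g n y))) \<le> 2 * real k" for n
    proof (intro always_eventually allI)
      fix y show "norm (norm (tr k y - cl (g n y))) \<le> 2 * real k"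
        using norm_triangle_ineq4[of "tr k y" "cl (g n y)"] trn[of y] cln[of "g n y"] by simp
    qed
    have "AE y in lebesgue. y \<notin> N"
      using N by (intro AE_not_in) (simp add: negligible_iff_null_sets)
    then have "AE y in ?M. y \<notin> N \<and> y \<in> {a..b}"
      by (auto simp: AE_restrict_space_iff)
    then show "AE y in ?M. (\<lambda>n. norm (tr k y - cl (g n y))) \<longlonglongrightarrow> 0"
    proof (rule eventually_mono)
      fix y assume "y \<notin> N \<and> y \<in> {a..b}"
      then have "(\<lambda>n. g n y) \<longlonglongrightarrow> tr k y" using g(2)[of y] by simp
      then have "(\<lambda>n. cl (g n y)) \<longlonglongrightarrow> cl (tr k y)"
        using clc by (intro continuous_on_tendsto_compose[of UNIV cl]) auto
      then have "(\<lambda>n. tr k y - cl (g n y)) \<longlonglongrightarrow> 0"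
        using clid[OF trn[of y]] by (auto intro!: tendsto_eq_intros)
      then show "(\<lambda>n. norm (tr k y - cl (g n y))) \<longlonglongrightarrow> 0"
        by (rule tendsto_norm_zero)
    qed
  qed measurable
  then have "(\<lambda>n. LINT y|?M. norm (tr k y - cl (g n y))) \<longlonglongrightarrow> 0" by simp
  then have "\<forall>\<^sub>F n in sequentially. (LINT y|?M. norm (tr k y - cl (g n y))) < e / 2"
    using \<open>e > 0\<close> by (intro order_tendstoD) auto
  then obtain n where n: "(LINT y|?M. norm (tr k y - cl (g n y))) < e / 2"
    by (auto simp: eventually_sequentially)
  let ?w = "\<lambda>y. cl (g n y)"
  have itr: "integrable ?M (tr k)"
    by (rule Bochner_Integration.integrable_bound[OF vM]) (auto simp: tr_def)
  have iw: "integrable ?M ?w"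
    by (rule finite_measure.integrable_const_bound[OF fin, of _ "real k"]) (use cln in auto)
  have "(LINT y|?M. norm (v y - ?w y)) \<le> (LINT y|?M. norm (v y - tr k y) + norm (tr k y - ?w y))"
  proof (rule integral_mono)
    fix y show "norm (v y - ?w y) \<le> norm (v y - tr k y) + norm (tr k y - ?w y)"
      using norm_triangle_ineq[of "v y - tr k y" "tr k y - ?w y"] by simp
  qed (use vM itr iw in auto)
  also have "\<dots> < e"
    using k(2) n vM itr iw by (subst Bochner_Integration.integral_add) auto
  finally have *: "(LINT y|?M. norm (v y - ?w y)) < e" .
  have "(LINT y|?M. norm (v y - ?w y)) = integral {a..b} (\<lambda>y. norm (v y - ?w y))"
    using vM iw by (intro lebesgue_integral_eq_integral) auto
  with * cg that[of ?w] show thesis by simp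
qed


section \<open>Primitives and weak derivatives\<close>

text \<open>
  The absolutely continuous functions \<open>u\<close> with derivative \<open>v\<close>. Stated through the fundamental
  theorem of calculus, the notion passes to sums and limits without reference to pointwise derivatives.
\<close>

definition primitive :: "(real \<Rightarrow> real^2) \<Rightarrow> (real \<Rightarrow> real^2) \<Rightarrow> bool" where
  "primitive u v \<longleftrightarrow> locally_integrable v \<and> (\<forall>a b. a \<le> b \<longrightarrow> integral {a..b} v = u b - u a)"

lemma primitive_eq: "primitive u v \<Longrightarrow> a \<le> b \<Longrightarrow> u b = u a + integral {a..b} v"
  by (simp add: primitive_def)

lemma primitive_integrable:
  assumes "primitive u v"
  shows "v absolutely_integrable_on {a..b}" "v integrable_on {a..b}"
  using assms by (auto simp: primitive_def locally_integrable_def set_lebesgue_integral_eq_integral(1))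

lemma primitive_continuous: assumes "primitive u v" shows "continuous_on S u"
proof -
  have "continuous_on {-R<..<R} u" for R
  proof -
    have "continuous_on {-R..R} (\<lambda>y. u (-R) + integral {-R..y} v)"
      by (intro continuous_intros indefinite_integral_continuous_1 primitive_integrable(2)[OF assms])
    then have "continuous_on {-R..R} u"
      by (rule continuous_on_eq) (use primitive_eq[OF assms] in auto)
    then show ?thesis by (rule continuous_on_subset) auto
  qed
  then have "isCont u x" for x
    by (rule continuous_on_interior[where S="{-(\<bar>x\<bar>+1)<..<\<bar>x\<bar>+1}"]) (auto simp: abs_if)
  then show ?thesis by (simp add: continuous_at_imp_continuous_on)
qed

lemma primitive_add:
  assumes "primitive u v" "primitive u' v'"
  shows "primitive (\<lambda>y. u y + u' y) (\<lambda>y. v y + v' y)"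
  using assms primitive_integrable[OF assms(1)] primitive_integrable[OF assms(2)]
  by (auto simp: primitive_def locally_integrable_def integral_add)

lemma primitive_diff:
  assumes "primitive u v" "primitive u' v'"
  shows "primitive (\<lambda>y. u y - u' y) (\<lambda>y. v y - v' y)"
  using assms primitive_integrable[OF assms(1)] primitive_integrable[OF assms(2)]
  by (auto simp: primitive_def locally_integrable_def integral_diff)

lemma primitive_add_const: "primitive u v \<Longrightarrow> primitive (\<lambda>y. u y + c) v"
  by (simp add: primitive_def)

lemma primitive_C1:
  assumes "\<And>y. (u has_vector_derivative v y) (at y)" "continuous_on UNIV v"
  shows "primitive u v"
  unfolding primitive_def
  using assms locally_integrable_continuous
  by (auto intro!: integral_unique fundamental_theorem_of_calculus intro: has_vector_derivative_at_within)

lemma primitive_exists: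
  assumes "locally_integrable v"
  obtains u where "primitive u v"
proof -
  have i: "v integrable_on {a..b}" for a b
    using assms by (auto simp: locally_integrable_def set_lebesgue_integral_eq_integral(1))
  define u where "u y = (if 0 \<le> y then integral {0..y} v else - integral {y..0} v)" for y
  have "integral {a..b} v = u b - u a" if "a \<le> b" for a b
  proof -
    consider "0 \<le> a" | "a < 0" "0 \<le> b" | "b < 0" by linarith
    then show ?thesis
    proof cases
      case 1
      then show ?thesis using that Henstock_Kurzweil_Integration.integral_combine[of 0 a b v] i by (simp add: u_def algebra_simps)
    next
      case 2
      then show ?thesis using that Henstock_Kurzweil_Integration.integral_combine[of a 0 b v] i by (simp add: u_def algebra_simps)
    next
      case 3
      then show ?thesis using that Henstock_Kurzweil_Integration.integral_combine[of a b 0 v] i by (simp add: u_def algebra_simps)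
    qed
  qed
  then show thesis using assms by (intro that[of u]) (simp add: primitive_def)
qed

text \<open>
  On a bounded interval a primitive is the limit of \<open>C\<^sup>1\<close> functions: one approximates the derivative in
  \<open>L\<^sup>1\<close> and integrates.
\<close>

lemma primitive_approx:
  assumes p: "primitive u v" and "a \<le> b" "e > 0"
  obtains z w where "continuous_on UNIV w" "integral {a..b} (\<lambda>y. norm (v y - w y)) < e"
    "\<And>y. y \<in> {a..b} \<Longrightarrow> (z has_vector_derivative w y) (at y within {a..b})"
    "\<And>y. y \<in> {a..b} \<Longrightarrow> norm (u y - z y) < e" "z a = u a"
proof -
  obtain w where w: "continuous_on UNIV w" "integral {a..b} (\<lambda>y. norm (v y - w y)) < e"
    using L1_continuous_approximation[OF primitive_integrable(1)[OF p] \<open>e > 0\<close>] .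
  define z where "z y = u a + integral {a..y} w" for y
  have wi: "w absolutely_integrable_on {c..d}" for c d
    by (intro absolutely_integrable_continuous_real continuous_on_subset[OF w(1)]) auto
  have d: "(z has_vector_derivative w y) (at y within {a..b})" if "y \<in> {a..b}" for y
    unfolding z_def using that
    by (auto intro!: derivative_eq_intros integral_has_vector_derivative continuous_on_subset[OF w(1)])
  have "norm (u y - z y) < e" if "y \<in> {a..b}" for y
  proof -
    have ai: "(\<lambda>y. v y - w y) absolutely_integrable_on {c..d}" for c d
      using primitive_integrable(1)[OF p] wi by (rule set_integral_diff(1))
    then have ni: "(\<lambda>y. norm (v y - w y)) integrable_on {c..d}" for c d
      by (simp add: absolutely_integrable_on_def)
    have "u y - z y = integral {a..y} (\<lambda>y. v y - w y)"
      using that primitive_eq[OF p, of a y] primitive_integrable(2)[OF p, of a y] wi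
      by (subst integral_diff) (auto simp: z_def set_lebesgue_integral_eq_integral(1))
    also have "norm \<dots> \<le> integral {a..y} (\<lambda>y. norm (v y - w y))"
      using ai by (intro integral_norm_bound_integral ni) (auto simp: set_lebesgue_integral_eq_integral(1))
    also have "\<dots> \<le> integral {a..b} (\<lambda>y. norm (v y - w y))"
      using that by (intro integral_subset_le ni) auto
    finally show ?thesis using w(2) by simp
  qed
  then show thesis using that[OF w d] by (simp add: z_def)
qed

text \<open>
  Integration by parts is classical for the \<open>C\<^sup>1\<close> approximations, and both sides of the formula are
  continuous under the approximation.
\<close>

lemma primitive_has_weak_deriv:
  assumes p: "primitive u v"
  shows "has_weak_deriv u v"
  unfolding has_weak_deriv_def
proof (intro conjI allI impI)
  show lu: "locally_integrable u"
    using primitive_continuous[OF p] by (rule locally_integrable_continuous)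
  show lv: "locally_integrable v" using p by (simp add: primitive_def)
  fix \<phi> assume t: "test_function \<phi>"
  obtain R0 where R0: "R0 > 0" and c\<phi>: "continuous_on UNIV \<phi>" and d2: "continuous_on UNIV (deriv \<phi>)"
    and d1: "\<And>y. (\<phi> has_vector_derivative deriv \<phi> y) (at y)"
    and z: "\<And>y. y \<notin> {-R0..R0} \<Longrightarrow> \<phi> y = 0" "\<And>y. y \<notin> {-R0..R0} \<Longrightarrow> deriv \<phi> y = 0"
    using test_function_C1[OF t] by metis
  \<comment> \<open>The larger interval makes \<open>\<phi>\<close> vanish at the end points.\<close>
  define R where "R = R0 + 1"
  have R: "R > 0" "\<And>y. y \<notin> {-R..R} \<Longrightarrow> \<phi> y = 0" "\<And>y. y \<notin> {-R..R} \<Longrightarrow> deriv \<phi> y = 0"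
    and ends: "\<phi> R = 0" "\<phi> (-R) = 0"
    using R0 z by (auto simp: R_def)
  obtain C where C: "C > 0" "\<And>y. y \<in> {-R..R} \<Longrightarrow> \<bar>\<phi> y\<bar> \<le> C" "\<And>y. y \<in> {-R..R} \<Longrightarrow> \<bar>deriv \<phi> y\<bar> \<le> C"
  proof -
    have "bounded (\<phi> ` {-R..R} \<union> deriv \<phi> ` {-R..R})"
      by (intro bounded_Un[THEN iffD2] conjI compact_imp_bounded compact_continuous_image)
         (auto intro: continuous_on_subset[OF c\<phi>] continuous_on_subset[OF d2])
    then show thesis using that by (auto simp: bounded_pos)
  qed
  let ?I = "integral {-R..R}"
  have bound: "norm (?I (\<lambda>y. deriv \<phi> y *\<^sub>R u y) + ?I (\<lambda>y. \<phi> y *\<^sub>R v y)) \<le> e * (C * (2 * R) + C)"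
    if e: "e > 0" for e
  proof -
    obtain z w where w: "continuous_on UNIV w" "?I (\<lambda>y. norm (v y - w y)) < e"
    "\<And>y. y \<in> {-R..R} \<Longrightarrow> (z has_vector_derivative w y) (at y within {-R..R})"
    "\<And>y. y \<in> {-R..R} \<Longrightarrow> norm (u y - z y) < e" "z (-R) = u (-R)"
      by (rule primitive_approx[OF p, of "-R" R e]) (use R(1) e in auto)
    have "((\<lambda>y. \<phi> y *\<^sub>R w y + deriv \<phi> y *\<^sub>R z y) has_integral (\<phi> R *\<^sub>R z R - \<phi> (-R) *\<^sub>R z (-R))) {-R..R}"
    proof (rule fundamental_theorem_of_calculus)
      show "((\<lambda>x. \<phi> x *\<^sub>R z x) has_vector_derivative \<phi> y *\<^sub>R w y + deriv \<phi> y *\<^sub>R z y) (at y within {-R..R})"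
        if "y \<in> {-R..R}" for y
        using d1[of y] w(3)[OF that]
        by (intro has_vector_derivative_scaleR)
           (auto simp: has_real_derivative_iff_has_vector_derivative intro: has_vector_derivative_at_within)
    qed (use R(1) in auto)
    then have zz: "((\<lambda>y. \<phi> y *\<^sub>R w y + deriv \<phi> y *\<^sub>R z y) has_integral 0) {-R..R}"
      by (simp add: ends)
    have i1: "(\<lambda>y. deriv \<phi> y *\<^sub>R u y) integrable_on {-R..R}"
      by (intro integrable_continuous_interval continuous_intros continuous_on_subset[OF d2]
         primitive_continuous[OF p]) auto
    have a2: "(\<lambda>y. \<phi> y *\<^sub>R v y) absolutely_integrable_on {-R..R}"
      by (intro absolutely_integrable_scaleR_continuous primitive_integrable(1)[OF p] continuous_on_subset[OF c\<phi>]) auto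
    then have i2: "(\<lambda>y. \<phi> y *\<^sub>R v y) integrable_on {-R..R}"
      by (rule set_lebesgue_integral_eq_integral(1))
    have i3: "(\<lambda>y. \<phi> y *\<^sub>R w y + deriv \<phi> y *\<^sub>R z y) integrable_on {-R..R}"
      using zz by blast
    have aw: "w absolutely_integrable_on {-R..R}"
      by (intro absolutely_integrable_continuous_real continuous_on_subset[OF w(1)]) auto
    have nd: "(\<lambda>y. norm (v y - w y)) integrable_on {-R..R}"
      using set_integral_diff(1)[OF primitive_integrable(1)[OF p] aw] by (simp add: absolutely_integrable_on_def)
    have eq: "deriv \<phi> y *\<^sub>R u y + \<phi> y *\<^sub>R v y - (\<phi> y *\<^sub>R w y + deriv \<phi> y *\<^sub>R z y)
       = deriv \<phi> y *\<^sub>R (u y - z y) + \<phi> y *\<^sub>R (v y - w y)" for y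
      by (simp add: algebra_simps)
    have "?I (\<lambda>y. deriv \<phi> y *\<^sub>R u y) + ?I (\<lambda>y. \<phi> y *\<^sub>R v y)
       = ?I (\<lambda>y. deriv \<phi> y *\<^sub>R u y + \<phi> y *\<^sub>R v y - (\<phi> y *\<^sub>R w y + deriv \<phi> y *\<^sub>R z y))"
      using i1 i2 i3 zz by (simp add: integral_add integral_diff integrable_add integral_unique)
    also have "\<dots> = ?I (\<lambda>y. deriv \<phi> y *\<^sub>R (u y - z y) + \<phi> y *\<^sub>R (v y - w y))"
      unfolding eq ..
    also have "norm \<dots> \<le> ?I (\<lambda>y. C * e + C * norm (v y - w y))"
    proof (rule integral_norm_bound_integral)
      show "(\<lambda>y. deriv \<phi> y *\<^sub>R (u y - z y) + \<phi> y *\<^sub>R (v y - w y)) integrable_on {-R..R}"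
        unfolding eq[symmetric] by (rule integrable_diff[OF integrable_add[OF i1 i2] i3])
      show "(\<lambda>y. C * e + C * norm (v y - w y)) integrable_on {-R..R}"
        by (intro integrable_add integrable_on_mult_right nd) auto
      fix y assume y: "y \<in> {-R..R}"
      have "norm (deriv \<phi> y *\<^sub>R (u y - z y)) \<le> C * e"
        using C(3)[OF y] w(4)[OF y] C(1) by (auto intro!: mult_mono)
      moreover have "norm (\<phi> y *\<^sub>R (v y - w y)) \<le> C * norm (v y - w y)"
        using C(2)[OF y] by (auto intro!: mult_right_mono)
      ultimately show "norm (deriv \<phi> y *\<^sub>R (u y - z y) + \<phi> y *\<^sub>R (v y - w y)) \<le> C * e + C * norm (v y - w y)"
        by (meson add_mono norm_triangle_le)
    qed
    also have "\<dots> = C * e * (2 * R) + C * ?I (\<lambda>y. norm (v y - w y))"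
      using nd R(1) by (subst integral_add) (auto intro: integrable_on_mult_right)
    also have "\<dots> \<le> C * e * (2 * R) + C * e"
      using w(2) C(1) by simp
    also have "\<dots> = e * (C * (2 * R) + C)" by (simp add: algebra_simps)
    finally show ?thesis .
  qed
  have "C * (2 * R) + C > 0" using C R by (simp add: add_pos_pos)
  then have small: "norm (?I (\<lambda>y. deriv \<phi> y *\<^sub>R u y) + ?I (\<lambda>y. \<phi> y *\<^sub>R v y)) \<le> d" if "d > 0" for d
    using bound[of "d / (C * (2 * R) + C)"] that by simp
  have "norm (?I (\<lambda>y. deriv \<phi> y *\<^sub>R u y) + ?I (\<lambda>y. \<phi> y *\<^sub>R v y)) \<le> 0"
    by (rule field_le_epsilon) (use small in simp)
  then have "norm (?I (\<lambda>y. deriv \<phi> y *\<^sub>R u y) + ?I (\<lambda>y. \<phi> y *\<^sub>R v y)) = 0"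
    by simp
  then have "?I (\<lambda>y. deriv \<phi> y *\<^sub>R u y) = - ?I (\<lambda>y. \<phi> y *\<^sub>R v y)"
    by (simp add: eq_neg_iff_add_eq_0)
  then show "(LINT y|lebesgue. deriv \<phi> y *\<^sub>R u y) = - (LINT y|lebesgue. \<phi> y *\<^sub>R v y)"
    using test_function_integral(2)[OF d2 lu R(3)] test_function_integral(2)[OF c\<phi> lv R(2)] by simp
qed

lemma smooth_indefinite_integral:
  fixes \<theta> \<Theta> :: "real \<Rightarrow> real"
  assumes "smooth_on UNIV \<theta>" "\<And>y. (\<Theta> has_vector_derivative \<theta> y) (at y)"
  shows "smooth_on UNIV \<Theta>"
  unfolding smooth_on_def
proof
  fix k
  have "higher_differentiable_on UNIV \<Theta> (Suc k)"
    by (rule higher_differentiable_on_real_SucI[OF assms(2)])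
       (use assms(1) in \<open>auto simp: smooth_on_def intro!: higher_differentiable_on_scaleR[of \<theta>, simplified]\<close>)
  then show "higher_differentiable_on UNIV \<Theta> k" by (rule higher_differentiable_on_SucD)
qed

lemma integral_superset_eq:
  fixes f :: "'a::euclidean_space \<Rightarrow> 'b::banach"
  assumes "A \<subseteq> B" "\<And>y. y \<in> B - A \<Longrightarrow> f y = 0"
  shows "integral B f = integral A f"
proof -
  have "(\<lambda>x. if x \<in> B then f x else 0) = (\<lambda>x. if x \<in> A then f x else 0)"
    using assms by (auto simp: fun_eq_iff)
  then show ?thesis by (metis integral_restrict_UNIV)
qed

text \<open>
  The lemma of du Bois-Reymond. A test function is the derivative of a test function exactly when its
  integral vanishes, and every test function has that property after subtraction of a multiple of a fixed
  bump \<open>\<eta>\<close>. Hence \<open>w\<close> minus its mean against \<open>\<eta>\<close> is annihilated by all test functions.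
\<close>

lemma weak_deriv_zero_const:
  assumes l: "locally_integrable w"
    and z: "\<And>\<phi>. test_function \<phi> \<Longrightarrow> (LINT y|lebesgue. deriv \<phi> y *\<^sub>R w y) = 0"
  obtains K where "AE y in lebesgue. w y = K"
proof -
  define \<eta> where "\<eta> = plateau 0 1 1"
  have \<eta>s: "smooth_on UNIV \<eta>" unfolding \<eta>_def by (rule plateau_smooth)
  have \<eta>c: "continuous_on UNIV \<eta>" by (rule smooth_on_continuous[OF \<eta>s])
  define c0 where "c0 = integral {0..1} \<eta>"
  have "c0 \<noteq> 0"
  proof
    assume "c0 = 0"
    then have "(\<eta> has_integral 0) (cbox 0 1)"
      unfolding c0_def using integrable_continuous_interval[OF continuous_on_subset[OF \<eta>c], of 0 1]
      by (auto simp: has_integral_iff)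
    then have "\<eta> (1/2) = 0"
      by (intro has_integral_0_cbox_imp_0[of 0 1 \<eta>])
         (use continuous_on_subset[OF \<eta>c] in \<open>auto simp: \<eta>_def plateau_bounds\<close>)
    then show False using plateau_pos[of 1 "1/2" 0 1] by (simp add: \<eta>_def)
  qed
  \<comment> \<open>The mean of \<open>w\<close> against the bump \<open>\<eta>\<close>; the constant value of \<open>w\<close> can only be this one.\<close>
  define K where "K = (1 / c0) *\<^sub>R (LINT y|lebesgue. \<eta> y *\<^sub>R w y)"
  have "AE y in lebesgue. w y - K = 0"
  proof (rule fundamental_lemma_test_functions)
    show lK: "locally_integrable (\<lambda>y. w y - K)"
      by (intro locally_integrable_diff[OF l] locally_integrable_continuous) auto
    fix \<psi> assume t: "test_function \<psi>"
    then have sm: "smooth_on UNIV \<psi>" by (simp add: test_function_def)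
    obtain R0 where R0: "R0 > 0" "\<And>y. y \<notin> {-R0..R0} \<Longrightarrow> \<psi> y = 0"
      using test_function_support[OF t] by metis
    have c\<psi>: "continuous_on UNIV \<psi>"
      by (rule smooth_on_continuous[OF sm])
    define R where "R = max R0 1"
    have R: "R \<ge> 1" "\<And>y. y \<notin> {-R..R} \<Longrightarrow> \<psi> y = 0" "\<And>y. y \<notin> {-R..R} \<Longrightarrow> \<eta> y = 0"
    proof -
      show "R \<ge> 1" by (simp add: R_def)
      show "\<psi> y = 0" if "y \<notin> {-R..R}" for y
        by (rule R0(2)) (use that in \<open>auto simp: R_def\<close>)
      show "\<eta> y = 0" if "y \<notin> {-R..R}" for y
        unfolding \<eta>_def by (rule plateau_outside) (use that in \<open>auto simp: R_def\<close>)
    qed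
    define s where "s = integral {-R..R} \<psi>"
    define \<theta> where "\<theta> y = \<psi> y + (- (s / c0)) *\<^sub>R \<eta> y" for y
    have \<theta>s: "smooth_on UNIV \<theta>"
      using sm \<eta>s unfolding \<theta>_def smooth_on_def
      by (intro allI higher_differentiable_on_add higher_differentiable_on_scaleR) auto
    have c\<theta>: "continuous_on UNIV \<theta>"
      by (rule smooth_on_continuous[OF \<theta>s])
    have \<theta>0: "\<theta> y = 0" if "y \<notin> {-R..R}" for y using R(2,3)[OF that] by (simp add: \<theta>_def)
    define \<Theta> where "\<Theta> y = integral {-R-1..y} \<theta>" for y
    have \<eta>R: "integral {-R..R} \<eta> = c0"
      unfolding c0_def
      by (rule integral_superset_eq) (use R(1) plateau_outside[of 1 _ 0 1] in \<open>auto simp: \<eta>_def\<close>)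
    have tot: "integral {-R..R} \<theta> = 0"
    proof -
      have i: "\<eta> integrable_on {-R..R}" "\<psi> integrable_on {-R..R}"
        by (auto intro!: integrable_continuous_interval intro: continuous_on_subset[OF \<eta>c] continuous_on_subset[OF c\<psi>])
      have "integral {-R..R} \<theta> = s + (- (s / c0)) *\<^sub>R c0"
        unfolding \<theta>_def s_def \<eta>R[symmetric]
        by (simp only: integral_add[OF i(2) integrable_cmul[OF i(1)]] integral_cmul)
      then show ?thesis using \<open>c0 \<noteq> 0\<close> by simp
    qed
    have \<Theta>l: "\<Theta> y = 0" if "y < -R" for y
    proof -
      have "\<Theta> y = integral {} \<theta>"
        unfolding \<Theta>_def by (rule integral_superset_eq) (use that \<theta>0 in auto)
      then show ?thesis by simp
    qed
    have \<Theta>r: "\<Theta> y = 0" if "y > R" for y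
    proof -
      have "\<Theta> y = integral {-R..R} \<theta>"
        unfolding \<Theta>_def by (rule integral_superset_eq) (use that R(1) \<theta>0 in auto)
      then show ?thesis using tot by simp
    qed
    have d\<Theta>: "(\<Theta> has_vector_derivative \<theta> y) (at y)" for y
    proof (cases "y < -R")
      case True
      have "((\<lambda>_. 0) has_vector_derivative 0) (at y)" by simp
      then have "(\<Theta> has_vector_derivative 0) (at y)"
        by (rule has_vector_derivative_transform_within_open[of _ _ _ "{..<-R}"]) (use True \<Theta>l in auto)
      then show ?thesis using \<theta>0[of y] True by simp
    next
      case False
      have "(\<Theta> has_vector_derivative \<theta> y) (at y within {-R-1..y+1})"
        unfolding \<Theta>_def using False
        by (intro integral_has_vector_derivative continuous_on_subset[OF c\<theta>]) auto
      then show ?thesis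
        using False by (subst (asm) at_within_interior) auto
    qed
    have d\<Theta>': "deriv \<Theta> = \<theta>"
      using d\<Theta> by (auto simp: has_real_derivative_iff_has_vector_derivative[symmetric] intro!: DERIV_imp_deriv)
    have "test_function \<Theta>"
      by (rule test_functionI[OF smooth_indefinite_integral[OF \<theta>s d\<Theta>], of "-R" R]) (use \<Theta>l \<Theta>r in force)
    from z[OF this] have z0: "(LINT y|lebesgue. \<theta> y *\<^sub>R w y) = 0" by (simp add: d\<Theta>')
    have i\<psi>: "integrable lebesgue (\<lambda>y. \<psi> y *\<^sub>R w y)"
      by (rule test_function_integral(1)[OF c\<psi> l R(2)])
    have i\<eta>: "integrable lebesgue (\<lambda>y. \<eta> y *\<^sub>R w y)"
      by (rule test_function_integral(1)[OF \<eta>c l R(3)])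
    have lK': "locally_integrable (\<lambda>_. K)" by (intro locally_integrable_continuous) auto
    have iK: "integrable lebesgue (\<lambda>y. \<psi> y *\<^sub>R K)"
      by (rule test_function_integral(1)[OF c\<psi> lK' R(2)])
    have "(\<lambda>y. \<theta> y *\<^sub>R w y) = (\<lambda>y. \<psi> y *\<^sub>R w y - (s / c0) *\<^sub>R (\<eta> y *\<^sub>R w y))"
      by (simp add: \<theta>_def algebra_simps)
    with z0 have "0 = (LINT y|lebesgue. \<psi> y *\<^sub>R w y - (s / c0) *\<^sub>R (\<eta> y *\<^sub>R w y))"
      by simp
    also have "\<dots> = (LINT y|lebesgue. \<psi> y *\<^sub>R w y) - (s / c0) *\<^sub>R (LINT y|lebesgue. \<eta> y *\<^sub>R w y)"
      by (subst Bochner_Integration.integral_diff[OF i\<psi> Bochner_Integration.integrable_scaleR_right[OF i\<eta>]])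
         (simp only: Bochner_Integration.integral_scaleR_right)
    also have "(s / c0) *\<^sub>R (LINT y|lebesgue. \<eta> y *\<^sub>R w y) = s *\<^sub>R K" by (simp add: K_def)
    also have "s *\<^sub>R K = integral {-R..R} (\<lambda>y. \<psi> y *\<^sub>R K)"
      unfolding s_def
      by (rule integral_unique[symmetric], rule has_integral_scaleR_left, rule integrable_integral)
        (intro integrable_continuous_interval continuous_on_subset[OF c\<psi>], auto)
    also have "\<dots> = (LINT y|lebesgue. \<psi> y *\<^sub>R K)"
      by (rule test_function_integral(2)[symmetric, OF c\<psi> lK' R(2)])
    also have "(LINT y|lebesgue. \<psi> y *\<^sub>R w y) - \<dots> = (LINT y|lebesgue. \<psi> y *\<^sub>R (w y - K))"
      by (subst Bochner_Integration.integral_diff[OF i\<psi> iK, symmetric]) (simp add: scaleR_diff_right)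
    finally show "(LINT y|lebesgue. \<psi> y *\<^sub>R (w y - K)) = 0" by simp
  qed
  then show thesis by (intro that[of K]) auto
qed

text \<open>
  The difference of \<open>u\<close> and any primitive of \<open>v\<close> has weak derivative zero.
\<close>

lemma has_weak_deriv_imp_primitive:
  assumes "has_weak_deriv u v"
  obtains u' where "primitive u' v" "AE y in lebesgue. u y = u' y"
proof -
  have lu: "locally_integrable u" and lv: "locally_integrable v" using assms by (auto simp: has_weak_deriv_def)
  obtain u0 where u0: "primitive u0 v" using primitive_exists[OF lv] .
  then have w0: "has_weak_deriv u0 v" by (rule primitive_has_weak_deriv)
  then have lu0: "locally_integrable u0" by (simp add: has_weak_deriv_def)
  obtain K where K: "AE y in lebesgue. u y - u0 y = K"
  proof (rule weak_deriv_zero_const)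
    show "locally_integrable (\<lambda>y. u y - u0 y)" using lu lu0 by (rule locally_integrable_diff)
    fix \<phi> assume t: "test_function \<phi>"
    have "(LINT y|lebesgue. deriv \<phi> y *\<^sub>R u y) = (LINT y|lebesgue. deriv \<phi> y *\<^sub>R u0 y)"
      using assms w0 t by (simp add: has_weak_deriv_def)
    then show "(LINT y|lebesgue. deriv \<phi> y *\<^sub>R (u y - u0 y)) = 0"
      unfolding scaleR_diff_right
      by (subst Bochner_Integration.integral_diff[OF test_function_integrable(2)[OF t lu]
            test_function_integrable(2)[OF t lu0]]) simp
  qed
  show thesis
  proof (rule that)
    show "primitive (\<lambda>y. u0 y + K) v" using u0 by (rule primitive_add_const)
    show "AE y in lebesgue. u y = u0 y + K" using K by eventually_elim (simp add: algebra_simps)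
  qed
qed

lemma has_weak_deriv_unique:
  assumes "has_weak_deriv u v" "has_weak_deriv u v'"
  shows "AE y in lebesgue. v y = v' y"
proof -
  have lv: "locally_integrable v" "locally_integrable v'" using assms by (auto simp: has_weak_deriv_def)
  have "AE y in lebesgue. v y - v' y = 0"
  proof (rule fundamental_lemma_test_functions)
    show "locally_integrable (\<lambda>y. v y - v' y)" using lv by (rule locally_integrable_diff)
    fix \<psi> assume t: "test_function \<psi>"
    have "- (LINT y|lebesgue. \<psi> y *\<^sub>R v y) = - (LINT y|lebesgue. \<psi> y *\<^sub>R v' y)"
      using assms t unfolding has_weak_deriv_def by metis
    then show "(LINT y|lebesgue. \<psi> y *\<^sub>R (v y - v' y)) = 0"
      unfolding scaleR_diff_right
      by (subst Bochner_Integration.integral_diff[OF test_function_integrable(1)[OF t lv(1)]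
            test_function_integrable(1)[OF t lv(2)]]) simp
  qed
  then show ?thesis by simp
qed

lemma has_weak_deriv_weak_deriv: "has_weak_deriv u v \<Longrightarrow> has_weak_deriv u (weak_deriv u)"
  unfolding weak_deriv_def by (rule someI[of "has_weak_deriv u"])

lemma weak_deriv_AE: "has_weak_deriv u v \<Longrightarrow> AE y in lebesgue. weak_deriv u y = v y"
  by (rule has_weak_deriv_unique[OF has_weak_deriv_weak_deriv])


section \<open>Second-order estimates for the potential\<close>

definition dir_deriv :: "(real^2 \<Rightarrow> real) \<Rightarrow> real^2 \<Rightarrow> real^2 \<Rightarrow> real" where
  "dir_deriv W x h = frechet_derivative W (at x) h"

definition dir_deriv2 :: "(real^2 \<Rightarrow> real) \<Rightarrow> real^2 \<Rightarrow> real^2 \<Rightarrow> real^2 \<Rightarrow> real" where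
  "dir_deriv2 W x h k = frechet_derivative (\<lambda>x. dir_deriv W x h) (at x) k"

locale C2_function =
  fixes W :: "real^2 \<Rightarrow> real"
  assumes C2: "higher_differentiable_on UNIV W 2"
begin

lemma C2_unfold:
  "W differentiable (at x)" "(\<lambda>x. dir_deriv W x h) differentiable (at x)"
  "continuous_on UNIV (\<lambda>x. dir_deriv2 W x h k)"
  using C2 by (auto simp: numeral_2_eq_2 dir_deriv_def dir_deriv2_def)

lemma has_derivative_dir_deriv: "(W has_derivative dir_deriv W x) (at x)"
  using C2_unfold(1)[of x] unfolding dir_deriv_def by (simp add: frechet_derivative_works)

lemma has_derivative_dir_deriv2: "((\<lambda>x. dir_deriv W x h) has_derivative dir_deriv2 W x h) (at x)"
  using C2_unfold(2)[of h x] unfolding dir_deriv2_def by (simp add: frechet_derivative_works)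

lemma continuous_W: "continuous_on S W"
  using C2_unfold(1) by (auto intro!: continuous_at_imp_continuous_on differentiable_imp_continuous_within)

lemma continuous_dir_deriv: "continuous_on S (\<lambda>x. dir_deriv W x h)"
  using C2_unfold(2) by (auto intro!: continuous_at_imp_continuous_on differentiable_imp_continuous_within)

lemma linear_dir_deriv: "linear (dir_deriv W x)"
  using has_derivative_dir_deriv has_derivative_linear by blast

lemma dir_deriv_grad: "dir_deriv W x h = grad W x \<bullet> h"
proof -
  have "h = (\<Sum>i\<in>UNIV. (h $ i) *\<^sub>R axis i 1)"
    by (simp add: basis_expansion scalar_mult_eq_scaleR[symmetric])
  then have "dir_deriv W x h = (\<Sum>i\<in>UNIV. (h $ i) *\<^sub>R dir_deriv W x (axis i 1))"
    using linear_sum[OF linear_dir_deriv] linear_cmul[OF linear_dir_deriv] by (metis (no_types, lifting) sum.cong)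
  then show ?thesis
    by (simp add: grad_def inner_vec_def dir_deriv_def mult.commute)
qed

lemma continuous_grad: "continuous_on S (grad W)"
  unfolding grad_def dir_deriv_def[symmetric] by (intro continuous_intros continuous_dir_deriv)

lemma linear_dir_deriv2: "linear (dir_deriv2 W x h)"
  using has_derivative_dir_deriv2 has_derivative_linear by blast

lemma dir_deriv2_add_left: "dir_deriv2 W x (h + h') k = dir_deriv2 W x h k + dir_deriv2 W x h' k"
proof -
  have "(\<lambda>x. dir_deriv W x (h + h')) = (\<lambda>x. dir_deriv W x h + dir_deriv W x h')"
    using linear_add[OF linear_dir_deriv] by auto
  then have "((\<lambda>x. dir_deriv W x (h + h')) has_derivative (\<lambda>k. dir_deriv2 W x h k + dir_deriv2 W x h' k)) (at x)"
    by (simp add: has_derivative_add has_derivative_dir_deriv2)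
  from has_derivative_unique[OF has_derivative_dir_deriv2 this] show ?thesis by metis
qed

lemma dir_deriv2_scale_left: "dir_deriv2 W x (c *\<^sub>R h) k = c * dir_deriv2 W x h k"
proof -
  have "(\<lambda>x. dir_deriv W x (c *\<^sub>R h)) = (\<lambda>x. c * dir_deriv W x h)"
    using linear_cmul[OF linear_dir_deriv] by auto
  then have "((\<lambda>x. dir_deriv W x (c *\<^sub>R h)) has_derivative (\<lambda>k. c * dir_deriv2 W x h k)) (at x)"
    by (simp add: has_derivative_mult_right has_derivative_dir_deriv2)
  from has_derivative_unique[OF has_derivative_dir_deriv2 this] show ?thesis by metis
qed

lemma vec2_expand: "h = (h $ 1) *\<^sub>R axis 1 1 + (h $ 2) *\<^sub>R (axis 2 1 :: real^2)"
  by (simp add: vec_eq_iff forall_2 axis_def)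

definition hess :: "real^2 \<Rightarrow> 2 \<Rightarrow> 2 \<Rightarrow> real" where "hess x i j = dir_deriv2 W x (axis i 1) (axis j 1)"

lemma dir_deriv2_expand:
  "dir_deriv2 W x h h = (h$1)\<^sup>2 * hess x 1 1 + h$1 * h$2 * (hess x 1 2 + hess x 2 1) + (h$2)\<^sup>2 * hess x 2 2"
proof -
  have *: "dir_deriv2 W x k h = h$1 * dir_deriv2 W x k (axis 1 1) + h$2 * dir_deriv2 W x k (axis 2 1)" for k
    using linear_add[OF linear_dir_deriv2] linear_cmul[OF linear_dir_deriv2]
    by (subst vec2_expand[of h]) simp
  have "dir_deriv2 W x h k = h$1 * dir_deriv2 W x (axis 1 1) k + h$2 * dir_deriv2 W x (axis 2 1) k" for k
    by (subst vec2_expand[of h]) (simp add: dir_deriv2_add_left dir_deriv2_scale_left)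
  from this[of h] show ?thesis
    by (simp add: * hess_def algebra_simps power2_eq_square)
qed

lemma continuous_hess: "continuous_on S (\<lambda>x. hess x i j)"
  unfolding hess_def using C2_unfold(3) continuous_on_subset by blast

lemma abs_quadratic_le:
  fixes h :: "real^2"
  shows "\<bar>(h$1)\<^sup>2 * a + h$1 * h$2 * (b + c) + (h$2)\<^sup>2 * d\<bar> \<le> (\<bar>a\<bar> + \<bar>b\<bar> + \<bar>c\<bar> + \<bar>d\<bar>) * (norm h)\<^sup>2"
proof -
  have n: "\<bar>h$1\<bar> \<le> norm h" "\<bar>h$2\<bar> \<le> norm h" by (rule component_le_norm_cart)+
  have 1: "\<bar>(h$1)\<^sup>2 * a\<bar> \<le> \<bar>a\<bar> * (norm h)\<^sup>2" and 4: "\<bar>(h$2)\<^sup>2 * d\<bar> \<le> \<bar>d\<bar> * (norm h)\<^sup>2"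
    using n by (auto simp: abs_mult mult.commute intro!: mult_left_mono abs_le_square_iff[THEN iffD1])
  have "\<bar>h$1 * h$2\<bar> \<le> (norm h)\<^sup>2"
    using n by (auto simp: abs_mult power2_eq_square intro!: mult_mono)
  then have 2: "\<bar>h$1 * h$2 * (b + c)\<bar> \<le> (\<bar>b\<bar> + \<bar>c\<bar>) * (norm h)\<^sup>2"
    by (simp add: abs_mult mult.commute[of "\<bar>b\<bar> + \<bar>c\<bar>"] mult_mono)
  have "(\<bar>a\<bar> + \<bar>b\<bar> + \<bar>c\<bar> + \<bar>d\<bar>) * (norm h)\<^sup>2
    = \<bar>a\<bar> * (norm h)\<^sup>2 + (\<bar>b\<bar> + \<bar>c\<bar>) * (norm h)\<^sup>2 + \<bar>d\<bar> * (norm h)\<^sup>2"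
    by (simp add: algebra_simps)
  with 1 2 4 show ?thesis by linarith
qed

text \<open>
  Taylor's formula for the restriction of \<open>W\<close> to the segment from \<open>x\<close> to \<open>x + h\<close>.
\<close>

lemma taylor_exact:
  "\<exists>t. 0 < t \<and> t < 1 \<and> W (x + h) = W x + dir_deriv W x h + dir_deriv2 W (x + t *\<^sub>R h) h h / 2"
proof -
  define df where "df m s = (if m = 0 then W (x + s *\<^sub>R h) else if m = 1 then dir_deriv W (x + s *\<^sub>R h) h else dir_deriv2 W (x + s *\<^sub>R h) h h)"
    for m :: nat and s :: real
  have l: "((\<lambda>s. x + s *\<^sub>R h) has_derivative (\<lambda>k. k *\<^sub>R h)) (at s)" for s
    by (auto intro!: derivative_eq_intros)
  have 0: "((\<lambda>s. W (x + s *\<^sub>R h)) has_field_derivative dir_deriv W (x + s *\<^sub>R h) h) (at s)" for s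
    using has_derivative_compose[OF l[of s] has_derivative_dir_deriv] linear_cmul[OF linear_dir_deriv]
    by (simp add: has_field_derivative_def mult_commute_abs)
  have 1: "((\<lambda>s. dir_deriv W (x + s *\<^sub>R h) h) has_field_derivative dir_deriv2 W (x + s *\<^sub>R h) h h) (at s)" for s
    using has_derivative_compose[OF l[of s] has_derivative_dir_deriv2, of h] linear_cmul[OF linear_dir_deriv2]
    by (simp add: has_field_derivative_def mult_commute_abs)
  have "\<exists>t>0. t < 1 \<and> W (x + 1 *\<^sub>R h) = (\<Sum>m<2. df m 0 / fact m * 1 ^ m) + df 2 t / fact 2 * 1 ^ 2"
  proof (rule Maclaurin)
    show "df 0 = (\<lambda>s. W (x + s *\<^sub>R h))" by (simp add: df_def fun_eq_iff)
    show "\<forall>m t. m < 2 \<and> 0 \<le> t \<and> t \<le> 1 \<longrightarrow> (df m has_real_derivative df (Suc m) t) (at t)"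
    proof (intro allI impI)
      fix m :: nat and t :: real
      assume "m < 2 \<and> 0 \<le> t \<and> t \<le> 1"
      then consider "m = 0" | "m = 1" by linarith
      then show "(df m has_real_derivative df (Suc m) t) (at t)"
        using 0 1 by cases (auto simp: df_def[abs_def])
    qed
  qed auto
  then obtain t where t: "t > 0" "t < 1" "W (x + h) = (\<Sum>m<2. df m 0 / fact m) + df 2 t / fact 2" by auto
  then show ?thesis by (intro exI[of _ t]) (simp add: df_def numeral_2_eq_2)
qed

lemma taylor_bound:
  obtains C where "C > 0"
    "\<And>x h. norm x \<le> R \<Longrightarrow> norm (x + h) \<le> R \<Longrightarrow> \<bar>W (x + h) - W x - grad W x \<bullet> h\<bar> \<le> C * (norm h)\<^sup>2"
proof -
  have "\<exists>B. \<forall>x\<in>cball 0 R. \<bar>hess x i j\<bar> \<le> B" for i j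
  proof -
    have "bounded ((\<lambda>x. hess x i j) ` cball 0 R)"
      by (intro compact_imp_bounded compact_continuous_image continuous_hess) auto
    then show ?thesis by (auto simp: bounded_iff)
  qed
  then obtain B where B: "\<And>i j x. x \<in> cball 0 R \<Longrightarrow> \<bar>hess x i j\<bar> \<le> B i j" by metis
  define C where "C = \<bar>B 1 1\<bar> + \<bar>B 1 2\<bar> + \<bar>B 2 1\<bar> + \<bar>B 2 2\<bar> + 1"
  have C: "\<bar>W (x + h) - W x - grad W x \<bullet> h\<bar> \<le> C * (norm h)\<^sup>2" if xh: "norm x \<le> R" "norm (x + h) \<le> R" for x h
  proof -
    obtain t where t: "0 < t" "t < 1" "W (x + h) = W x + dir_deriv W x h + dir_deriv2 W (x + t *\<^sub>R h) h h / 2"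
      using taylor_exact[of x h] by blast
    let ?y = "x + t *\<^sub>R h"
    have "?y \<in> cball 0 R"
    proof -
      have "?y = (1 - t) *\<^sub>R x + t *\<^sub>R (x + h)" by (simp add: algebra_simps)
      moreover have "(1 - t) *\<^sub>R x + t *\<^sub>R (x + h) \<in> cball 0 R"
        using t xh by (intro convexD convex_cball) auto
      ultimately show ?thesis by simp
    qed
    then have "\<bar>hess ?y i j\<bar> \<le> \<bar>B i j\<bar>" for i j using B[of ?y i j] by simp
    then have "\<bar>hess ?y 1 1\<bar> + \<bar>hess ?y 1 2\<bar> + \<bar>hess ?y 2 1\<bar> + \<bar>hess ?y 2 2\<bar> \<le> C"
      unfolding C_def by (smt (verit))
    then have "\<bar>dir_deriv2 W ?y h h\<bar> \<le> C * (norm h)\<^sup>2"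
      unfolding dir_deriv2_expand by (intro order_trans[OF abs_quadratic_le] mult_right_mono) auto
    moreover have "C * (norm h)\<^sup>2 \<ge> 0" unfolding C_def by auto
    ultimately show ?thesis using t(3) by (auto simp: dir_deriv_grad)
  qed
  show thesis by (rule that[of C]) (use C in \<open>auto simp: C_def\<close>)
qed

lemma grad_zero_at_min:
  assumes "\<And>x. W x \<ge> W p"
  shows "grad W p = 0"
proof -
  have "dir_deriv W p = (\<lambda>v. 0)"
    using assms by (intro differential_zero_maxmin[where S = UNIV and x = p and f = W]) (auto intro: has_derivative_dir_deriv)
  then have "grad W p \<bullet> grad W p = 0" by (metis dir_deriv_grad)
  then show ?thesis by simp
qed

text \<open>
  At a well the gradient vanishes, so that \<open>W\<close> is of second order there. This makes the new parameter of
  the minimizing curve run to infinity.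
\<close>

lemma quadratic_upper_bound:
  assumes "\<And>x. W x \<ge> 0" "W p = 0"
  obtains C where "C > 0" "\<And>x. norm x \<le> R \<Longrightarrow> W x \<le> C * (norm (x - p))\<^sup>2"
proof -
  obtain C where C: "C > 0" "\<And>x h. norm x \<le> max R (norm p) \<Longrightarrow> norm (x + h) \<le> max R (norm p) \<Longrightarrow>
      \<bar>W (x + h) - W x - grad W x \<bullet> h\<bar> \<le> C * (norm h)\<^sup>2"
    using taylor_bound by blast
  have "grad W p = 0" using assms by (intro grad_zero_at_min) simp
  then show thesis
    using C(2)[of p "_ - p"] assms C(1) by (intro that[of C]) auto
qed

text \<open>
  The second derivative in a direction \<open>h\<close> is bounded below by a multiple of \<open>|h|\<^sup>2\<close> at the well, by
  compactness of the unit circle, and still by half of it nearby. This is what turns finite energy into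
  square integrability of the distance to the well.
\<close>

lemma quadratic_lower_bound:
  assumes "\<And>x. W x \<ge> 0" "W p = 0" "hessian_pos_def W p"
  obtains c r where "c > 0" "r > 0" "\<And>x. norm (x - p) \<le> r \<Longrightarrow> W x \<ge> c * (norm (x - p))\<^sup>2"
proof -
  have pos: "dir_deriv2 W p v v > 0" if "v \<noteq> 0" for v
    using assms(3) that by (simp add: hessian_pos_def_def dir_deriv2_def dir_deriv_def)
  have "continuous_on (sphere 0 1) (\<lambda>v. dir_deriv2 W p v v)"
    unfolding dir_deriv2_expand by (intro continuous_intros)
  moreover have "sphere (0::real^2) 1 \<noteq> {}" by simp
  ultimately obtain v0 where v0: "v0 \<in> sphere 0 1" "\<And>v. v \<in> sphere 0 1 \<Longrightarrow> dir_deriv2 W p v0 v0 \<le> dir_deriv2 W p v v"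
    using continuous_attains_inf[of "sphere (0::real^2) 1" "\<lambda>v. dir_deriv2 W p v v"] by auto
  define c0 where "c0 = dir_deriv2 W p v0 v0"
  have "c0 > 0" unfolding c0_def using v0(1) by (intro pos) auto
  have c0: "dir_deriv2 W p h h \<ge> c0 * (norm h)\<^sup>2" for h
  proof (cases "h = 0")
    case False
    let ?v = "(1 / norm h) *\<^sub>R h"
    have "c0 \<le> dir_deriv2 W p ?v ?v" unfolding c0_def by (rule v0(2)) (use False in simp)
    also have "dir_deriv2 W p ?v ?v = dir_deriv2 W p h h / (norm h)\<^sup>2"
      by (simp only: dir_deriv2_scale_left linear_cmul[OF linear_dir_deriv2]) (simp add: power2_eq_square)
    finally show ?thesis using False by (simp add: field_simps)
  qed (simp add: dir_deriv2_expand)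
  have "\<forall>i j. \<exists>d>0. \<forall>x. dist x p < d \<longrightarrow> dist (hess x i j) (hess p i j) < c0 / 8"
  proof (intro allI)
    fix i j :: 2
    have "c0 / 8 > 0" using \<open>c0 > 0\<close> by simp
    then show "\<exists>d>0. \<forall>x. dist x p < d \<longrightarrow> dist (hess x i j) (hess p i j) < c0 / 8"
      using continuous_hess[of UNIV i j] unfolding continuous_on_iff by blast
  qed
  then obtain d where d: "\<And>i j. d i j > 0" "\<And>i j x. dist x p < d i j \<Longrightarrow> dist (hess x i j) (hess p i j) < c0 / 8"
    by metis
  define r where "r = min (min (d 1 1) (d 1 2)) (min (d 2 1) (d 2 2)) / 2"
  have r: "r > 0" using d(1) by (simp add: r_def)
  have lb: "W x \<ge> c0 / 4 * (norm (x - p))\<^sup>2" if x: "norm (x - p) \<le> r" for x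
  proof -
    define h where "h = x - p"
    obtain t where t: "0 < t" "t < 1" "W (p + h) = W p + dir_deriv W p h + dir_deriv2 W (p + t *\<^sub>R h) h h / 2"
      using taylor_exact[of p h] by blast
    let ?y = "p + t *\<^sub>R h"
    have "dist ?y p \<le> r"
      using x t by (auto simp: dist_norm h_def intro: order_trans[OF mult_left_le_one_le])
    moreover have "r < d 1 1" "r < d 1 2" "r < d 2 1" "r < d 2 2"
      using d(1)[of 1 1] d(1)[of 1 2] d(1)[of 2 1] d(1)[of 2 2] unfolding r_def by linarith+
    ultimately have "dist ?y p < d i j" for i j
      using exhaust_2[of i] exhaust_2[of j] by auto
    then have dd: "\<bar>hess ?y i j - hess p i j\<bar> \<le> c0 / 8" for i j
      using d(2)[of ?y i j] by (simp add: dist_real_def)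
    have "\<bar>dir_deriv2 W ?y h h - dir_deriv2 W p h h\<bar> =
       \<bar>(h$1)\<^sup>2 * (hess ?y 1 1 - hess p 1 1) + h$1 * h$2 * ((hess ?y 1 2 - hess p 1 2) + (hess ?y 2 1 - hess p 2 1))
         + (h$2)\<^sup>2 * (hess ?y 2 2 - hess p 2 2)\<bar>"
      unfolding dir_deriv2_expand by (simp add: algebra_simps)
    also have "\<dots> \<le> c0 / 2 * (norm h)\<^sup>2"
      using dd[of 1 1] dd[of 1 2] dd[of 2 1] dd[of 2 2]
      by (intro order_trans[OF abs_quadratic_le] mult_right_mono) auto
    finally have "dir_deriv2 W ?y h h \<ge> c0 / 2 * (norm h)\<^sup>2"
      using c0[of h] by linarith
    moreover have "dir_deriv W p h = 0" using grad_zero_at_min[of p] assms(1,2) by (simp add: dir_deriv_grad)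
    ultimately show ?thesis using t(3) assms(2) by (simp add: h_def)
  qed
  show thesis by (rule that[of "c0/4" r]) (use \<open>c0 > 0\<close> r lb in auto)
qed

end


section \<open>Curves with given energy and area\<close>

text \<open>
  The numbers \<open>e\<close> and \<open>A\<close> are the energy and the area. The derivative \<open>\<gamma>'\<close> is an explicit argument
  and may fail to be one at finitely many points, so that curves can be concatenated.
\<close>

definition has_energy_area ::
  "(real^2 \<Rightarrow> real) \<Rightarrow> (real \<Rightarrow> real^2) \<Rightarrow> (real \<Rightarrow> real^2) \<Rightarrow> real \<Rightarrow> real \<Rightarrow> real \<Rightarrow> real \<Rightarrow> bool" where
  "has_energy_area W \<gamma> \<gamma>' a b e A \<longleftrightarrow>
     (\<exists>L. L-lipschitz_on {a..b} \<gamma>) \<and>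
     (\<exists>S. finite S \<and> (\<forall>t\<in>{a..b} - S. (\<gamma> has_vector_derivative \<gamma>' t) (at t within {a..b}))) \<and>
     (\<lambda>t. sqrt (W (\<gamma> t)) * norm (\<gamma>' t)) absolutely_integrable_on {a..b} \<and>
     integral {a..b} (\<lambda>t. sqrt (W (\<gamma> t)) * norm (\<gamma>' t)) = e \<and>
     (\<lambda>t. \<gamma> t $ 2 * \<gamma>' t $ 1) absolutely_integrable_on {a..b} \<and>
     - integral {a..b} (\<lambda>t. \<gamma> t $ 2 * \<gamma>' t $ 1) = A"

lemma has_energy_area_affine:
  assumes g: "has_energy_area W \<gamma> \<gamma>' a b e A" and m: "m > 0" and ab: "m * c + k = a" "m * d + k = b"
  shows "has_energy_area W (\<lambda>t. \<gamma> (m * t + k)) (\<lambda>t. m *\<^sub>R \<gamma>' (m * t + k)) c d e A"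
proof -
  let ?g = "\<lambda>t. m * t + k"
  have im: "?g ` {c..d} = {a..b}"
    using m by (simp add: image_affinity_atLeastAtMost ab[symmetric])
  have dg: "(?g has_field_derivative m) (at t within {c..d})" for t
    by (auto intro!: derivative_eq_intros)
  have inj: "inj_on ?g {c..d}" using m by (auto simp: inj_on_def)
  obtain L where L: "L-lipschitz_on {a..b} \<gamma>" using g by (auto simp: has_energy_area_def)
  obtain S where S: "finite S" "\<And>t. t \<in> {a..b} - S \<Longrightarrow> (\<gamma> has_vector_derivative \<gamma>' t) (at t within {a..b})"
    using g by (auto simp: has_energy_area_def)
  have "m-lipschitz_on {c..d} ?g"
    using m by (intro lipschitz_onI) (auto simp: dist_real_def abs_mult right_diff_distrib[symmetric])
  then have lip: "(L * m)-lipschitz_on {c..d} (\<lambda>t. \<gamma> (?g t))"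
    using L im by (intro lipschitz_on_compose2) auto
  have fin: "finite (?g -` S \<inter> {c..d})"
    using S(1) inj by (rule finite_vimage_IntI)
  have der: "((\<lambda>t. \<gamma> (?g t)) has_vector_derivative m *\<^sub>R \<gamma>' (?g t)) (at t within {c..d})"
    if "t \<in> {c..d} - (?g -` S \<inter> {c..d})" for t
  proof -
    have "?g t \<in> {a..b} - S" using that im by blast
    then have "(\<gamma> has_vector_derivative \<gamma>' (?g t)) (at (?g t) within ?g ` {c..d})"
      using S(2) im by simp
    then show ?thesis
      using vector_diff_chain_within[of ?g m t "{c..d}" \<gamma>] dg
      by (simp add: has_real_derivative_iff_has_vector_derivative o_def)
  qed
  have cov: "(\<lambda>t. m * f (?g t)) absolutely_integrable_on {c..d} \<and> integral {c..d} (\<lambda>t. m * f (?g t)) = I"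
    if "f absolutely_integrable_on {a..b}" "integral {a..b} f = I" for f :: "real \<Rightarrow> real" and I
  proof -
    have sl: "{c..d} \<in> sets lebesgue" by simp
    note cv = has_absolute_integral_change_of_variables_1'[where S = "{c..d}" and g = ?g and g' = "\<lambda>_. m",
        OF sl dg inj]
    have "(\<lambda>t. \<bar>m\<bar> * f (?g t)) absolutely_integrable_on {c..d} \<and> integral {c..d} (\<lambda>t. \<bar>m\<bar> * f (?g t)) = I"
      unfolding cv using that unfolding im by simp
    then show ?thesis using m by (simp only: abs_of_pos)
  qed
  have E: "(\<lambda>t. m * (sqrt (W (\<gamma> (?g t))) * norm (\<gamma>' (?g t)))) absolutely_integrable_on {c..d} \<and>
     integral {c..d} (\<lambda>t. m * (sqrt (W (\<gamma> (?g t))) * norm (\<gamma>' (?g t)))) = e"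
    by (rule cov) (use g in \<open>simp_all add: has_energy_area_def\<close>)
  have A: "(\<lambda>t. m * (\<gamma> (?g t) $ 2 * \<gamma>' (?g t) $ 1)) absolutely_integrable_on {c..d} \<and>
     integral {c..d} (\<lambda>t. m * (\<gamma> (?g t) $ 2 * \<gamma>' (?g t) $ 1)) = - A"
    by (rule cov) (use g in \<open>auto simp: has_energy_area_def\<close>)
  have eqs: "(\<lambda>t. sqrt (W (\<gamma> (?g t))) * norm (m *\<^sub>R \<gamma>' (?g t)))
      = (\<lambda>t. m * (sqrt (W (\<gamma> (?g t))) * norm (\<gamma>' (?g t))))"
    "(\<lambda>t. \<gamma> (?g t) $ 2 * (m *\<^sub>R \<gamma>' (?g t)) $ 1) = (\<lambda>t. m * (\<gamma> (?g t) $ 2 * \<gamma>' (?g t) $ 1))"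
    using m by (auto simp: mult_ac)
  show ?thesis
    unfolding has_energy_area_def eqs
  proof (intro conjI)
    show "\<exists>L. L-lipschitz_on {c..d} (\<lambda>t. \<gamma> (?g t))" using lip by blast
    show "\<exists>S. finite S \<and> (\<forall>t\<in>{c..d} - S. ((\<lambda>t. \<gamma> (?g t)) has_vector_derivative m *\<^sub>R \<gamma>' (?g t)) (at t within {c..d}))"
      using fin der by blast
    show "- integral {c..d} (\<lambda>t. m * (\<gamma> (?g t) $ 2 * \<gamma>' (?g t) $ 1)) = A"
      using A by linarith
  qed (use E A in auto)
qed

lemma has_energy_area_join:
  assumes 1: "has_energy_area W \<gamma>1 \<gamma>1' a b e1 A1" and 2: "has_energy_area W \<gamma>2 \<gamma>2' b c e2 A2"
    and eq: "\<gamma>1 b = \<gamma>2 b" and ab: "a < b" "b < c"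
  shows "has_energy_area W (\<lambda>t. if t \<le> b then \<gamma>1 t else \<gamma>2 t) (\<lambda>t. if t \<le> b then \<gamma>1' t else \<gamma>2' t) a c (e1 + e2) (A1 + A2)"
    (is "has_energy_area W ?g ?g' a c _ _")
proof -
  obtain L1 L2 where "L1-lipschitz_on {a..b} \<gamma>1" "L2-lipschitz_on {b..c} \<gamma>2"
    using 1 2 by (auto simp: has_energy_area_def)
  then have "(max L1 L2)-lipschitz_on {a..c} ?g"
    using eq by (intro lipschitz_on_concat) (auto intro: lipschitz_on_mono)
  moreover obtain S1 where S1: "finite S1" "\<And>t. t \<in> {a..b} - S1 \<Longrightarrow> (\<gamma>1 has_vector_derivative \<gamma>1' t) (at t within {a..b})"
    using 1 by (auto simp: has_energy_area_def)
  obtain S2 where S2: "finite S2" "\<And>t. t \<in> {b..c} - S2 \<Longrightarrow> (\<gamma>2 has_vector_derivative \<gamma>2' t) (at t within {b..c})"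
    using 2 by (auto simp: has_energy_area_def)
  have der: "(?g has_vector_derivative ?g' t) (at t within {a..c})" if t: "t \<in> {a..c} - (S1 \<union> S2 \<union> {b})" for t
  proof (cases "t < b")
    case True
    have "(\<gamma>1 has_vector_derivative \<gamma>1' t) (at t within {a..b})" using S1(2) t True by auto
    also have "at t within {a..b} = at t within {a..c}"
      by (rule at_within_nhd[of t "{..<b}"]) (use True ab in auto)
    finally have "(?g has_vector_derivative \<gamma>1' t) (at t within {a..c})"
      by (rule has_vector_derivative_transform_within[of _ _ _ _ "b - t"]) (use True t in \<open>auto simp: dist_real_def\<close>)
    then show ?thesis using True by simp
  next
    case False
    then have tb: "t > b" using t by auto
    have "(\<gamma>2 has_vector_derivative \<gamma>2' t) (at t within {b..c})" using S2(2) t tb by auto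
    also have "at t within {b..c} = at t within {a..c}"
      by (rule at_within_nhd[of t "{b<..}"]) (use tb ab in auto)
    finally have "(?g has_vector_derivative \<gamma>2' t) (at t within {a..c})"
      by (rule has_vector_derivative_transform_within[of _ _ _ _ "t - b"]) (use tb t in \<open>auto simp: dist_real_def\<close>)
    then show ?thesis using tb by simp
  qed
  have glue: "h absolutely_integrable_on {a..c} \<and> integral {a..c} h = integral {a..b} h1 + integral {b..c} h2"
    if h1: "h1 absolutely_integrable_on {a..b}" and h2: "h2 absolutely_integrable_on {b..c}"
      and hh: "\<And>t. t < b \<Longrightarrow> h t = h1 t" "\<And>t. t > b \<Longrightarrow> h t = h2 t" for h h1 h2 :: "real \<Rightarrow> real"
  proof -
    have a1: "h absolutely_integrable_on {a..b}"
      by (rule absolutely_integrable_spike[OF h1, of "{b}"]) (use hh in auto)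
    have a2: "h absolutely_integrable_on {b..c}"
      by (rule absolutely_integrable_spike[OF h2, of "{b}"]) (use hh in auto)
    have i1: "integral {a..b} h = integral {a..b} h1" by (rule integral_spike[of "{b}"]) (use hh in auto)
    have i2: "integral {b..c} h = integral {b..c} h2" by (rule integral_spike[of "{b}"]) (use hh in auto)
    have "{a..c} = {a..b} \<union> {b..c}" using ab by auto
    then have a: "h absolutely_integrable_on {a..c}"
      using absolutely_integrable_Un[OF a1 a2] by simp
    have "integral {a..c} h = integral {a..b} h + integral {b..c} h"
      using Henstock_Kurzweil_Integration.integral_combine[of a b c h] ab set_lebesgue_integral_eq_integral(1)[OF a] by simp
    with a i1 i2 show ?thesis by simp
  qed
  have "(\<lambda>t. sqrt (W (?g t)) * norm (?g' t)) absolutely_integrable_on {a..c} \<and>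
    integral {a..c} (\<lambda>t. sqrt (W (?g t)) * norm (?g' t)) = e1 + e2"
    using glue[of "\<lambda>t. sqrt (W (\<gamma>1 t)) * norm (\<gamma>1' t)" "\<lambda>t. sqrt (W (\<gamma>2 t)) * norm (\<gamma>2' t)"
        "\<lambda>t. sqrt (W (?g t)) * norm (?g' t)"] 1 2 by (simp add: has_energy_area_def)
  moreover have "(\<lambda>t. ?g t $ 2 * ?g' t $ 1) absolutely_integrable_on {a..c} \<and>
    - integral {a..c} (\<lambda>t. ?g t $ 2 * ?g' t $ 1) = A1 + A2"
    using glue[of "\<lambda>t. \<gamma>1 t $ 2 * \<gamma>1' t $ 1" "\<lambda>t. \<gamma>2 t $ 2 * \<gamma>2' t $ 1" "\<lambda>t. ?g t $ 2 * ?g' t $ 1"] 1 2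
    by (simp add: has_energy_area_def)
  moreover have "finite (S1 \<union> S2 \<union> {b})" using S1 S2 by simp
  ultimately show ?thesis unfolding has_energy_area_def using der by (intro conjI exI[of _ "max L1 L2"] exI[of _ "S1 \<union> S2 \<union> {b}"] ballI) simp_all
qed

definition joinable :: "(real^2 \<Rightarrow> real) \<Rightarrow> real^2 \<Rightarrow> real^2 \<Rightarrow> real \<Rightarrow> real \<Rightarrow> bool" where
  "joinable W p q e A \<longleftrightarrow>
     (\<exists>\<gamma> \<gamma>' a b. a < b \<and> has_energy_area W \<gamma> \<gamma>' a b e A \<and> \<gamma> a = p \<and> \<gamma> b = q)"

lemma joinable_on:
  assumes "joinable W p q e A" "c < d"
  obtains \<gamma> \<gamma>' where "has_energy_area W \<gamma> \<gamma>' c d e A" "\<gamma> c = p" "\<gamma> d = q"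
proof -
  obtain \<gamma> \<gamma>' a b where g: "a < b" "has_energy_area W \<gamma> \<gamma>' a b e A" "\<gamma> a = p" "\<gamma> b = q"
    using assms by (auto simp: joinable_def)
  define m where "m = (b - a) / (d - c)"
  define k where "k = a - m * c"
  have "m * (d - c) = b - a" using assms(2) by (simp add: m_def)
  then have m: "m * c + k = a" "m * d + k = b" by (auto simp: k_def algebra_simps)
  have m0: "m > 0" using g(1) assms(2) by (simp add: m_def)
  show thesis
    by (rule that[OF has_energy_area_affine[OF g(2) m0 m]]) (simp_all add: m g)
qed

lemma joinable_trans:
  assumes "joinable W p q e1 A1" "joinable W q r e2 A2"
  shows "joinable W p r (e1 + e2) (A1 + A2)"
proof -
  obtain \<gamma>1 \<gamma>1' where 1: "has_energy_area W \<gamma>1 \<gamma>1' 0 1 e1 A1" "\<gamma>1 0 = p" "\<gamma>1 1 = q"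
    using joinable_on[OF assms(1), of 0 1] by auto
  obtain \<gamma>2 \<gamma>2' where 2: "has_energy_area W \<gamma>2 \<gamma>2' 1 2 e2 A2" "\<gamma>2 1 = q" "\<gamma>2 2 = r"
    using joinable_on[OF assms(2), of 1 2] by auto
  have "has_energy_area W (\<lambda>t. if t \<le> 1 then \<gamma>1 t else \<gamma>2 t) (\<lambda>t. if t \<le> 1 then \<gamma>1' t else \<gamma>2' t)
      0 2 (e1 + e2) (A1 + A2)"
    by (rule has_energy_area_join[OF 1(1) 2(1)]) (use 1 2 in auto)
  then show ?thesis
    unfolding joinable_def using 1 2
    by (intro exI[of _ "\<lambda>t. if t \<le> 1 then \<gamma>1 t else \<gamma>2 t"] exI[of _ "\<lambda>t. if t \<le> 1 then \<gamma>1' t else \<gamma>2' t"]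
        exI[of _ "0::real"] exI[of _ "2::real"]) simp
qed

lemma joinable_imp_connecting_curve:
  assumes "joinable W p q e A"
  obtains \<gamma> where "\<gamma> \<in> connecting_curves p q" "curve_E W \<gamma> = e" "curve_P \<gamma> = A"
proof -
  obtain \<gamma> \<gamma>' where g: "has_energy_area W \<gamma> \<gamma>' 0 1 e A" "\<gamma> 0 = p" "\<gamma> 1 = q"
    using joinable_on[OF assms, of 0 1] by auto
  obtain L where L: "L-lipschitz_on {0..1} \<gamma>" using g(1) by (auto simp: has_energy_area_def)
  obtain S where S: "finite S" "\<And>t. t \<in> {0..1} - S \<Longrightarrow> (\<gamma> has_vector_derivative \<gamma>' t) (at t within {0..1})"
    using g(1) by (auto simp: has_energy_area_def)
  have d: "curve_deriv \<gamma> t = \<gamma>' t" if "t \<in> {0..1} - S" for t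
    using S(2)[OF that] that by (intro vector_derivative_within_cbox[of 0 1, simplified]) auto
  have nS: "negligible S" using S(1) by (rule negligible_finite)
  have val: "(LINT t:{0..1}|lebesgue. h t) = integral {0..1} h1"
    if "h1 absolutely_integrable_on {0..1}" "\<And>t. t \<in> {0..1} - S \<Longrightarrow> h t = h1 t" for h h1 :: "real \<Rightarrow> real"
  proof -
    have "h absolutely_integrable_on {0..1}"
      by (rule absolutely_integrable_spike[OF that(1) nS]) (use that(2) in auto)
    then have "(LINT t:{0..1}|lebesgue. h t) = integral {0..1} h"
      by (rule set_lebesgue_integral_eq_integral(2))
    also have "\<dots> = integral {0..1} h1"
      by (rule integral_spike[OF nS]) (use that(2) in auto)
    finally show ?thesis .
  qed
  show thesis
  proof
    show "\<gamma> \<in> connecting_curves p q"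
      unfolding connecting_curves_def locally_lipschitz_on_def
      by (intro CollectI conjI ballI exI[of _ "1::real"] exI[of _ L] lipschitz_on_subset[OF L]) (auto simp: g)
    show "curve_E W \<gamma> = e"
      unfolding curve_E_def using g(1) d
      by (subst val[of "\<lambda>t. sqrt (W (\<gamma> t)) * norm (\<gamma>' t)"]) (auto simp: has_energy_area_def)
    show "curve_P \<gamma> = A"
      unfolding curve_P_def using g(1) d
      by (subst val[of "\<lambda>t. \<gamma> t $ 2 * \<gamma>' t $ 1"]) (auto simp: has_energy_area_def)
  qed
qed

lemma joinable_C1:
  assumes W: "continuous_on UNIV W" and ab: "a < b"
    and z: "\<And>y. y \<in> {a..b} \<Longrightarrow> (z has_vector_derivative w y) (at y within {a..b})"
    and w: "continuous_on {a..b} w"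
  shows "joinable W (z a) (z b) (integral {a..b} (\<lambda>y. sqrt (W (z y)) * norm (w y)))
     (- integral {a..b} (\<lambda>y. z y $ 2 * w y $ 1))"
proof -
  have cz: "continuous_on {a..b} z"
    using z by (meson continuous_on_eq_continuous_within has_vector_derivative_continuous)
  have cW: "continuous_on {a..b} (\<lambda>y. W (z y))"
    by (rule continuous_on_compose2[OF W cz]) auto
  obtain L where L: "L > 0" "\<And>y. y \<in> {a..b} \<Longrightarrow> norm (w y) \<le> L"
    using compact_imp_bounded[OF compact_continuous_image[OF w]] by (auto simp: bounded_pos)
  have "L-lipschitz_on {a..b} z"
  proof (rule lipschitz_onI)
    fix x y assume xy: "x \<in> {a..b}" "y \<in> {a..b}"
    show "dist (z x) (z y) \<le> L * dist x y"
      unfolding dist_norm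
    proof (rule differentiable_bound[of "{a..b}" z "\<lambda>y k. k *\<^sub>R w y"])
      show "(z has_derivative (\<lambda>k. k *\<^sub>R w y)) (at y within {a..b})" if "y \<in> {a..b}" for y
        using z[OF that] by (simp add: has_vector_derivative_def)
      show "onorm (\<lambda>k. k *\<^sub>R w y) \<le> L" if "y \<in> {a..b}" for y
        by (rule onorm_bound) (use L that in \<open>auto simp: mult.commute[of L] intro!: mult_left_mono\<close>)
    qed (use xy in auto)
  qed (use L in auto)
  moreover have "(\<lambda>t. sqrt (W (z t)) * norm (w t)) absolutely_integrable_on {a..b}"
    "(\<lambda>t. z t $ 2 * w t $ 1) absolutely_integrable_on {a..b}"
    by (intro absolutely_integrable_continuous_real continuous_intros cW cz w)+
  ultimately have "has_energy_area W z w a b (integral {a..b} (\<lambda>y. sqrt (W (z y)) * norm (w y)))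
     (- integral {a..b} (\<lambda>y. z y $ 2 * w y $ 1))"
    unfolding has_energy_area_def using z by blast
  then show ?thesis using ab unfolding joinable_def by blast
qed

text \<open>
  The area of a segment is that of the trapezoid between it and the first coordinate axis, up to sign.
\<close>

lemma joinable_segment:
  assumes W: "continuous_on UNIV W" and M: "\<And>x. x \<in> closed_segment p q \<Longrightarrow> sqrt (W x) \<le> M"
  obtains e where "joinable W p q e (- ((p $ 2 + q $ 2) / 2 * (q $ 1 - p $ 1)))" "e \<le> M * norm (q - p)"
proof -
  define z where "z t = p + t *\<^sub>R (q - p)" for t :: real
  have j: "joinable W (z 0) (z 1) (integral {0..1} (\<lambda>y. sqrt (W (z y)) * norm (q - p)))
     (- integral {0..1} (\<lambda>y. z y $ 2 * (q - p) $ 1))"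
    by (rule joinable_C1[OF W]) (auto simp: z_def intro!: derivative_eq_intros)
  have cz: "continuous_on {0..1} z" unfolding z_def by (intro continuous_intros)
  have "((\<lambda>y. z y $ 2 * (q - p) $ 1) has_integral
     ((1 * p $ 2 + 1\<^sup>2 / 2 * (q $ 2 - p $ 2)) * (q $ 1 - p $ 1) - (0 * p $ 2 + 0\<^sup>2 / 2 * (q $ 2 - p $ 2)) * (q $ 1 - p $ 1))) {0..1}"
    by (rule fundamental_theorem_of_calculus)
       (auto simp: z_def has_real_derivative_iff_has_vector_derivative[symmetric] intro!: derivative_eq_intros)
  then have A: "integral {0..1} (\<lambda>y. z y $ 2 * (q - p) $ 1) = (p $ 2 + q $ 2) / 2 * (q $ 1 - p $ 1)"
    by (simp add: integral_unique field_simps)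
  have cW: "continuous_on {0..1} (\<lambda>y. W (z y))"
    by (rule continuous_on_compose2[OF W cz]) auto
  have "integral {0..1} (\<lambda>y. sqrt (W (z y)) * norm (q - p)) \<le> integral {0..1::real} (\<lambda>y. M * norm (q - p))"
  proof (rule Henstock_Kurzweil_Integration.integral_le)
    show "(\<lambda>y. sqrt (W (z y)) * norm (q - p)) integrable_on {0..1}"
      by (intro integrable_continuous_interval continuous_intros cW)
    fix y :: real assume "y \<in> {0..1}"
    then have "z y \<in> closed_segment p q"
      by (auto simp: z_def in_segment algebra_simps intro!: exI[of _ y])
    then show "sqrt (W (z y)) * norm (q - p) \<le> M * norm (q - p)" by (intro mult_right_mono M) auto
  qed auto
  then have e: "integral {0..1} (\<lambda>y. sqrt (W (z y)) * norm (q - p)) \<le> M * norm (q - p)" by simp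
  have "z 0 = p" "z 1 = q" by (simp_all add: z_def)
  with j A have "joinable W p q (integral {0..1} (\<lambda>y. sqrt (W (z y)) * norm (q - p)))
      (- ((p $ 2 + q $ 2) / 2 * (q $ 1 - p $ 1)))" by (simp only:)
  from that[OF this e] show thesis .
qed


section \<open>Completing an arc to a competitor\<close>

text \<open>
  The loop is a right triangle with legs \<open>r\<close> and \<open>|b| \<le> r\<close>; the sign of \<open>b\<close> selects the orientation. Its
  area is \<open>\<alpha>\<close>, whereas its energy is only of the order of its length, the square root of \<open>|\<alpha>|\<close>.
\<close>

lemma joinable_small_loop:
  assumes W: "continuous_on UNIV W" and W0: "\<And>x. W x \<ge> 0" and M: "\<And>x. x \<in> cball p 1 \<Longrightarrow> sqrt (W x) \<le> M"
    and \<alpha>: "\<bar>\<alpha>\<bar> \<le> 1/8"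
  obtains e where "joinable W p p e \<alpha>" "e \<le> 4 * M * sqrt (2 * \<bar>\<alpha>\<bar>)"
proof -
  define r where "r = sqrt (2 * \<bar>\<alpha>\<bar>)"
  define b where "b = sgn \<alpha> * r"
  have r0: "r \<ge> 0" by (simp add: r_def)
  have "r \<le> sqrt ((1/2)\<^sup>2)" unfolding r_def using \<alpha> by (intro real_sqrt_le_mono) (simp add: power2_eq_square)
  then have r1: "r \<le> 1/2" by simp
  have rb: "r * b / 2 = \<alpha>"
    unfolding b_def r_def by (auto simp: sgn_if)
  have b: "\<bar>b\<bar> \<le> r" using r0 by (auto simp: b_def sgn_if)
  define x1 where "x1 = p + r *\<^sub>R axis 1 1"
  define x2 where "x2 = x1 + b *\<^sub>R axis 2 1"
  have n1: "norm (x1 - p) = r" using r0 by (simp add: x1_def norm_axis_1)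
  have n2: "norm (x2 - x1) \<le> r" using b by (simp add: x2_def norm_axis_1)
  have n3: "norm (p - x2) \<le> 2 * r"
    using norm_triangle_ineq[of "x2 - x1" "x1 - p"] n1 n2 by (simp add: norm_minus_commute)
  have inb: "p \<in> cball p 1" "x1 \<in> cball p 1" "x2 \<in> cball p 1"
    using n1 n3 r1 by (auto simp: dist_norm norm_minus_commute)
  have seg: "sqrt (W x) \<le> M" if "x \<in> closed_segment y z" "y \<in> cball p 1" "z \<in> cball p 1" for x y z
    using that closed_segment_subset[of y "cball p 1" z] by (intro M) auto
  obtain e1 where e1: "joinable W p x1 e1 (- ((p $ 2 + x1 $ 2) / 2 * (x1 $ 1 - p $ 1)))" "e1 \<le> M * norm (x1 - p)"
    using joinable_segment[OF W, of p x1 M] seg inb by metis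
  obtain e2 where e2: "joinable W x1 x2 e2 (- ((x1 $ 2 + x2 $ 2) / 2 * (x2 $ 1 - x1 $ 1)))" "e2 \<le> M * norm (x2 - x1)"
    using joinable_segment[OF W, of x1 x2 M] seg inb by metis
  obtain e3 where e3: "joinable W x2 p e3 (- ((x2 $ 2 + p $ 2) / 2 * (p $ 1 - x2 $ 1)))" "e3 \<le> M * norm (p - x2)"
    using joinable_segment[OF W, of x2 p M] seg inb by metis
  have M0: "M \<ge> 0"
    using M[OF inb(1)] W0[of p] real_sqrt_ge_zero[of "W p"] by linarith
  have c: "x1 $ 1 = p $ 1 + r" "x1 $ 2 = p $ 2" "x2 $ 1 = p $ 1 + r" "x2 $ 2 = p $ 2 + b"
    by (auto simp: x1_def x2_def axis_def)
  have "- ((p $ 2 + x1 $ 2) / 2 * (x1 $ 1 - p $ 1)) + - ((x1 $ 2 + x2 $ 2) / 2 * (x2 $ 1 - x1 $ 1))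
     + - ((x2 $ 2 + p $ 2) / 2 * (p $ 1 - x2 $ 1)) = r * b / 2"
    unfolding c by (simp add: field_simps)
  then have j: "joinable W p p (e1 + e2 + e3) \<alpha>"
    using joinable_trans[OF joinable_trans[OF e1(1) e2(1)] e3(1)] by (simp only: rb)
  have "e1 + e2 + e3 \<le> M * r + M * r + M * (2 * r)"
    using e1(2)[unfolded n1] e2(2) e3(2) mult_left_mono[OF n2 M0] mult_left_mono[OF n3 M0] by linarith
  then show thesis using that[OF j] by (simp add: r_def)
qed

text \<open>
  Continuity of the integral of a product under uniform convergence of the first factor and \<open>L\<^sup>1\<close>
  convergence of the second one. Both the energy and the area of a curve have this form.
\<close>

lemma integral_product_diff_le:
  fixes f f' h h' d m :: "real \<Rightarrow> real"
  assumes i: "(\<lambda>y. f' y * h' y) integrable_on {a..b}" "(\<lambda>y. f y * h y) integrable_on {a..b}"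
      "d integrable_on {a..b}" "m integrable_on {a..b}"
    and f: "\<And>y. y \<in> {a..b} \<Longrightarrow> \<bar>f' y\<bar> \<le> M" "\<And>y. y \<in> {a..b} \<Longrightarrow> \<bar>f' y - f y\<bar> \<le> \<epsilon>"
    and h: "\<And>y. \<bar>h' y - h y\<bar> \<le> d y" "\<And>y. \<bar>h y\<bar> \<le> m y" and pos: "M \<ge> 0" "\<epsilon> \<ge> 0"
  shows "\<bar>integral {a..b} (\<lambda>y. f' y * h' y) - integral {a..b} (\<lambda>y. f y * h y)\<bar>
    \<le> M * integral {a..b} d + \<epsilon> * integral {a..b} m"
proof -
  have "\<bar>integral {a..b} (\<lambda>y. f' y * h' y) - integral {a..b} (\<lambda>y. f y * h y)\<bar>
      = norm (integral {a..b} (\<lambda>y. f' y * h' y - f y * h y))"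
    using i by (simp add: integral_diff)
  also have "\<dots> \<le> integral {a..b} (\<lambda>y. M * d y + \<epsilon> * m y)"
  proof (rule integral_norm_bound_integral)
    fix y assume y: "y \<in> {a..b}"
    have "\<bar>f' y * h' y - f y * h y\<bar> = \<bar>f' y * (h' y - h y) + (f' y - f y) * h y\<bar>"
      by (simp add: algebra_simps)
    also have "\<dots> \<le> \<bar>f' y\<bar> * \<bar>h' y - h y\<bar> + \<bar>f' y - f y\<bar> * \<bar>h y\<bar>"
      by (metis abs_mult abs_triangle_ineq)
    also have "\<dots> \<le> M * d y + \<epsilon> * m y"
      by (intro add_mono mult_mono f[OF y] h pos abs_ge_zero)
    finally show "norm (f' y * h' y - f y * h y) \<le> M * d y + \<epsilon> * m y" by simp
  qed (intro integrable_diff integrable_add integrable_on_mult_right i)+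
  also have "\<dots> = M * integral {a..b} d + \<epsilon> * integral {a..b} m"
    using i(3,4) by (subst integral_add) (auto intro: integrable_on_mult_right)
  finally show ?thesis .
qed

text \<open>
  Energy and area are continuous under the approximation of a primitive by \<open>C\<^sup>1\<close> functions: the position
  converges uniformly and the velocity in \<open>L\<^sup>1\<close>.
\<close>

lemma energy_area_approx:
  assumes W: "continuous_on UNIV W" and p: "primitive u v" and ab: "a < b" and \<delta>: "\<delta> > 0"
  obtains z w where "continuous_on UNIV w"
    "\<And>y. y \<in> {a..b} \<Longrightarrow> (z has_vector_derivative w y) (at y within {a..b})"
    "z a = u a" "norm (u b - z b) < \<delta>"
    "\<bar>integral {a..b} (\<lambda>y. sqrt (W (z y)) * norm (w y)) - integral {a..b} (\<lambda>y. sqrt (W (u y)) * norm (v y))\<bar> < \<delta>"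
    "\<bar>integral {a..b} (\<lambda>y. z y $ 2 * w y $ 1) - integral {a..b} (\<lambda>y. u y $ 2 * v y $ 1)\<bar> < \<delta>"
proof -
  let ?F = "\<lambda>x. sqrt (W x)"
  have cu: "continuous_on S u" for S using p by (rule primitive_continuous)
  obtain B where B: "B > 0" "\<And>y. y \<in> {a..b} \<Longrightarrow> norm (u y) \<le> B"
    using compact_imp_bounded[OF compact_continuous_image[OF cu, of "{a..b}"]] by (auto simp: bounded_pos)
  have cF: "continuous_on S ?F" for S
    by (intro continuous_intros continuous_on_subset[OF W]) auto
  obtain M where M: "M > 0" "\<And>x. x \<in> cball 0 (B + 1) \<Longrightarrow> \<bar>?F x\<bar> \<le> M"
    using compact_imp_bounded[OF compact_continuous_image[OF cF, of "cball 0 (B+1)"]] by (auto simp: bounded_pos)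
  define V where "V = integral {a..b} (\<lambda>y. norm (v y))"
  have av: "v absolutely_integrable_on {a..b}" using p by (rule primitive_integrable(1))
  then have nv: "(\<lambda>y. norm (v y)) integrable_on {a..b}" by (simp add: absolutely_integrable_on_def)
  have V0: "V \<ge> 0" unfolding V_def by (rule integral_nonneg[OF nv]) auto
  \<comment> \<open>The energy error is at most \<open>M e + \<epsilon> V\<close> and the area error at most \<open>(B + 1) e + e V\<close>; the constants
    below make both smaller than \<open>\<delta>\<close>.\<close>
  define \<epsilon> where "\<epsilon> = \<delta> / (2 * (V + 1))"
  have \<epsilon>: "\<epsilon> > 0" using V0 \<delta> by (simp add: \<epsilon>_def)
  have "uniformly_continuous_on (cball 0 (B + 1)) ?F"
    by (intro compact_uniformly_continuous cF) auto
  then obtain d where d: "d > 0" "\<And>x x'. x \<in> cball 0 (B + 1) \<Longrightarrow> x' \<in> cball 0 (B + 1) \<Longrightarrow> dist x' x < d \<Longrightarrow> dist (?F x') (?F x) < \<epsilon>"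
    using \<epsilon> unfolding uniformly_continuous_on_def by metis
  define C where "C = M + B + V + 2"
  have C: "C > 0" using M B V0 by (simp add: C_def)
  define e where "e = min (min d 1) (min \<delta> (\<delta> / (2 * C)))"
  have e: "e > 0" "e \<le> d" "e \<le> 1" "e \<le> \<delta>" "e * C \<le> \<delta> / 2"
  proof -
    show "e > 0" using d(1) \<delta> C by (simp add: e_def)
    have "e \<le> \<delta> / (2 * C)" by (simp add: e_def)
    then show "e * C \<le> \<delta> / 2" using C by (simp add: field_simps)
  qed (auto simp: e_def)
  obtain z w where w: "continuous_on UNIV w" "integral {a..b} (\<lambda>y. norm (v y - w y)) < e"
    "\<And>y. y \<in> {a..b} \<Longrightarrow> (z has_vector_derivative w y) (at y within {a..b})"
    "\<And>y. y \<in> {a..b} \<Longrightarrow> norm (u y - z y) < e" "z a = u a"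
    by (rule primitive_approx[OF p, of a b e]) (use ab e in auto)
  have cz: "continuous_on {a..b} z"
    using w(3) by (meson continuous_on_eq_continuous_within has_vector_derivative_continuous)
  have aw: "w absolutely_integrable_on {a..b}"
    by (intro absolutely_integrable_continuous_real continuous_on_subset[OF w(1)]) auto
  have nd: "(\<lambda>y. norm (v y - w y)) integrable_on {a..b}"
    using set_integral_diff(1)[OF av aw] by (simp add: absolutely_integrable_on_def)
  have zb: "z y \<in> cball 0 (B + 1)" "u y \<in> cball 0 (B + 1)" if "y \<in> {a..b}" for y
    using B(2)[OF that] w(4)[OF that] e(3) norm_triangle_ineq4[of "u y" "u y - z y"] by auto
  have cFz: "continuous_on {a..b} (\<lambda>y. ?F (z y))" "continuous_on {a..b} (\<lambda>y. ?F (u y))"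
    by (rule continuous_on_compose2[OF cF[of UNIV]]; auto intro: cz cu)+
  have i1: "(\<lambda>y. ?F (z y) * norm (w y)) integrable_on {a..b}" "(\<lambda>y. z y $ 2 * w y $ 1) integrable_on {a..b}"
    by (intro integrable_continuous_interval continuous_intros cFz cz continuous_on_subset[OF w(1)]; simp)+
  have v1: "(\<lambda>y. v y $ 1) absolutely_integrable_on {a..b}"
    using absolutely_integrable_linear[OF av bounded_linear_vec_nth] by (simp add: o_def)
  have i2: "(\<lambda>y. ?F (u y) * norm (v y)) integrable_on {a..b}" "(\<lambda>y. u y $ 2 * v y $ 1) integrable_on {a..b}"
    using absolutely_integrable_scaleR_continuous[OF cFz(2) absolutely_integrable_norm[OF av]]
      absolutely_integrable_scaleR_continuous[OF _ v1, of "\<lambda>y. u y $ 2"] cu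
    by (auto simp: o_def intro!: set_lebesgue_integral_eq_integral(1) continuous_intros)
  have "\<bar>integral {a..b} (\<lambda>y. ?F (z y) * norm (w y)) - integral {a..b} (\<lambda>y. ?F (u y) * norm (v y))\<bar>
      \<le> M * integral {a..b} (\<lambda>y. norm (v y - w y)) + \<epsilon> * V"
    unfolding V_def
  proof (rule integral_product_diff_le[OF i1(1) i2(1) nd nv])
    show "\<bar>norm (w y) - norm (v y)\<bar> \<le> norm (v y - w y)" for y
      by (metis norm_minus_commute norm_triangle_ineq3)
    show "\<bar>?F (z y) - ?F (u y)\<bar> \<le> \<epsilon>" if y: "y \<in> {a..b}" for y
      using d(2)[OF zb(2)[OF y] zb(1)[OF y]] w(4)[OF y] e(2)
      by (auto simp: dist_norm norm_minus_commute)
  qed (use M zb \<epsilon> in auto)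
  also have "\<dots> < \<delta>"
  proof -
    have "M * integral {a..b} (\<lambda>y. norm (v y - w y)) \<le> M * e" using w(2) M(1) by simp
    also have "\<dots> \<le> e * C" using e(1) B(1) V0 by (simp add: C_def algebra_simps)
    finally have 1: "M * integral {a..b} (\<lambda>y. norm (v y - w y)) \<le> \<delta> / 2" using e(5) by linarith
    have "\<epsilon> * (V + 1) = \<delta> / 2" using V0 by (simp add: \<epsilon>_def field_simps)
    then have "\<epsilon> * V < \<delta> / 2" using \<epsilon> by (simp add: algebra_simps)
    then show ?thesis using 1 by linarith
  qed
  finally have E: "\<bar>integral {a..b} (\<lambda>y. ?F (z y) * norm (w y)) - integral {a..b} (\<lambda>y. ?F (u y) * norm (v y))\<bar> < \<delta>" .
  have "\<bar>integral {a..b} (\<lambda>y. z y $ 2 * w y $ 1) - integral {a..b} (\<lambda>y. u y $ 2 * v y $ 1)\<bar>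
      \<le> (B + 1) * integral {a..b} (\<lambda>y. norm (v y - w y)) + e * V"
    unfolding V_def
  proof (rule integral_product_diff_le[OF i1(2) i2(2) nd nv])
    show "\<bar>z y $ 2\<bar> \<le> B + 1" if "y \<in> {a..b}" for y
      using zb(1)[OF that] component_le_norm_cart[of "z y" 2] by auto
    show "\<bar>w y $ 1 - v y $ 1\<bar> \<le> norm (v y - w y)" for y
      using component_le_norm_cart[of "v y - w y" 1] by (simp add: abs_minus_commute)
    show "\<bar>z y $ 2 - u y $ 2\<bar> \<le> e" if "y \<in> {a..b}" for y
      using w(4)[OF that] component_le_norm_cart[of "u y - z y" 2] by (simp add: abs_minus_commute)
    show "\<bar>v y $ 1\<bar> \<le> norm (v y)" for y by (rule component_le_norm_cart)
  qed (use B e in auto)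
  also have "\<dots> \<le> (B + 1) * e + e * V" using w(2) B(1) by simp
  also have "\<dots> \<le> e * C" using e(1) M(1) by (simp add: C_def algebra_simps)
  also have "\<dots> < \<delta>" using e(5) \<delta> by linarith
  finally have A: "\<bar>integral {a..b} (\<lambda>y. z y $ 2 * w y $ 1) - integral {a..b} (\<lambda>y. u y $ 2 * v y $ 1)\<bar> < \<delta>" .
  have "norm (u b - z b) < \<delta>" using w(4)[of b] e(4) ab by auto
  then show thesis using that[OF w(1) w(3) w(5) _ E A] by blast
qed

text \<open>
  The competitor consists of a segment from \<open>pm\<close>, a \<open>C\<^sup>1\<close> approximation of \<open>u\<close> between the times \<open>a\<close>
  and \<open>b\<close>, a segment to \<open>pp\<close>, and a small loop at \<open>pp\<close> that makes the area exactly \<open>A\<close>. Every piece except the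
  second costs an energy that tends to zero with \<open>\<delta>\<close>.
\<close>

lemma minimal_energy_le:
  assumes W: "continuous_on UNIV W" and W0: "\<And>x. W x \<ge> 0"
    and min: "constrained_E_minimizer W pm pp A \<gamma>s"
    and p: "primitive u v"
    and approx: "\<And>\<delta>. \<delta> > 0 \<Longrightarrow> \<exists>a b. a < b \<and> norm (u a - pm) < \<delta> \<and> norm (u b - pp) < \<delta> \<and>
        \<bar>- integral {a..b} (\<lambda>y. u y $ 2 * v y $ 1) - A\<bar> < \<delta>"
    and E0: "\<And>a b. a < b \<Longrightarrow> integral {a..b} (\<lambda>y. sqrt (W (u y)) * norm (v y)) \<le> E0"
  shows "curve_E W \<gamma>s \<le> E0"
proof (rule field_le_epsilon)
  fix \<eta> :: real assume \<eta>: "\<eta> > 0"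
  have cF: "continuous_on S (\<lambda>x. sqrt (W x))" for S
    by (intro continuous_intros continuous_on_subset[OF W]) auto
  have "bounded ((\<lambda>x. sqrt (W x)) ` (cball pm 2 \<union> cball pp 2))"
    by (intro compact_imp_bounded compact_continuous_image cF compact_Un) auto
  then obtain M where M: "M > 0" "\<And>x. x \<in> cball pm 2 \<union> cball pp 2 \<Longrightarrow> sqrt (W x) \<le> M"
    by (auto simp: bounded_pos abs_le_iff W0)
  define K where "K = norm pm + norm pp + 2"
  have K: "K > 0" by (simp add: K_def add_nonneg_pos)
  have "((\<lambda>\<delta>. \<delta> + 3 * M * \<delta> + 4 * M * sqrt (2 * ((3 * K + 2) * \<delta>))) \<longlongrightarrow> 0 + 3 * M * 0 + 4 * M * sqrt (2 * ((3 * K + 2) * 0))) (at_right 0)"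
    by (intro tendsto_intros)
  then have "\<forall>\<^sub>F \<delta> in at_right 0. \<delta> + 3 * M * \<delta> + 4 * M * sqrt (2 * ((3 * K + 2) * \<delta>)) < \<eta>"
    using \<eta> by (intro order_tendstoD) auto
  moreover have "((\<lambda>\<delta>. (3 * K + 2) * \<delta>) \<longlongrightarrow> (3 * K + 2) * 0) (at_right 0)" by (intro tendsto_intros)
  then have "\<forall>\<^sub>F \<delta> in at_right 0. (3 * K + 2) * \<delta> < 1 / 8" by (intro order_tendstoD) auto
  moreover have "\<forall>\<^sub>F \<delta> in at_right (0::real). \<delta> < 1" by (rule eventually_at_rightI[of 0 1]) auto
  moreover have "\<forall>\<^sub>F \<delta> in at_right (0::real). \<delta> > 0" by (rule eventually_at_right_less)
  ultimately have "\<forall>\<^sub>F \<delta> in at_right (0::real). \<delta> + 3 * M * \<delta> + 4 * M * sqrt (2 * ((3 * K + 2) * \<delta>)) < \<eta>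
     \<and> (3 * K + 2) * \<delta> < 1 / 8 \<and> \<delta> < 1 \<and> \<delta> > 0" by eventually_elim simp
  then obtain \<delta> where \<delta>: "\<delta> + 3 * M * \<delta> + 4 * M * sqrt (2 * ((3 * K + 2) * \<delta>)) < \<eta>"
     "(3 * K + 2) * \<delta> < 1 / 8" "\<delta> < 1" "\<delta> > 0"
    using eventually_happens'[OF trivial_limit_at_right_real] by blast
  obtain a b where ab: "a < b" "norm (u a - pm) < \<delta>" "norm (u b - pp) < \<delta>"
        "\<bar>- integral {a..b} (\<lambda>y. u y $ 2 * v y $ 1) - A\<bar> < \<delta>"
    using approx[OF \<delta>(4)] by blast
  obtain z w where z: "continuous_on UNIV w"
    "\<And>y. y \<in> {a..b} \<Longrightarrow> (z has_vector_derivative w y) (at y within {a..b})"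
    "z a = u a" "norm (u b - z b) < \<delta>"
    "\<bar>integral {a..b} (\<lambda>y. sqrt (W (z y)) * norm (w y)) - integral {a..b} (\<lambda>y. sqrt (W (u y)) * norm (v y))\<bar> < \<delta>"
    "\<bar>integral {a..b} (\<lambda>y. z y $ 2 * w y $ 1) - integral {a..b} (\<lambda>y. u y $ 2 * v y $ 1)\<bar> < \<delta>"
    using energy_area_approx[OF W p ab(1) \<delta>(4)] by blast
  let ?Ez = "integral {a..b} (\<lambda>y. sqrt (W (z y)) * norm (w y))"
  let ?Az = "- integral {a..b} (\<lambda>y. z y $ 2 * w y $ 1)"
  have zb: "norm (z b - pp) < 2 * \<delta>"
    using ab(3) z(4) norm_triangle_ineq[of "z b - u b" "u b - pp"] by (simp add: norm_minus_commute)
  have area: "\<bar>- ((x $ 2 + y $ 2) / 2 * (y $ 1 - x $ 1))\<bar> \<le> K * norm (y - x)"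
    if "norm x \<le> K" "norm y \<le> K" for x y :: "real^2"
  proof -
    have "\<bar>(x $ 2 + y $ 2) / 2\<bar> \<le> K"
    proof -
      have b: "\<bar>x $ 2\<bar> \<le> K" "\<bar>y $ 2\<bar> \<le> K"
        using that component_le_norm_cart[of x 2] component_le_norm_cart[of y 2] by linarith+
      show ?thesis by (rule abs_leI) (use b[unfolded abs_le_iff] in \<open>simp_all add: field_simps\<close>)
    qed
    moreover have "\<bar>y $ 1 - x $ 1\<bar> \<le> norm (y - x)" using component_le_norm_cart[of "y - x" 1] by simp
    ultimately show ?thesis unfolding abs_minus abs_mult using K by (intro mult_mono) auto
  qed
  have nK: "norm pm \<le> K" "norm pp \<le> K" "norm (u a) \<le> K" "norm (z b) \<le> K"
    using ab(2) zb \<delta>(3) norm_triangle_sub[of "u a" pm] norm_triangle_sub[of "z b" pp] norm_ge_zero[of pm] norm_ge_zero[of pp]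
    unfolding K_def by linarith+
  have seg1: "sqrt (W x) \<le> M" if "x \<in> closed_segment pm (u a)" for x
    using that closed_segment_subset[of pm "cball pm 2" "u a"] ab(2) \<delta>(3)
    by (intro M) (auto simp: dist_norm norm_minus_commute)
  have seg2: "sqrt (W x) \<le> M" if "x \<in> closed_segment (z b) pp" for x
    using that closed_segment_subset[of "z b" "cball pp 2" pp] zb \<delta>(3)
    by (intro M) (auto simp: dist_norm norm_minus_commute)
  define a1 where "a1 = - ((pm $ 2 + u a $ 2) / 2 * (u a $ 1 - pm $ 1))"
  define a2 where "a2 = - ((z b $ 2 + pp $ 2) / 2 * (pp $ 1 - z b $ 1))"
  obtain e1 where e1: "joinable W pm (u a) e1 a1" "e1 \<le> M * norm (u a - pm)"
    using joinable_segment[OF W, of pm "u a" M] seg1 unfolding a1_def by metis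
  obtain e2 where e2: "joinable W (z b) pp e2 a2" "e2 \<le> M * norm (pp - z b)"
    using joinable_segment[OF W, of "z b" pp M] seg2 unfolding a2_def by metis
  \<comment> \<open>The area still missing, to be supplied by the loop.\<close>
  define \<alpha> where "\<alpha> = A - (a1 + ?Az + a2)"
  have "K * norm (u a - pm) \<le> K * \<delta>" "K * norm (pp - z b) \<le> K * (2 * \<delta>)"
    using ab(2) zb K by (auto simp: norm_minus_commute intro!: mult_left_mono)
  then have "\<bar>a1\<bar> \<le> K * \<delta>" "\<bar>a2\<bar> \<le> K * (2 * \<delta>)"
    using area[OF nK(1,3)] area[OF nK(4,2)] unfolding a1_def a2_def by linarith+
  moreover have "(3 * K + 2) * \<delta> = K * \<delta> + K * (2 * \<delta>) + \<delta> + \<delta>" by (simp add: algebra_simps)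
  ultimately have \<alpha>: "\<bar>\<alpha>\<bar> \<le> (3 * K + 2) * \<delta>"
    using ab(4) z(6) unfolding \<alpha>_def by linarith
  obtain e3 where e3: "joinable W pp pp e3 \<alpha>" "e3 \<le> 4 * M * sqrt (2 * \<bar>\<alpha>\<bar>)"
    using joinable_small_loop[OF W W0, of pp M \<alpha>] M \<alpha> \<delta>(2) by force
  have jz: "joinable W (u a) (z b) ?Ez ?Az"
    using joinable_C1[OF W ab(1) z(2) continuous_on_subset[OF z(1)]] z(3) by simp
  have "joinable W pm pp (e1 + ?Ez + e2 + e3) (a1 + ?Az + a2 + \<alpha>)"
    by (intro joinable_trans[OF joinable_trans[OF joinable_trans[OF e1(1) jz] e2(1)] e3(1)])
  then have "joinable W pm pp (e1 + ?Ez + e2 + e3) A" by (simp add: \<alpha>_def)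
  then obtain \<gamma> where \<gamma>: "\<gamma> \<in> connecting_curves pm pp" "curve_E W \<gamma> = e1 + ?Ez + e2 + e3" "curve_P \<gamma> = A"
    by (rule joinable_imp_connecting_curve)
  have "curve_E W \<gamma>s \<le> curve_E W \<gamma>"
    using min \<gamma> unfolding constrained_E_minimizer_def is_arg_min_def by force
  also have "\<dots> \<le> M * \<delta> + (E0 + \<delta>) + M * (2 * \<delta>) + 4 * M * sqrt (2 * ((3 * K + 2) * \<delta>))"
  proof -
    have "M * norm (u a - pm) \<le> M * \<delta>" "M * norm (pp - z b) \<le> M * (2 * \<delta>)"
      using ab(2) zb M by (auto simp: norm_minus_commute intro!: mult_left_mono)
    moreover have "4 * M * sqrt (2 * \<bar>\<alpha>\<bar>) \<le> 4 * M * sqrt (2 * ((3 * K + 2) * \<delta>))"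
      using \<alpha> M(1) by (intro mult_left_mono real_sqrt_le_mono) auto
    ultimately show ?thesis
      using \<gamma>(2) e1(2) e2(2) e3(2) z(5) E0[OF ab(1)] by linarith
  qed
  also have "\<dots> \<le> E0 + \<eta>" using \<delta>(1) by (simp add: algebra_simps)
  finally show "curve_E W \<gamma>s \<le> E0 + \<eta>" .
qed


section \<open>Lipschitz functions and improper integrals\<close>

text \<open>
  The difference quotients of a Lipschitz function are bounded, so that dominated convergence applies to
  them. Their integrals telescope to averages of \<open>f\<close> at the two end points, where \<open>f\<close> is extended by
  constants.
\<close>

lemma lipschitz_FTC:
  fixes f f' :: "real \<Rightarrow> 'b::euclidean_space"
  assumes lip: "L-lipschitz_on {a..b} f" and ab: "a < b" and N: "negligible N"
    and der: "\<And>t. t \<in> {a..b} - N \<Longrightarrow> (f has_vector_derivative f' t) (at t within {a..b})"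
  shows "f' absolutely_integrable_on {a..b}" "integral {a..b} f' = f b - f a"
proof -
  define g where "g t = f (max a (min b t))" for t
  have L0: "L \<ge> 0" using lip by (rule lipschitz_on_nonneg)
  have gl: "norm (g s - g t) \<le> L * \<bar>s - t\<bar>" for s t
  proof -
    have "norm (g s - g t) \<le> L * dist (max a (min b s)) (max a (min b t))"
      unfolding g_def using lipschitz_onD[OF lip, of "max a (min b s)" "max a (min b t)"] ab
      by (auto simp: dist_norm)
    also have "\<dots> \<le> L * \<bar>s - t\<bar>" using L0 by (intro mult_left_mono) (auto simp: dist_real_def)
    finally show ?thesis .
  qed
  have "L-lipschitz_on UNIV g"
    using gl L0 by (intro lipschitz_onI) (auto simp: dist_norm)
  then have cg: "continuous_on S g" for S
    using lipschitz_on_continuous_on continuous_on_subset by blast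
  define h where "h n = inverse (real (Suc n))" for n
  have h: "h n > 0" for n by (simp add: h_def)
  have h0: "h \<longlonglongrightarrow> 0" unfolding h_def by (rule LIMSEQ_inverse_real_of_nat)
  define q where "q n t = (1 / h n) *\<^sub>R (g (t + h n) - g t)" for n t
  have cq: "continuous_on S (q n)" for S n
    unfolding q_def by (intro continuous_intros cg continuous_on_compose2[OF cg[of UNIV]]) auto
  have qb: "norm (q n t) \<le> L" for n t
    using gl[of "t + h n" t] h[of n] by (simp add: q_def divide_le_eq)
  define N' where "N' = N \<union> {a, b}"
  have N': "negligible N'" using N by (simp add: N'_def negligible_insert negligible_Un)
  define q' where "q' n t = (if t \<in> N' then 0 else q n t)" for n t
  define f'' where "f'' t = (if t \<in> N' then 0 else f' t)" for t
  have iq': "q' n integrable_on {a..b}" for n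
    by (rule integrable_spike[OF integrable_continuous_interval[OF cq] N']) (auto simp: q'_def)
  have conv: "(\<lambda>n. q' n t) \<longlonglongrightarrow> f'' t" if t: "t \<in> {a..b}" for t
  proof (cases "t \<in> N'")
    case False
    then have t': "a < t" "t < b" "t \<notin> N" using t by (auto simp: N'_def)
    have "(f has_vector_derivative f' t) (at t within {a..b})" using der t' by auto
    then have "(f has_vector_derivative f' t) (at t)"
      using t' by (subst (asm) at_within_interior) auto
    then have "(g has_vector_derivative f' t) (at t)"
      by (rule has_vector_derivative_transform_within_open[of _ _ _ "{a<..<b}"]) (use t' in \<open>auto simp: g_def\<close>)
    then have "((\<lambda>s. (g s - g t - (s - t) *\<^sub>R f' t) /\<^sub>R \<bar>s - t\<bar>) \<longlongrightarrow> 0) (at t)"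
      by (simp add: has_vector_derivative_def has_derivative_at_within divide_inverse)
    moreover have "filterlim (\<lambda>n. t + h n) (at t) sequentially"
      unfolding filterlim_at using h h0 by (auto intro!: tendsto_eq_intros simp: less_imp_neq[symmetric])
    ultimately have "(\<lambda>n. (g (t + h n) - g t - (t + h n - t) *\<^sub>R f' t) /\<^sub>R \<bar>t + h n - t\<bar>) \<longlonglongrightarrow> 0"
      by (rule filterlim_compose)
    moreover have "(g (t + h n) - g t - (t + h n - t) *\<^sub>R f' t) /\<^sub>R \<bar>t + h n - t\<bar> = q n t - f' t" for n
      using h[of n] by (simp add: q_def scaleR_diff_right inverse_eq_divide)
    ultimately have "(\<lambda>n. q n t - f' t) \<longlonglongrightarrow> 0" by simp
    then have "(\<lambda>n. q n t) \<longlonglongrightarrow> f' t" by (rule LIM_zero_cancel)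
    then show ?thesis using False by (simp add: q'_def f''_def)
  qed (simp add: q'_def f''_def)
  have qb': "norm (q' n t) \<le> L" for n t using qb L0 by (simp add: q'_def)
  have Lint: "(\<lambda>_. L) integrable_on {a..b}" by (rule integrable_const_ivl)
  have if'': "f'' integrable_on {a..b}" and lim: "(\<lambda>n. integral {a..b} (q' n)) \<longlonglongrightarrow> integral {a..b} f''"
    using dominated_convergence[OF iq' Lint qb' conv] by blast+
  have "norm (f'' t) \<le> L" if "t \<in> {a..b}" for t
    using conv[OF that] by (rule Lim_norm_ubound[rotated]) (auto simp: qb')
  then have ai: "f'' absolutely_integrable_on {a..b}"
    by (rule absolutely_integrable_integrable_bound[OF _ if'' Lint])
  show "f' absolutely_integrable_on {a..b}"
    by (rule absolutely_integrable_spike[OF ai N']) (auto simp: f''_def)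
  have iq: "integral {a..b} (q' n) = (1 / h n) *\<^sub>R (integral {b..b + h n} g - integral {a..a + h n} g)" for n
  proof -
    have ig: "g integrable_on {c..d}" for c d by (intro integrable_continuous_interval cg)
    have "integral {a..b} (q' n) = integral {a..b} (q n)"
      by (rule integral_spike[OF N']) (auto simp: q'_def)
    also have "\<dots> = (1 / h n) *\<^sub>R (integral {a..b} (\<lambda>t. g (t + h n)) - integral {a..b} g)"
    proof -
      have "(\<lambda>t. g (t + h n)) integrable_on {a..b}"
        by (intro integrable_continuous_interval continuous_on_compose2[OF cg[of UNIV]] continuous_intros) auto
      then show ?thesis unfolding q_def by (simp add: integral_diff ig)
    qed
    also have "integral {a..b} (\<lambda>t. g (t + h n)) = integral {a + h n..b + h n} g"
      using integral_shift[OF cg, of a b "h n"] by (simp add: o_def)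
    also have "integral {a + h n..b + h n} g - integral {a..b} g = integral {b..b + h n} g - integral {a..a + h n} g"
      using Henstock_Kurzweil_Integration.integral_combine[of a b "b + h n" g] Henstock_Kurzweil_Integration.integral_combine[of a "a + h n" "b + h n" g] ig ab h[of n]
      by (simp add: algebra_simps)
    finally show ?thesis .
  qed
  have avg: "(\<lambda>n. (1 / h n) *\<^sub>R integral {c..c + h n} g) \<longlonglongrightarrow> g c" for c
  proof (rule LIM_zero_cancel)
    show "(\<lambda>n. (1 / h n) *\<^sub>R integral {c..c + h n} g - g c) \<longlonglongrightarrow> 0"
    proof (rule Lim_null_comparison)
      show "\<forall>\<^sub>F n in sequentially. norm ((1 / h n) *\<^sub>R integral {c..c + h n} g - g c) \<le> L * h n"
      proof (rule always_eventually, rule allI)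
        fix n
        have "(1 / h n) *\<^sub>R integral {c..c + h n} g - g c = (1 / h n) *\<^sub>R integral {c..c + h n} (\<lambda>t. g t - g c)"
          using h[of n] by (subst integral_diff) (auto intro: integrable_continuous_interval cg simp: scaleR_diff_right)
        moreover have "norm (integral {c..c + h n} (\<lambda>t. g t - g c)) \<le> (L * h n) * (c + h n - c)"
        proof (rule integral_bound)
          fix t assume t: "t \<in> {c..c + h n}"
          have "norm (g t - g c) \<le> L * \<bar>t - c\<bar>" by (rule gl)
          also have "\<dots> \<le> L * h n" using t L0 by (intro mult_left_mono) auto
          finally show "norm (g t - g c) \<le> L * h n" .
        qed (use h[of n] in \<open>auto intro!: continuous_intros cg\<close>)
        ultimately show "norm ((1 / h n) *\<^sub>R integral {c..c + h n} g - g c) \<le> L * h n"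
          using h[of n] by (simp add: divide_le_eq)
      qed
      show "(\<lambda>n. L * h n) \<longlonglongrightarrow> 0" using tendsto_mult_right_zero[OF h0, of L] by simp
    qed
  qed
  have "(\<lambda>n. integral {a..b} (q' n)) \<longlonglongrightarrow> g b - g a"
    unfolding iq scaleR_diff_right by (intro tendsto_diff avg)
  then have "integral {a..b} f'' = g b - g a" using lim LIMSEQ_unique by blast
  moreover have "integral {a..b} f'' = integral {a..b} f'"
    by (rule integral_spike[OF N']) (auto simp: f''_def)
  ultimately show "integral {a..b} f' = f b - f a" using ab by (simp add: g_def)
qed

lemma lipschitz_primitive:
  fixes f f' :: "real \<Rightarrow> 'b::euclidean_space"
  assumes lip: "L-lipschitz_on {a..b} f" and N: "negligible N"
    and der: "\<And>t. t \<in> {a..b} - N \<Longrightarrow> (f has_vector_derivative f' t) (at t within {a..b})"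
    and cd: "a \<le> c" "c \<le> d" "d \<le> b"
  shows "integral {c..d} f' = f d - f c"
proof (cases "c = d")
  case False
  show ?thesis
  proof (rule lipschitz_FTC(2))
    show "L-lipschitz_on {c..d} f" by (rule lipschitz_on_subset[OF lip]) (use cd in auto)
    show "(f has_vector_derivative f' t) (at t within {c..d})" if "t \<in> {c..d} - N" for t
      by (rule has_vector_derivative_within_subset[OF der]) (use that cd in auto)
  qed (use False cd N in auto)
qed simp

lemma locally_lipschitz_on_imp_lipschitz:
  assumes "locally_lipschitz_on {a..b} \<gamma>"
  obtains L where "L-lipschitz_on {a..b} \<gamma>"
proof -
  have "local_lipschitz {0::real} {a..b} (\<lambda>_. \<gamma>)"
    unfolding local_lipschitz_def
  proof (intro ballI)
    fix t x :: real assume "t \<in> {0}" "x \<in> {a..b}"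
    then obtain d L where "d > 0" "L-lipschitz_on (cball x d \<inter> {a..b}) \<gamma>"
      using assms unfolding locally_lipschitz_on_def by blast
    then show "\<exists>u>0. \<exists>L. \<forall>t\<in>cball t u \<inter> {0}. L-lipschitz_on (cball x u \<inter> {a..b}) \<gamma>" by blast
  qed
  then obtain L where "\<And>t. t \<in> {0::real} \<Longrightarrow> L-lipschitz_on {a..b} \<gamma>"
    by (rule local_lipschitz_compact_implies_lipschitz) auto
  then show thesis using that by auto
qed

text \<open>
  The two limits in the definition of an improper integral are independent of each other, hence the
  splitting at zero.
\<close>

lemma tendsto_improper_integral:
  fixes f :: "real \<Rightarrow> real"
  assumes f: "integrable lebesgue f"
  shows "((\<lambda>(a, b). LINT y:{a..b}|lebesgue. f y) \<longlongrightarrow> (LINT y|lebesgue. f y)) (at_bot \<times>\<^sub>F at_top)"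
proof -
  have si: "set_integrable lebesgue S f" if "S \<in> sets lebesgue" for S
    using f that unfolding set_integrable_def by (rule integrable_mult_indicator[rotated])
  have "((\<lambda>b. LINT y:{0..b}|lebesgue. f y) \<longlongrightarrow> (LINT y:{0..}|lebesgue. f y)) at_top"
    by (rule tendsto_set_lebesgue_integral_at_top) (auto intro: si)
  then have 1: "((\<lambda>x. LINT y:{0..snd x}|lebesgue. f y) \<longlongrightarrow> (LINT y:{0..}|lebesgue. f y)) (at_bot \<times>\<^sub>F at_top)"
    by (rule filterlim_compose[OF _ filterlim_snd])
  have "((\<lambda>a. LINT y:{a..0}|lebesgue. f y) \<longlongrightarrow> (LINT y:{..0}|lebesgue. f y)) at_bot"
    by (rule tendsto_set_lebesgue_integral_at_bot) (auto intro: si)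
  then have 2: "((\<lambda>x. LINT y:{fst x..0}|lebesgue. f y) \<longlongrightarrow> (LINT y:{..0}|lebesgue. f y)) (at_bot \<times>\<^sub>F at_top)"
    by (rule filterlim_compose[OF _ filterlim_fst])
  have ae: "AE y in lebesgue. y \<noteq> (0::real)"
    by (rule AE_I'[of "{0}"]) (auto simp: negligible_iff_null_sets[symmetric])
  have un: "(LINT y:A|lebesgue. f y) + (LINT y:B|lebesgue. f y) = (LINT y:A \<union> B|lebesgue. f y)"
    if "A \<in> sets lebesgue" "B \<in> sets lebesgue" "A \<inter> B \<subseteq> {0}" for A B
    using ae that by (intro set_integral_Un_AE[symmetric] si) auto
  have tot: "(LINT y:{..0}|lebesgue. f y) + (LINT y:{0..}|lebesgue. f y) = (LINT y|lebesgue. f y)"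
  proof -
    have "{..0} \<union> {0..} = (UNIV :: real set)" by auto
    then show ?thesis by (subst un) (auto simp: set_lebesgue_integral_def)
  qed
  have "((\<lambda>x. (LINT y:{fst x..0}|lebesgue. f y) + (LINT y:{0..snd x}|lebesgue. f y)) \<longlongrightarrow> (LINT y|lebesgue. f y)) (at_bot \<times>\<^sub>F at_top)"
    using tendsto_add[OF 2 1] tot by simp
  then show ?thesis
  proof (rule Lim_transform_eventually)
    have "\<forall>\<^sub>F x in at_bot \<times>\<^sub>F at_top. fst x \<le> (0::real) \<and> snd x \<ge> (0::real)"
      unfolding eventually_prod_filter
      by (intro exI[of _ "\<lambda>a. a \<le> 0"] exI[of _ "\<lambda>b. b \<ge> 0"]) (auto intro: eventually_le_at_bot eventually_ge_at_top)
    then show "\<forall>\<^sub>F x in at_bot \<times>\<^sub>F at_top. (LINT y:{fst x..0}|lebesgue. f y) + (LINT y:{0..snd x}|lebesgue. f y)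
         = (case x of (a, b) \<Rightarrow> LINT y:{a..b}|lebesgue. f y)"
    proof (rule eventually_mono)
      fix x :: "real \<times> real" assume x: "fst x \<le> 0 \<and> snd x \<ge> 0"
      then have "{fst x..0} \<union> {0..snd x} = {fst x..snd x}" by auto
      then show "(LINT y:{fst x..0}|lebesgue. f y) + (LINT y:{0..snd x}|lebesgue. f y)
         = (case x of (a, b) \<Rightarrow> LINT y:{a..b}|lebesgue. f y)"
        by (subst un) (auto simp: case_prod_beta)
    qed
  qed
qed


section \<open>Reparametrizing the minimizing curve\<close>

text \<open>
  The curve \<open>\<gamma>\<close> has constant speed \<open>spd\<close> off the null set \<open>N\<close>. In the context below, \<open>yy\<close> is the new parameter
  as a function of the old one, with derivative \<open>k\<close>; \<open>T\<close> is its inverse, \<open>U\<close> the reparametrized curve and \<open>V\<close>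
  its derivative. The formula for \<open>V\<close> is the chain rule; it is meaningful at every point, whereas \<open>U\<close> is
  differentiable only almost everywhere.
\<close>

locale reparametrized_curve = C2_function W for W :: "real^2 \<Rightarrow> real" +
  fixes pp pm :: "real^2" and \<gamma> :: "real \<Rightarrow> real^2" and spd :: real and N :: "real set" and L :: real
  assumes W_nonneg: "\<And>x. W x \<ge> 0"
    and W_zero_iff: "\<And>x. W x = 0 \<longleftrightarrow> x = pp \<or> x = pm"
    and wells_distinct: "pp \<noteq> pm"
    and hess_pp: "hessian_pos_def W pp" and hess_pm: "hessian_pos_def W pm"
    and lip: "L-lipschitz_on {0..1} \<gamma>"
    and ends: "\<gamma> 0 = pm" "\<gamma> 1 = pp"
    and interior: "\<And>t. 0 < t \<Longrightarrow> t < 1 \<Longrightarrow> \<gamma> t \<noteq> pm \<and> \<gamma> t \<noteq> pp"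
    and N: "negligible N"
    and der: "\<And>t. t \<in> {0..1} - N \<Longrightarrow> (\<gamma> has_vector_derivative curve_deriv \<gamma> t) (at t within {0..1})"
    and speed: "\<And>t. t \<in> {0..1} - N \<Longrightarrow> norm (curve_deriv \<gamma> t) = spd"
begin

abbreviation "F x \<equiv> sqrt (W x)"
abbreviation "d\<gamma> \<equiv> curve_deriv \<gamma>"
abbreviation "yy \<equiv> y_of_t W \<gamma>"
definition "T = inv_into {0<..<1} yy"
abbreviation "U \<equiv> U_of_curve W \<gamma>"
definition "V y = (sqrt 2 * F (U y) / spd) *\<^sub>R d\<gamma> (T y)"
definition "k t = spd / (sqrt 2 * F (\<gamma> t))"

lemma U_eq: "U y = \<gamma> (T y)" by (simp add: U_of_curve_def T_def)

lemma continuous_\<gamma>: "S \<subseteq> {0..1} \<Longrightarrow> continuous_on S \<gamma>"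
  using lipschitz_on_continuous_on[OF lip] continuous_on_subset by blast

lemma continuous_F: "continuous_on S F"
  by (intro continuous_intros continuous_W)

lemma continuous_F\<gamma>: "S \<subseteq> {0..1} \<Longrightarrow> continuous_on S (\<lambda>t. F (\<gamma> t))"
  by (rule continuous_on_compose2[OF continuous_F[of UNIV] continuous_\<gamma>]) auto

lemma d\<gamma>_integrable: "d\<gamma> absolutely_integrable_on {0..1}"
  by (rule lipschitz_FTC(1)[OF lip _ N der]) auto

lemma d\<gamma>_integral: "0 \<le> c \<Longrightarrow> c \<le> d \<Longrightarrow> d \<le> 1 \<Longrightarrow> integral {c..d} d\<gamma> = \<gamma> d - \<gamma> c"
  by (rule lipschitz_primitive[OF lip N der])

lemma \<gamma>_dist_le: "0 \<le> c \<Longrightarrow> c \<le> d \<Longrightarrow> d \<le> 1 \<Longrightarrow> norm (\<gamma> d - \<gamma> c) \<le> spd * (d - c)"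
proof -
  assume cd: "0 \<le> c" "c \<le> d" "d \<le> 1"
  define f where "f t = (if t \<in> N then 0 else d\<gamma> t)" for t
  have spd0: "spd \<ge> 0"
  proof (rule ccontr)
    assume neg: "\<not> spd \<ge> 0"
    have "{0..1} \<subseteq> N"
    proof
      fix t :: real assume "t \<in> {0..1}"
      then show "t \<in> N" using speed[of t] neg norm_ge_zero[of "d\<gamma> t"] by auto
    qed
    then have "negligible {0..1::real}" using N negligible_subset by blast
    then show False using negligible_interval(1)[of 0 "1::real"] by simp
  qed
  have 1: "integral {c..d} d\<gamma> = integral {c..d} f"
    by (rule integral_spike[OF N]) (auto simp: f_def)
  have "d\<gamma> integrable_on {c..d}"
    using absolutely_integrable_on_subinterval[OF d\<gamma>_integrable, of c d] cd
    by (simp add: set_lebesgue_integral_eq_integral(1))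
  then have "f integrable_on {c..d}"
    by (rule integrable_spike[OF _ N]) (auto simp: f_def)
  then have "norm (integral {c..d} f) \<le> integral {c..d} (\<lambda>_. spd)"
    by (rule integral_norm_bound_integral) (use cd speed spd0 in \<open>auto simp: f_def\<close>)
  then show ?thesis using 1 d\<gamma>_integral cd by (simp add: mult.commute)
qed

lemma spd_pos: "spd > 0"
proof -
  have "0 < norm (\<gamma> 1 - \<gamma> 0)" using ends wells_distinct by simp
  also have "\<dots> \<le> spd * (1 - 0)" by (rule \<gamma>_dist_le) auto
  finally show ?thesis by simp
qed

lemma F_pos: "0 < t \<Longrightarrow> t < 1 \<Longrightarrow> F (\<gamma> t) > 0"
  using interior[of t] W_zero_iff[of "\<gamma> t"] W_nonneg[of "\<gamma> t"] by auto

lemma k_nonneg: "k t \<ge> 0" using spd_pos W_nonneg by (simp add: k_def)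

lemma k_pos: "0 < t \<Longrightarrow> t < 1 \<Longrightarrow> k t > 0" using spd_pos F_pos by (simp add: k_def)

lemma continuous_k:
  assumes S: "S \<subseteq> {0<..<1}"
  shows "continuous_on S k"
proof -
  have "continuous_on S (\<lambda>t. sqrt 2 * F (\<gamma> t))"
    using S by (intro continuous_on_mult continuous_on_const continuous_F\<gamma>) auto
  moreover have "\<forall>t\<in>S. sqrt 2 * F (\<gamma> t) \<noteq> 0"
  proof
    fix t assume "t \<in> S"
    then have "F (\<gamma> t) > 0" using S by (intro F_pos) auto
    then show "sqrt 2 * F (\<gamma> t) \<noteq> 0" by simp
  qed
  ultimately show ?thesis
    unfolding k_def[abs_def] by (intro continuous_on_divide continuous_on_const)
qed

lemma LINT_speed:
  assumes "0 < s" "s \<le> t" "t < 1"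
  shows "1 / sqrt 2 * (LINT \<tau>:{s<..<t}|lebesgue. norm (d\<gamma> \<tau>) / F (\<gamma> \<tau>)) = integral {s..t} k"
proof -
  have ck: "continuous_on {s..t} k" using assms by (intro continuous_k) auto
  have "(\<lambda>\<tau>. sqrt 2 * k \<tau>) absolutely_integrable_on {s..t}"
    by (intro absolutely_integrable_continuous_real continuous_intros ck)
  moreover have eq: "norm (d\<gamma> \<tau>) / F (\<gamma> \<tau>) = sqrt 2 * k \<tau>" if "\<tau> \<in> {s..t} - N" for \<tau>
    using speed[of \<tau>] that assms by (simp add: k_def)
  ultimately have ai: "(\<lambda>\<tau>. norm (d\<gamma> \<tau>) / F (\<gamma> \<tau>)) absolutely_integrable_on {s..t}"
    by (rule absolutely_integrable_spike[OF _ N])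
  then have "(\<lambda>\<tau>. norm (d\<gamma> \<tau>) / F (\<gamma> \<tau>)) absolutely_integrable_on {s<..<t}"
    by (rule set_integrable_subset) auto
  then have "(LINT \<tau>:{s<..<t}|lebesgue. norm (d\<gamma> \<tau>) / F (\<gamma> \<tau>)) = integral {s..t} (\<lambda>\<tau>. norm (d\<gamma> \<tau>) / F (\<gamma> \<tau>))"
    by (simp add: set_lebesgue_integral_eq_integral(2) integral_open_interval_real)
  also have "\<dots> = integral {s..t} (\<lambda>\<tau>. sqrt 2 * k \<tau>)"
    by (rule integral_spike[OF N]) (simp add: eq)
  finally show ?thesis by simp
qed

lemma yy_diff:
  assumes "0 < s" "s \<le> t" "t < 1"
  shows "yy t = yy s + integral {s..t} k"
proof -
  have r: "yy t = integral {1/2..t} k" if "1/2 \<le> t" "t < 1" for t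
    using LINT_speed[of "1/2" t] that by (simp add: y_of_t_def interval_lebesgue_integral_def)
  have l: "yy t = - integral {t..1/2} k" if "0 < t" "t \<le> 1/2" for t
  proof (cases "t = 1/2")
    case False
    then show ?thesis
      using LINT_speed[of t "1/2"] that by (simp add: y_of_t_def interval_lebesgue_integral_def)
  next
    case True
    show ?thesis unfolding True by (simp add: y_of_t_def interval_lebesgue_integral_def set_lebesgue_integral_def)
  qed
  have ik: "k integrable_on {a..b}" if "0 < a" "b < 1" for a b
    using that by (intro integrable_continuous_interval continuous_k) auto
  note comb = Henstock_Kurzweil_Integration.integral_combine
  consider "1/2 \<le> s" | "s < 1/2" "1/2 \<le> t" | "t < 1/2" by linarith
  then show ?thesis
  proof cases
    case 1
    then show ?thesis using r[of t] r[of s] assms comb[of "1/2" s t k] ik[of "1/2" t] by simp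
  next
    case 2
    then show ?thesis using r[of t] l[of s] assms comb[of s "1/2" t k] ik[of s t] by simp
  next
    case 3
    then show ?thesis using l[of t] l[of s] assms comb[of s t "1/2" k] ik[of s "1/2"] by simp
  qed
qed

lemma yy_deriv:
  assumes "0 < t" "t < 1"
  shows "(yy has_field_derivative k t) (at t)"
proof -
  define a where "a = t / 2"
  define b where "b = (1 + t) / 2"
  have ab: "0 < a" "a < t" "t < b" "b < 1" using assms by (auto simp: a_def b_def)
  have "((\<lambda>\<tau>. yy a + integral {a..\<tau>} k) has_vector_derivative k t) (at t within {a..b})"
    using ab by (auto intro!: derivative_eq_intros integral_has_vector_derivative continuous_k)
  then have "((\<lambda>\<tau>. yy a + integral {a..\<tau>} k) has_vector_derivative k t) (at t)"
    using ab by (subst (asm) at_within_interior) auto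
  then have "(yy has_vector_derivative k t) (at t)"
  proof (rule has_vector_derivative_transform_within_open[of _ _ _ "{a<..<b}"])
    show "yy a + integral {a..x} k = yy x" if "x \<in> {a<..<b}" for x
      using that ab by (intro yy_diff[symmetric]) auto
  qed (use ab in auto)
  then show ?thesis by (simp add: has_real_derivative_iff_has_vector_derivative)
qed

lemma yy_less:
  assumes "0 < s" "s < t" "t < 1"
  shows "yy s < yy t"
proof (rule DERIV_pos_imp_increasing[OF assms(2)])
  fix x assume "s \<le> x" "x \<le> t"
  then have "0 < x" "x < 1" using assms by auto
  then show "\<exists>y. DERIV yy x :> y \<and> 0 < y" using yy_deriv k_pos by blast
qed

lemma yy_half: "yy (1/2) = 0"
  by (simp add: y_of_t_def interval_lebesgue_integral_def set_lebesgue_integral_def)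

text \<open>
  A curve of constant speed is at distance at most a multiple of \<open>1 - t\<close> from its end point, and \<open>F\<close> grows
  at most linearly with that distance.
\<close>

lemma F_decay:
  obtains C where "C > 0" "\<And>t. 0 \<le> t \<Longrightarrow> t \<le> 1 \<Longrightarrow> F (\<gamma> t) \<le> C * (1 - t)"
    "\<And>t. 0 \<le> t \<Longrightarrow> t \<le> 1 \<Longrightarrow> F (\<gamma> t) \<le> C * t"
proof -
  obtain R where R: "\<And>t. t \<in> {0..1} \<Longrightarrow> norm (\<gamma> t) \<le> R"
  proof -
    have "bounded (\<gamma> ` {0..1})"
      by (intro compact_imp_bounded compact_continuous_image continuous_\<gamma>) auto
    then show thesis using that unfolding bounded_iff by blast
  qed
  have z: "W pp = 0" "W pm = 0" using W_zero_iff by auto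
  obtain C1 where C1: "C1 > 0" "\<And>x. norm x \<le> R \<Longrightarrow> W x \<le> C1 * (norm (x - pp))\<^sup>2"
    using quadratic_upper_bound[OF W_nonneg z(1)] by blast
  obtain C2 where C2: "C2 > 0" "\<And>x. norm x \<le> R \<Longrightarrow> W x \<le> C2 * (norm (x - pm))\<^sup>2"
    using quadratic_upper_bound[OF W_nonneg z(2)] by blast
  define C where "C = sqrt (max C1 C2) * spd"
  have sq: "F x \<le> sqrt (max C1 C2) * n" if "W x \<le> c * n'\<^sup>2" "c \<le> max C1 C2" "0 \<le> n'" "n' \<le> n" for x c n n'
  proof -
    have "W x \<le> max C1 C2 * n\<^sup>2"
      using that C1(1) by (intro order_trans[OF that(1)] mult_mono power_mono) auto
    then have "F x \<le> sqrt (max C1 C2 * n\<^sup>2)" by (rule real_sqrt_le_mono)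
    then show ?thesis using that by (simp add: real_sqrt_mult)
  qed
  show thesis
  proof
    show "C > 0" using C1(1) spd_pos by (simp add: C_def)
    fix t :: real assume t: "0 \<le> t" "t \<le> 1"
    have "norm (\<gamma> t - pp) \<le> spd * (1 - t)"
      using \<gamma>_dist_le[of t 1] t ends by (simp add: norm_minus_commute)
    then show "F (\<gamma> t) \<le> C * (1 - t)"
      using sq[OF C1(2)[OF R] _ _ , of t "spd * (1 - t)"] t by (simp add: C_def mult.assoc)
    have "norm (\<gamma> t - pm) \<le> spd * t"
      using \<gamma>_dist_le[of 0 t] t ends by simp
    then show "F (\<gamma> t) \<le> C * t"
      using sq[OF C2(2)[OF R] _ _ , of t "spd * t"] t by (simp add: C_def mult.assoc)
  qed
qed

text \<open>
  By comparison with a logarithm, because the derivative of \<open>yy\<close> is bounded below by constant multiples of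
  \<open>1 / (1 - t)\<close> and of \<open>1 / t\<close>.
\<close>

lemma yy_unbounded:
  "\<exists>t. 1/2 \<le> t \<and> t < 1 \<and> c \<le> yy t" "\<exists>t. 0 < t \<and> t \<le> 1/2 \<and> yy t \<le> - c"
proof -
  obtain C where C: "C > 0" "\<And>t. 0 \<le> t \<Longrightarrow> t \<le> 1 \<Longrightarrow> F (\<gamma> t) \<le> C * (1 - t)"
    "\<And>t. 0 \<le> t \<Longrightarrow> t \<le> 1 \<Longrightarrow> F (\<gamma> t) \<le> C * t"
    using F_decay by blast
  define K where "K = spd / (sqrt 2 * C)"
  have K: "K > 0" using C spd_pos by (simp add: K_def)
  have kb: "k t \<ge> K / (1 - t)" "k t \<ge> K / t" if "0 < t" "t < 1" for t
  proof -
    have "sqrt 2 * F (\<gamma> t) \<le> sqrt 2 * (C * (1 - t))" "sqrt 2 * F (\<gamma> t) \<le> sqrt 2 * (C * t)"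
      using C(2,3)[of t] that by auto
    then show "k t \<ge> K / (1 - t)" "k t \<ge> K / t"
      unfolding k_def K_def divide_divide_eq_left
      using spd_pos F_pos[OF that] that C(1)
      by (intro divide_left_mono; simp add: mult.assoc)+
  qed
  show "\<exists>t. 1/2 \<le> t \<and> t < 1 \<and> c \<le> yy t"
  proof -
    \<comment> \<open>The point at which the logarithmic lower bound for \<open>yy\<close> equals \<open>|c|\<close>.\<close>
    define t where "t = 1 - 1/2 * exp (- \<bar>c\<bar> / K)"
    have "exp (- \<bar>c\<bar> / K) \<le> 1" using K by simp
    then have t: "1/2 \<le> t" "t < 1" by (auto simp: t_def)
    have "yy (1/2) + K * ln (1 - 1/2) \<le> yy t + K * ln (1 - t)"
    proof (rule DERIV_nonneg_imp_nondecreasing[OF t(1)])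
      fix x assume x: "1/2 \<le> x" "x \<le> t"
      then have x': "0 < x" "x < 1" using t by auto
      show "\<exists>y. ((\<lambda>x. yy x + K * ln (1 - x)) has_real_derivative y) (at x) \<and> 0 \<le> y"
        using kb(1)[OF x'] x' yy_deriv[OF x']
        by (intro exI[of _ "k x + K * (- 1 / (1 - x))"] conjI) (auto intro!: derivative_eq_intros)
    qed
    moreover have "ln (1 - t) = ln (1/2) - \<bar>c\<bar> / K"
      by (simp add: t_def ln_mult ln_div)
    ultimately have "\<bar>c\<bar> \<le> yy t" using K by (simp add: yy_half right_diff_distrib)
    then show ?thesis using t by (intro exI[of _ t]) auto
  qed
  show "\<exists>t. 0 < t \<and> t \<le> 1/2 \<and> yy t \<le> - c"
  proof -
    define t where "t = 1/2 * exp (- \<bar>c\<bar> / K)"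
    have "exp (- \<bar>c\<bar> / K) \<le> 1" using K by simp
    then have t: "0 < t" "t \<le> 1/2" by (auto simp: t_def)
    have "yy t - K * ln t \<le> yy (1/2) - K * ln (1/2)"
    proof (rule DERIV_nonneg_imp_nondecreasing[OF t(2)])
      fix x assume x: "t \<le> x" "x \<le> 1/2"
      then have x': "0 < x" "x < 1" using t by auto
      show "\<exists>y. ((\<lambda>x. yy x - K * ln x) has_real_derivative y) (at x) \<and> 0 \<le> y"
        using kb(2)[OF x'] x' yy_deriv[OF x']
        by (intro exI[of _ "k x - K * (1 / x)"] conjI) (auto intro!: derivative_eq_intros)
    qed
    moreover have "ln t = ln (1/2) - \<bar>c\<bar> / K"
      by (simp add: t_def ln_mult ln_div)
    ultimately have "yy t \<le> - \<bar>c\<bar>" using K by (simp add: yy_half right_diff_distrib)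
    then show ?thesis using t by (intro exI[of _ t]) auto
  qed
qed

lemma yy_surj: "\<exists>t. 0 < t \<and> t < 1 \<and> yy t = c"
proof -
  obtain t1 where t1: "1/2 \<le> t1" "t1 < 1" "c \<le> yy t1" using yy_unbounded(1) by blast
  obtain t2 where t2: "0 < t2" "t2 \<le> 1/2" "yy t2 \<le> - (- c)" using yy_unbounded(2) by blast
  have "continuous_on {t2..t1} yy"
  proof (intro continuous_at_imp_continuous_on ballI)
    fix x assume "x \<in> {t2..t1}"
    then show "isCont yy x" using t1 t2 by (intro DERIV_isCont[OF yy_deriv]) auto
  qed
  then obtain t where "t2 \<le> t" "t \<le> t1" "yy t = c"
    using IVT'[of yy t2 c t1] t1 t2 by auto
  then show ?thesis using t1 t2 by (intro exI[of _ t]) auto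
qed

lemma yy_inj: "inj_on yy {0<..<1}"
  by (rule inj_onI) (metis greaterThanLessThan_iff linorder_less_linear order_less_irrefl yy_less)

lemma T_yy: "0 < t \<Longrightarrow> t < 1 \<Longrightarrow> T (yy t) = t"
  unfolding T_def by (rule inv_into_f_f[OF yy_inj]) auto

lemma T_bounds: "0 < T y" "T y < 1" and yy_T: "yy (T y) = y"
proof -
  have "y \<in> yy ` {0<..<1}" using yy_surj[of y] by auto
  then have "T y \<in> {0<..<1}" "yy (T y) = y"
    unfolding T_def by (rule inv_into_into, rule f_inv_into_f)
  then show "0 < T y" "T y < 1" "yy (T y) = y" by auto
qed

lemma yy_le_iff: "0 < s \<Longrightarrow> s < 1 \<Longrightarrow> 0 < t \<Longrightarrow> t < 1 \<Longrightarrow> yy s \<le> yy t \<longleftrightarrow> s \<le> t"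
  by (metis yy_less linorder_not_less order_le_less)

lemma T_mono: "x \<le> y \<Longrightarrow> T x \<le> T y"
  using yy_le_iff[of "T x" "T y"] T_bounds yy_T by simp

lemma yy_image: "yy ` {T a..T b} = {a..b}"
proof (intro equalityI subsetI)
  fix y assume "y \<in> yy ` {T a..T b}"
  then obtain t where t: "T a \<le> t" "t \<le> T b" "y = yy t" by auto
  then have "0 < t" "t < 1" using T_bounds by (meson less_le_trans le_less_trans)+
  then show "y \<in> {a..b}"
    using t yy_le_iff[of "T a" t] yy_le_iff[of t "T b"] T_bounds yy_T by simp
next
  fix y assume "y \<in> {a..b}"
  then show "y \<in> yy ` {T a..T b}"
    using T_mono[of a y] T_mono[of y b] yy_T[of y] by (intro image_eqI[of _ _ "T y"]) auto
qed

lemma yy_image_UNIV: "yy ` {0<..<1} = UNIV"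
proof -
  have "y \<in> yy ` {0<..<1}" for y
    using yy_surj[of y] by auto
  then show ?thesis by blast
qed

text \<open>
  Integrands may be changed on the null set \<open>N\<close>, so that the speed of \<open>\<gamma>\<close> may be replaced by its
  constant value.
\<close>

lemma change_of_variables:
  fixes f h :: "real \<Rightarrow> 'b::euclidean_space"
  assumes S: "S \<in> sets lebesgue" "S \<subseteq> {0<..<1}"
    and h: "h absolutely_integrable_on S" "integral S h = I"
    and eq: "\<And>t. t \<in> S - N \<Longrightarrow> k t *\<^sub>R f (yy t) = h t"
  shows "f absolutely_integrable_on yy ` S" "integral (yy ` S) f = I"
proof -
  have a: "(\<lambda>t. \<bar>k t\<bar> *\<^sub>R f (yy t)) absolutely_integrable_on S"
    by (rule absolutely_integrable_spike[OF h(1) N]) (simp add: eq k_nonneg)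
  have b: "integral S (\<lambda>t. \<bar>k t\<bar> *\<^sub>R f (yy t)) = I"
    unfolding h(2)[symmetric] by (rule integral_spike[OF N]) (simp add: eq k_nonneg)
  have d: "(yy has_field_derivative k t) (at t within S)" if "t \<in> S" for t
  proof -
    have "0 < t" "t < 1" using that S(2) by auto
    then have "(yy has_field_derivative k t) (at t)" by (rule yy_deriv)
    then show ?thesis by (rule has_field_derivative_at_within)
  qed
  have inj: "inj_on yy S" using yy_inj S(2) by (rule inj_on_subset)
  have "f absolutely_integrable_on yy ` S \<and> integral (yy ` S) f = I"
    using has_absolute_integral_change_of_variables_real[OF S(1) d inj, of f I] a b by simp
  then show "f absolutely_integrable_on yy ` S" "integral (yy ` S) f = I" by auto
qed

lemma change_of_variables_whole_line:
  fixes f h :: "real \<Rightarrow> real"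
  assumes "h absolutely_integrable_on {0<..<1}" "integral {0<..<1} h = I"
    and "\<And>t. t \<in> {0<..<1} - N \<Longrightarrow> k t * f (yy t) = h t"
  shows "integrable lebesgue f" "(LINT y|lebesgue. f y) = I"
proof -
  have *: "f absolutely_integrable_on UNIV" "integral UNIV f = I"
    using change_of_variables[of "{0<..<1}" h I f] assms unfolding yy_image_UNIV by auto
  then show i: "integrable lebesgue f" by (simp add: set_integrable_def)
  show "(LINT y|lebesgue. f y) = I"
    using integral_lebesgue[OF i] *(2) by simp
qed

lemma kV: "0 < t \<Longrightarrow> t < 1 \<Longrightarrow> k t *\<^sub>R V (yy t) = d\<gamma> t"
  using F_pos[of t] spd_pos by (simp add: k_def V_def U_eq T_yy)

text \<open>
  The change of variables applied to \<open>V\<close> itself, which becomes \<open>\<gamma>'\<close>.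
\<close>

lemma primitive_U: "primitive U V"
proof -
  have "V absolutely_integrable_on {a..b}" "integral {a..b} V = \<gamma> (T b) - \<gamma> (T a)" if "a \<le> b" for a b
  proof -
    have sub: "{T a..T b} \<subseteq> {0<..<1}" using T_bounds[of a] T_bounds[of b] by auto
    have 1: "d\<gamma> absolutely_integrable_on {T a..T b}"
      using d\<gamma>_integrable by (rule absolutely_integrable_on_subinterval) (use sub in auto)
    have 2: "integral {T a..T b} d\<gamma> = \<gamma> (T b) - \<gamma> (T a)"
      using T_bounds[of a] T_bounds[of b] T_mono[OF that] by (intro d\<gamma>_integral) auto
    show "V absolutely_integrable_on {a..b}" "integral {a..b} V = \<gamma> (T b) - \<gamma> (T a)"
      by (rule change_of_variables[OF _ sub 1 2, of V, unfolded yy_image]; use kV sub in auto)+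
  qed
  moreover have "V absolutely_integrable_on {a..b}" if "\<not> a \<le> b" for a b using that by simp
  ultimately show ?thesis unfolding primitive_def locally_integrable_def U_eq by blast
qed

lemma F_speed_integral:
  "(\<lambda>t. F (\<gamma> t) * spd) absolutely_integrable_on {0<..<1}"
  "integral {0<..<1} (\<lambda>t. F (\<gamma> t) * spd) = curve_E W \<gamma>"
proof -
  have 1: "(\<lambda>t. F (\<gamma> t) * spd) absolutely_integrable_on {0..1}"
    by (intro absolutely_integrable_continuous_real continuous_intros continuous_F\<gamma>) auto
  then show "(\<lambda>t. F (\<gamma> t) * spd) absolutely_integrable_on {0<..<1}"
    by (rule set_integrable_subset) auto
  have "(\<lambda>t. F (\<gamma> t) * norm (d\<gamma> t)) absolutely_integrable_on {0..1}"
    by (rule absolutely_integrable_spike[OF 1 N]) (simp add: speed)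
  then have "curve_E W \<gamma> = integral {0..1} (\<lambda>t. F (\<gamma> t) * norm (d\<gamma> t))"
    unfolding curve_E_def by (rule set_lebesgue_integral_eq_integral(2))
  also have "\<dots> = integral {0..1} (\<lambda>t. F (\<gamma> t) * spd)"
    by (rule integral_spike[OF N]) (simp add: speed)
  finally show "integral {0<..<1} (\<lambda>t. F (\<gamma> t) * spd) = curve_E W \<gamma>"
    by (simp add: integral_open_interval_real)
qed

lemma potential_energy:
  "integrable lebesgue (\<lambda>y. W (U y))" "(LINT y|lebesgue. W (U y)) = curve_E W \<gamma> / sqrt 2"
proof -
  have eq: "k t * W (U (yy t)) = F (\<gamma> t) * spd / sqrt 2" if "t \<in> {0<..<1} - N" for t
  proof -
    have *: "spd / (sqrt 2 * f) * (f * f) = f * spd / sqrt 2" if "f > 0" for f :: real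
      using that by (simp add: field_simps)
    have "W (\<gamma> t) = F (\<gamma> t) * F (\<gamma> t)" using W_nonneg by simp
    then show ?thesis using *[OF F_pos[of t]] that by (simp add: k_def U_eq T_yy)
  qed
  have a: "(\<lambda>t. F (\<gamma> t) * spd / sqrt 2) absolutely_integrable_on {0<..<1}"
    using F_speed_integral(1) by (rule set_integrable_divide)
  have b: "integral {0<..<1} (\<lambda>t. F (\<gamma> t) * spd / sqrt 2) = curve_E W \<gamma> / sqrt 2"
    using F_speed_integral(2) by simp
  show "integrable lebesgue (\<lambda>y. W (U y))" "(LINT y|lebesgue. W (U y)) = curve_E W \<gamma> / sqrt 2"
    by (rule change_of_variables_whole_line[OF a b]; use eq in simp)+
qed

text \<open>
  Together with the potential energy this expresses equipartition: both halves of \<open>H(U)\<close> equal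
  \<open>E(\<gamma>) / \<surd>2\<close>.
\<close>

lemma kinetic_energy:
  "integrable lebesgue (\<lambda>y. (norm (V y))\<^sup>2)" "(LINT y|lebesgue. (norm (V y))\<^sup>2) = sqrt 2 * curve_E W \<gamma>"
proof -
  have eq: "k t * (norm (V (yy t)))\<^sup>2 = sqrt 2 * (F (\<gamma> t) * spd)" if t: "t \<in> {0<..<1} - N" for t
  proof -
    have "norm (d\<gamma> t) = spd" using t by (intro speed) auto
    then have "norm (V (yy t)) = sqrt 2 * F (\<gamma> t)"
      using t spd_pos W_nonneg[of "\<gamma> t"] by (simp add: V_def U_eq T_yy)
    then show ?thesis using F_pos[of t] t spd_pos by (simp add: k_def power2_eq_square)
  qed
  have a: "(\<lambda>t. sqrt 2 * (F (\<gamma> t) * spd)) absolutely_integrable_on {0<..<1}"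
    using F_speed_integral(1) by (intro set_integrable_mult_right) auto
  have b: "integral {0<..<1} (\<lambda>t. sqrt 2 * (F (\<gamma> t) * spd)) = sqrt 2 * curve_E W \<gamma>"
    using F_speed_integral(2) by simp
  show "integrable lebesgue (\<lambda>y. (norm (V y))\<^sup>2)" "(LINT y|lebesgue. (norm (V y))\<^sup>2) = sqrt 2 * curve_E W \<gamma>"
    by (rule change_of_variables_whole_line[OF a b]; use eq in simp)+
qed

lemma area_U:
  "integrable lebesgue (\<lambda>y. U y $ 2 * V y $ 1)" "- (LINT y|lebesgue. U y $ 2 * V y $ 1) = curve_P \<gamma>"
proof -
  have eq: "k t * (U (yy t) $ 2 * V (yy t) $ 1) = \<gamma> t $ 2 * d\<gamma> t $ 1" if t: "t \<in> {0<..<1} - N" for t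
  proof -
    have "k t * V (yy t) $ 1 = d\<gamma> t $ 1" using arg_cong[OF kV[of t], of "\<lambda>v. v $ 1"] t by simp
    then show ?thesis using t by (simp add: U_eq T_yy mult.left_commute)
  qed
  have v1: "(\<lambda>t. d\<gamma> t $ 1) absolutely_integrable_on {0..1}"
    using absolutely_integrable_linear[OF d\<gamma>_integrable bounded_linear_vec_nth] by (simp add: o_def)
  have a0: "(\<lambda>t. \<gamma> t $ 2 * d\<gamma> t $ 1) absolutely_integrable_on {0..1}"
    using absolutely_integrable_scaleR_continuous[OF _ v1, of "\<lambda>t. \<gamma> t $ 2"]
    by (auto intro!: continuous_intros continuous_\<gamma>)
  then have a: "(\<lambda>t. \<gamma> t $ 2 * d\<gamma> t $ 1) absolutely_integrable_on {0<..<1}"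
    by (rule set_integrable_subset) auto
  have b: "integral {0<..<1} (\<lambda>t. \<gamma> t $ 2 * d\<gamma> t $ 1) = - curve_P \<gamma>"
    using set_lebesgue_integral_eq_integral(2)[OF a0] by (simp add: curve_P_def integral_open_interval_real)
  have "integrable lebesgue (\<lambda>y. U y $ 2 * V y $ 1)" "(LINT y|lebesgue. U y $ 2 * V y $ 1) = - curve_P \<gamma>"
    by (rule change_of_variables_whole_line[OF a b]; use eq in simp)+
  then show "integrable lebesgue (\<lambda>y. U y $ 2 * V y $ 1)" "- (LINT y|lebesgue. U y $ 2 * V y $ 1) = curve_P \<gamma>"
    by auto
qed

lemma U_tendsto: "(U \<longlongrightarrow> pp) at_top" "(U \<longlongrightarrow> pm) at_bot"
proof -
  show "(U \<longlongrightarrow> pp) at_top"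
  proof (rule tendstoI)
    fix e :: real assume e: "e > 0"
    define t where "t = max (1/2) (1 - e / (2 * spd))"
    have t: "0 < t" "t < 1" "spd * (1 - t) < e"
      using e spd_pos by (auto simp: t_def max_def field_simps)
    have "dist (U y) pp < e" if "y \<ge> yy t" for y
    proof -
      have "t \<le> T y" using that yy_le_iff[of t "T y"] T_bounds[of y] yy_T[of y] t by simp
      then have "spd * (1 - T y) \<le> spd * (1 - t)" using spd_pos by simp
      moreover have "norm (\<gamma> 1 - \<gamma> (T y)) \<le> spd * (1 - T y)"
        using T_bounds[of y] by (intro \<gamma>_dist_le) auto
      ultimately show ?thesis using t(3) by (simp add: U_eq ends dist_norm norm_minus_commute)
    qed
    then show "\<forall>\<^sub>F y in at_top. dist (U y) pp < e" unfolding eventually_at_top_linorder by blast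
  qed
  show "(U \<longlongrightarrow> pm) at_bot"
  proof (rule tendstoI)
    fix e :: real assume e: "e > 0"
    define t where "t = min (1/2) (e / (2 * spd))"
    have t: "0 < t" "t < 1" "spd * t < e"
      using e spd_pos by (auto simp: t_def min_def field_simps)
    have "dist (U y) pm < e" if "y \<le> yy t" for y
    proof -
      have "T y \<le> t" using that yy_le_iff[of "T y" t] T_bounds[of y] yy_T[of y] t by simp
      then have "spd * T y \<le> spd * t" using spd_pos by simp
      moreover have "norm (\<gamma> (T y) - \<gamma> 0) \<le> spd * (T y - 0)"
        using T_bounds[of y] by (intro \<gamma>_dist_le) auto
      ultimately show ?thesis using t(3) by (simp add: U_eq ends dist_norm)
    qed
    then show "\<forall>\<^sub>F y in at_bot. dist (U y) pm < e" unfolding eventually_at_bot_linorder by blast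
  qed
qed

end


section \<open>Minimality on the line\<close>

lemma locally_integrable_measurable:
  assumes "locally_integrable f"
  shows "f \<in> borel_measurable lebesgue"
proof (rule borel_measurable_LIMSEQ_metric)
  show "(\<lambda>y. indicator {- real n..real n} y *\<^sub>R f y) \<in> borel_measurable lebesgue" for n
    using locally_integrable_absolutely[OF assms, of "- real n" "real n"]
    unfolding set_integrable_def by (rule borel_measurable_integrable)
  fix y
  obtain m :: nat where m: "\<bar>y\<bar> \<le> real m" using real_arch_simple by blast
  show "(\<lambda>n. indicator {- real n..real n} y *\<^sub>R f y) \<longlonglongrightarrow> f y"
  proof (rule tendsto_eventually, unfold eventually_sequentially, intro exI allI impI)
    fix n assume "m \<le> n"
    then have "\<bar>y\<bar> \<le> real n" using m by linarith
    then have "y \<in> {- real n..real n}" by auto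
    then show "indicator {- real n..real n} y *\<^sub>R f y = f y" by simp
  qed
qed

lemma borel_measurable_component:
  assumes "f \<in> borel_measurable lebesgue"
  shows "(\<lambda>y. (f y :: real^2) $ i) \<in> borel_measurable lebesgue"
  by (rule measurable_compose[OF assms borel_measurable_continuous_onI]) (intro continuous_intros)

lemma line_H_eq:
  assumes "has_weak_deriv u v"
  shows "line_H W u = (\<integral>\<^sup>+ y. ennreal ((norm (v y))\<^sup>2 / 2 + W (u y)) \<partial>lebesgue)"
  unfolding line_H_def
  by (rule nn_integral_cong_AE) (use weak_deriv_AE[OF assms] in \<open>eventually_elim, simp\<close>)

lemma has_line_P_iff:
  assumes "has_weak_deriv u v"
  shows "has_line_P u A \<longleftrightarrow>
     ((\<lambda>(a, b). - (LINT y:{a..b}|lebesgue. u y $ 2 * v y $ 1)) \<longlongrightarrow> A) (at_bot \<times>\<^sub>F at_top)"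
proof -
  have m: "u \<in> borel_measurable lebesgue" "v \<in> borel_measurable lebesgue" "weak_deriv u \<in> borel_measurable lebesgue"
    using assms has_weak_deriv_weak_deriv[OF assms]
    by (auto simp: has_weak_deriv_def intro: locally_integrable_measurable)
  have "(LINT y:{a..b}|lebesgue. u y $ 2 * weak_deriv u y $ 1) = (LINT y:{a..b}|lebesgue. u y $ 2 * v y $ 1)" for a b
  proof (rule set_lebesgue_integral_cong_AE)
    show "AE x\<in>{a..b} in lebesgue. u x $ 2 * weak_deriv u x $ 1 = u x $ 2 * v x $ 1"
      using weak_deriv_AE[OF assms] by eventually_elim simp
  qed (intro borel_measurable_times borel_measurable_component m | simp)+
  then show ?thesis unfolding has_line_P_def by simp
qed

lemma line_H_eq_integral:
  assumes "has_weak_deriv u v" "\<And>x. W x \<ge> 0"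
    and "integrable lebesgue (\<lambda>y. (norm (v y))\<^sup>2 / 2 + W (u y))"
  shows "line_H W u = ennreal (LINT y|lebesgue. (norm (v y))\<^sup>2 / 2 + W (u y))"
  unfolding line_H_eq[OF assms(1)]
  by (rule nn_integral_eq_integral[OF assms(3)]) (use assms(2) in auto)

lemma primitive_in_H1:
  assumes "primitive z w" "integrable lebesgue (\<lambda>y. (norm (z y))\<^sup>2)" "integrable lebesgue (\<lambda>y. (norm (w y))\<^sup>2)"
  shows "z \<in> H1"
  unfolding H1_def square_integrable_def
  using assms primitive_has_weak_deriv[OF assms(1)]
  by (auto simp: has_weak_deriv_def intro: locally_integrable_measurable intro!: exI[of _ w])

lemma transition_function_facts:
  assumes "transition_function pp pm g"
  obtains g' R where "\<And>y. (g has_vector_derivative g' y) (at y)" "continuous_on UNIV g'" "R > 0"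
    "\<And>y. y \<ge> R \<Longrightarrow> g y = pp" "\<And>y. y \<le> -R \<Longrightarrow> g y = pm" "\<And>y. y \<notin> {-R..R} \<Longrightarrow> g' y = 0"
proof -
  have sm: "smooth_on UNIV g" using assms by (simp add: transition_function_def)
  define g' where "g' y = frechet_derivative g (at y) 1" for y
  have d: "(g has_vector_derivative g' y) (at y)" for y
  proof -
    have "g differentiable (at y)"
      using sm[unfolded smooth_on_def, rule_format, of "Suc 0"] by simp
    then have D: "(g has_derivative frechet_derivative g (at y)) (at y)"
      by (simp add: frechet_derivative_works)
    have "frechet_derivative g (at y) = (\<lambda>h. h *\<^sub>R g' y)"
    proof
      show "frechet_derivative g (at y) h = h *\<^sub>R g' y" for h
        using linear_cmul[OF has_derivative_linear[OF D], of h 1] by (simp add: g'_def)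
    qed
    with D show ?thesis by (simp add: has_vector_derivative_def)
  qed
  have c: "continuous_on UNIV g'"
    using sm[unfolded smooth_on_def, rule_format, of "Suc 0"] by (simp add: g'_def[abs_def])
  obtain R1 where R1: "\<And>y. y \<ge> R1 \<Longrightarrow> g y = pp"
    using assms by (auto simp: transition_function_def eventually_at_top_linorder)
  obtain R2 where R2: "\<And>y. y \<le> R2 \<Longrightarrow> g y = pm"
    using assms by (auto simp: transition_function_def eventually_at_bot_linorder)
  define R where "R = \<bar>R1\<bar> + \<bar>R2\<bar> + 1"
  have R: "R > 0" "\<And>y. y \<ge> R \<Longrightarrow> g y = pp" "\<And>y. y \<le> -R \<Longrightarrow> g y = pm"
    using R1 R2 by (auto simp: R_def)
  have "g' y = 0" if y: "y \<notin> {-R..R}" for y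
  proof -
    have "((\<lambda>_. g y) has_vector_derivative 0) (at y)" by simp
    then have "(g has_vector_derivative 0) (at y)"
      by (rule has_vector_derivative_transform_within_open[of _ _ _ "if y > R then {R<..} else {..<-R}"])
         (use y R in \<open>auto split: if_splits\<close>)
    with d show ?thesis by (rule vector_derivative_unique_at)
  qed
  then show thesis using that[OF d c R] by blast
qed

lemma continuous_support_integrable:
  fixes f :: "real \<Rightarrow> 'b::euclidean_space"
  assumes "continuous_on UNIV f" "\<And>y. y \<notin> {-R..R} \<Longrightarrow> f y = 0"
  shows "integrable lebesgue f"
  by (rule lebesgue_integral_eq_integral_support(1)[OF absolutely_integrable_continuous_real])
     (use assms in \<open>auto intro: continuous_on_subset\<close>)

lemma integrable_norm2_diff:
  fixes f g :: "real \<Rightarrow> real^2"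
  assumes "f \<in> borel_measurable lebesgue" "g \<in> borel_measurable lebesgue"
    "integrable lebesgue (\<lambda>y. (norm (f y))\<^sup>2)" "integrable lebesgue (\<lambda>y. (norm (g y))\<^sup>2)"
  shows "integrable lebesgue (\<lambda>y. (norm (f y - g y))\<^sup>2)"
proof (rule Bochner_Integration.integrable_bound)
  show "integrable lebesgue (\<lambda>y. 2 * (norm (f y))\<^sup>2 + 2 * (norm (g y))\<^sup>2)" using assms by auto
  show "(\<lambda>y. (norm (f y - g y))\<^sup>2) \<in> borel_measurable lebesgue" using assms(1,2) by measurable
  show "AE y in lebesgue. norm ((norm (f y - g y))\<^sup>2) \<le> norm (2 * (norm (f y))\<^sup>2 + 2 * (norm (g y))\<^sup>2)"
  proof (rule always_eventually, rule allI)
    fix y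
    have "(norm (f y - g y))\<^sup>2 \<le> (norm (f y) + norm (g y))\<^sup>2"
      by (intro power_mono norm_triangle_ineq4) auto
    also have "\<dots> \<le> 2 * (norm (f y))\<^sup>2 + 2 * (norm (g y))\<^sup>2"
      using sum_squares_bound[of "norm (f y)" "norm (g y)"] by (simp add: power2_sum)
    finally show "norm ((norm (f y - g y))\<^sup>2) \<le> norm (2 * (norm (f y))\<^sup>2 + 2 * (norm (g y))\<^sup>2)" by simp
  qed
qed

context reparametrized_curve
begin

lemma V_minus_compact_square_integrable:
  assumes "continuous_on UNIV g'" "\<And>y. y \<notin> {-R..R} \<Longrightarrow> g' y = 0"
  shows "integrable lebesgue (\<lambda>y. (norm (V y - g' y))\<^sup>2)"
proof -
  have "integrable lebesgue (\<lambda>y. (norm (g' y))\<^sup>2)"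
    by (rule continuous_support_integrable[of _ R]) (use assms in \<open>auto intro!: continuous_intros\<close>)
  then show ?thesis
    using primitive_U locally_integrable_continuous[OF assms(1)]
    by (intro integrable_norm2_diff kinetic_energy(1)) (auto simp: primitive_def intro: locally_integrable_measurable)
qed

text \<open>
  Near the ends of the line \<open>|U - g|\<^sup>2\<close> is bounded by a multiple of \<open>W(U)\<close>, which is integrable.
\<close>

lemma U_minus_transition_H1:
  assumes "transition_function pp pm g"
  shows "(\<lambda>y. U y - g y) \<in> H1"
proof -
  obtain g' R where g: "\<And>y. (g has_vector_derivative g' y) (at y)" "continuous_on UNIV g'" "R > 0"
    "\<And>y. y \<ge> R \<Longrightarrow> g y = pp" "\<And>y. y \<le> -R \<Longrightarrow> g y = pm" "\<And>y. y \<notin> {-R..R} \<Longrightarrow> g' y = 0"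
    using transition_function_facts[OF assms] by blast
  have pg: "primitive g g'" using g(1,2) by (rule primitive_C1)
  have p: "primitive (\<lambda>y. U y - g y) (\<lambda>y. V y - g' y)" using primitive_U pg by (rule primitive_diff)
  have cont: "continuous_on S (\<lambda>y. U y - g y)" for S using primitive_continuous[OF p] .
  have 1: "integrable lebesgue (\<lambda>y. (norm (V y - g' y))\<^sup>2)"
    by (rule V_minus_compact_square_integrable[OF g(2,6)])
  have z: "W pp = 0" "W pm = 0" using W_zero_iff by auto
  obtain c1 r1 where c1: "c1 > 0" "r1 > 0" "\<And>x. norm (x - pp) \<le> r1 \<Longrightarrow> W x \<ge> c1 * (norm (x - pp))\<^sup>2"
    using quadratic_lower_bound[OF W_nonneg z(1) hess_pp] by blast
  obtain c2 r2 where c2: "c2 > 0" "r2 > 0" "\<And>x. norm (x - pm) \<le> r2 \<Longrightarrow> W x \<ge> c2 * (norm (x - pm))\<^sup>2"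
    using quadratic_lower_bound[OF W_nonneg z(2) hess_pm] by blast
  obtain R1 where R1: "\<And>y. y \<ge> R1 \<Longrightarrow> dist (U y) pp < r1"
    using tendstoD[OF U_tendsto(1) c1(2)] by (auto simp: eventually_at_top_linorder)
  obtain R2 where R2: "\<And>y. y \<le> R2 \<Longrightarrow> dist (U y) pm < r2"
    using tendstoD[OF U_tendsto(2) c2(2)] by (auto simp: eventually_at_bot_linorder)
  define Q where "Q = \<bar>R1\<bar> + \<bar>R2\<bar> + R"
  have "bounded ((\<lambda>y. U y - g y) ` {-Q..Q})"
    by (intro compact_imp_bounded compact_continuous_image cont) auto
  then obtain B where B: "\<And>y. y \<in> {-Q..Q} \<Longrightarrow> norm (U y - g y) \<le> B" unfolding bounded_iff by blast
  have 2: "integrable lebesgue (\<lambda>y. (norm (U y - g y))\<^sup>2)"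
  proof (rule Bochner_Integration.integrable_bound)
    show "integrable lebesgue (\<lambda>y. (1 / c1 + 1 / c2) * W (U y) + B\<^sup>2 * indicator {-Q..Q} y)"
    proof -
      have "integrable lebesgue (indicat_real {-Q..Q})"
        using absolutely_integrable_continuous_real[of "-Q" Q "\<lambda>_. 1::real"] by (simp add: set_integrable_def)
      then show ?thesis
        using potential_energy(1) by (intro Bochner_Integration.integrable_add integrable_mult_right) auto
    qed
    show "(\<lambda>y. (norm (U y - g y))\<^sup>2) \<in> borel_measurable lebesgue"
      using locally_integrable_measurable[OF locally_integrable_continuous[OF cont]] by measurable
    show "AE y in lebesgue. norm ((norm (U y - g y))\<^sup>2) \<le> norm ((1 / c1 + 1 / c2) * W (U y) + B\<^sup>2 * indicator {-Q..Q} y)"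
    proof (rule always_eventually, rule allI)
      fix y
      have W0: "W (U y) / c1 \<ge> 0" "W (U y) / c2 \<ge> 0" using W_nonneg c1 c2 by auto
      have nn: "(1 / c1 + 1 / c2) * W (U y) = W (U y) / c1 + W (U y) / c2" by (simp add: distrib_right)
      consider "y > Q" | "y < -Q" | "y \<in> {-Q..Q}" by force
      then have "(norm (U y - g y))\<^sup>2 \<le> (1 / c1 + 1 / c2) * W (U y) + B\<^sup>2 * indicator {-Q..Q} y"
      proof cases
        case 1
        then have "R1 \<le> y" "R \<le> y" using g(3) unfolding Q_def by linarith+
        then have "g y = pp" "norm (U y - pp) \<le> r1" using g(4) R1[of y] by (auto simp: dist_norm)
        then have "(norm (U y - g y))\<^sup>2 \<le> W (U y) / c1" using c1(1) c1(3)[of "U y"] by (simp add: pos_le_divide_eq mult.commute)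
        then show ?thesis unfolding nn using W0 1 by simp
      next
        case 2
        then have "y \<le> R2" "y \<le> -R" using g(3) unfolding Q_def by linarith+
        then have "g y = pm" "norm (U y - pm) \<le> r2" using g(5) R2[of y] by (auto simp: dist_norm)
        then have "(norm (U y - g y))\<^sup>2 \<le> W (U y) / c2" using c2(1) c2(3)[of "U y"] by (simp add: pos_le_divide_eq mult.commute)
        then show ?thesis unfolding nn using W0 2 by simp
      next
        case 3
        then have "(norm (U y - g y))\<^sup>2 \<le> B\<^sup>2" using B by (intro power_mono) auto
        then show ?thesis unfolding nn using W0 3 by simp
      qed
      then show "norm ((norm (U y - g y))\<^sup>2) \<le> norm ((1 / c1 + 1 / c2) * W (U y) + B\<^sup>2 * indicator {-Q..Q} y)"
        by simp
    qed
  qed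
  show ?thesis using primitive_in_H1[OF p 2 1] .
qed

lemma has_weak_deriv_U: "has_weak_deriv U V"
  using primitive_U by (rule primitive_has_weak_deriv)

lemma line_H_U: "line_H W U = ennreal (sqrt 2 * curve_E W \<gamma>)"
proof -
  have i: "integrable lebesgue (\<lambda>y. (norm (V y))\<^sup>2 / 2 + W (U y))"
    using kinetic_energy(1) potential_energy(1) by auto
  have "line_H W U = ennreal (LINT y|lebesgue. (norm (V y))\<^sup>2 / 2 + W (U y))"
    by (rule line_H_eq_integral[OF has_weak_deriv_U W_nonneg i])
  also have "(LINT y|lebesgue. (norm (V y))\<^sup>2 / 2 + W (U y)) = sqrt 2 * curve_E W \<gamma> / 2 + curve_E W \<gamma> / sqrt 2"
    using kinetic_energy potential_energy by (subst Bochner_Integration.integral_add) auto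
  also have "\<dots> = sqrt 2 * curve_E W \<gamma>"
    by (simp add: field_simps)
  finally show ?thesis .
qed

lemma has_line_P_U: "has_line_P U (curve_P \<gamma>)"
proof -
  have "((\<lambda>x. - (case x of (a, b) \<Rightarrow> LINT y:{a..b}|lebesgue. U y $ 2 * V y $ 1)) \<longlongrightarrow> - (LINT y|lebesgue. U y $ 2 * V y $ 1)) (at_bot \<times>\<^sub>F at_top)"
    by (intro tendsto_minus tendsto_improper_integral area_U)
  then show ?thesis
    unfolding has_line_P_iff[OF has_weak_deriv_U] area_U(2) by (simp add: case_prod_beta')
qed

end

lemma has_weak_deriv_cong_AE:
  assumes v: "has_weak_deriv u' v" and ae: "AE y in lebesgue. u y = u' y" and m: "u \<in> borel_measurable lebesgue"
  shows "has_weak_deriv u v"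
proof -
  have m': "u' \<in> borel_measurable lebesgue"
    using v by (auto simp: has_weak_deriv_def intro: locally_integrable_measurable)
  have "locally_integrable u"
    unfolding locally_integrable_def
  proof (intro allI)
    fix a b
    have "set_integrable lebesgue {a..b} u \<longleftrightarrow> set_integrable lebesgue {a..b} u'"
      by (rule set_integrable_cong_AE) (use m m' ae in auto)
    then show "set_integrable lebesgue {a..b} u"
      using v by (simp add: has_weak_deriv_def locally_integrable_def)
  qed
  moreover have "(LINT y|lebesgue. deriv \<phi> y *\<^sub>R u y) = (LINT y|lebesgue. deriv \<phi> y *\<^sub>R u' y)"
    if "test_function \<phi>" for \<phi>
  proof (rule integral_cong_AE)
    have "deriv \<phi> \<in> borel_measurable borel"
      using that by (intro borel_measurable_continuous_onI smooth_on_real_deriv(2)) (simp add: test_function_def)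
    then have dm: "deriv \<phi> \<in> borel_measurable lebesgue" by (simp add: measurable_completion)
    show "(\<lambda>y. deriv \<phi> y *\<^sub>R u y) \<in> borel_measurable lebesgue" "(\<lambda>y. deriv \<phi> y *\<^sub>R u' y) \<in> borel_measurable lebesgue"
      using dm m m' by measurable
    show "AE y in lebesgue. deriv \<phi> y *\<^sub>R u y = deriv \<phi> y *\<^sub>R u' y" using ae by eventually_elim simp
  qed
  ultimately show ?thesis using v by (simp add: has_weak_deriv_def)
qed

text \<open>
  A half line has infinite measure, so that a square integrable function cannot stay away from zero on
  it. This takes the place of the decay at infinity of \<open>H\<^sup>1\<close> functions.
\<close>

lemma square_integrable_small:
  fixes z :: "real \<Rightarrow> real^2"
  assumes i: "integrable lebesgue (\<lambda>y. (norm (z y))\<^sup>2)" and "\<delta> > 0"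
  shows "\<exists>b\<ge>Q. norm (z b) < \<delta>" "\<exists>a\<le>Q. norm (z a) < \<delta>"
proof -
  have main: False if S: "S \<in> sets lebesgue" "\<And>y. y \<in> S \<Longrightarrow> norm (z y) \<ge> \<delta>" "\<And>n::nat. \<exists>T\<subseteq>S. T \<in> sets lebesgue \<and> emeasure lebesgue T = ennreal n"
    for S
  proof -
    define I where "I = (LINT y|lebesgue. (norm (z y))\<^sup>2)"
    have I: "I \<ge> 0" unfolding I_def by (rule integral_nonneg_AE) simp
    obtain n :: nat where n: "real n > I / \<delta>\<^sup>2" using reals_Archimedean2 by blast
    obtain T where T: "T \<subseteq> S" "T \<in> sets lebesgue" "emeasure lebesgue T = ennreal n" using S(3) by blast
    have "ennreal (\<delta>\<^sup>2) * ennreal n = (\<integral>\<^sup>+ y. ennreal (\<delta>\<^sup>2) * indicator T y \<partial>lebesgue)"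
      using T by (simp add: nn_integral_cmult_indicator)
    also have "\<dots> \<le> (\<integral>\<^sup>+ y. ennreal ((norm (z y))\<^sup>2) \<partial>lebesgue)"
    proof (rule nn_integral_mono)
      fix y
      show "ennreal (\<delta>\<^sup>2) * indicator T y \<le> ennreal ((norm (z y))\<^sup>2)"
        using S(2)[of y] T(1) \<open>\<delta> > 0\<close> by (auto simp: indicator_def intro!: ennreal_leI power_mono)
    qed
    also have "\<dots> = ennreal I" unfolding I_def by (rule nn_integral_eq_integral[OF i]) simp
    finally have "\<delta>\<^sup>2 * real n \<le> I"
      using I by (simp add: ennreal_mult[symmetric] ennreal_of_nat_eq_real_of_nat)
    then show False using n \<open>\<delta> > 0\<close> by (simp add: pos_divide_less_eq mult.commute)
  qed
  show "\<exists>b\<ge>Q. norm (z b) < \<delta>"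
  proof (rule ccontr)
    assume "\<not> ?thesis"
    then show False
      by (intro main[of "{Q..}"]) (auto simp: not_less intro!: exI[of _ "{Q..Q + real _}"])
  qed
  show "\<exists>a\<le>Q. norm (z a) < \<delta>"
  proof (rule ccontr)
    assume "\<not> ?thesis"
    then show False
      by (intro main[of "{..Q}"]) (auto simp: not_less intro!: exI[of _ "{Q - real _..Q}"])
  qed
qed

text \<open>
  The primitive \<open>u'\<close> of the weak derivative agrees with \<open>u\<close> almost everywhere, which both integrals
  respect. The inequality \<open>\<surd>2 \<surd>W(u') |v| \<le> |v|\<^sup>2 / 2 + W(u')\<close> bounds the energy of every arc of \<open>u'\<close> by
  \<open>H(u) / \<surd>2\<close>.
\<close>

lemma line_H_ge_minimal_energy:
  assumes W: "continuous_on UNIV W" and W0: "\<And>x. W x \<ge> 0"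
    and min: "constrained_E_minimizer W pm pp A \<gamma>s"
    and g: "transition_function pp pm g" and u: "u \<in> admissible_class g A"
  shows "ennreal (sqrt 2 * curve_E W \<gamma>s) \<le> line_H W u"
proof (cases "line_H W u = \<infinity>")
  case False
  obtain g' R where g: "\<And>y. (g has_vector_derivative g' y) (at y)" "continuous_on UNIV g'" "R > 0"
    "\<And>y. y \<ge> R \<Longrightarrow> g y = pp" "\<And>y. y \<le> -R \<Longrightarrow> g y = pm" "\<And>y. y \<notin> {-R..R} \<Longrightarrow> g' y = 0"
    using transition_function_facts[OF g] by blast
  have pg: "primitive g g'" using g(1,2) by (rule primitive_C1)
  have gm: "g \<in> borel_measurable lebesgue"
    using primitive_continuous[OF pg] by (intro locally_integrable_measurable locally_integrable_continuous)
  obtain w where w: "has_weak_deriv (\<lambda>y. u y - g y) w" and sq: "integrable lebesgue (\<lambda>y. (norm (u y - g y))\<^sup>2)"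
    and um: "(\<lambda>y. u y - g y) \<in> borel_measurable lebesgue"
    using u by (auto simp: admissible_class_def H1_def square_integrable_def)
  obtain z where z: "primitive z w" and ze: "AE y in lebesgue. u y - g y = z y"
    using has_weak_deriv_imp_primitive[OF w] .
  define u' where "u' y = z y + g y" for y
  define v where "v y = w y + g' y" for y
  have p: "primitive u' v" unfolding u'_def[abs_def] v_def[abs_def] using z pg by (rule primitive_add)
  have ue: "AE y in lebesgue. u y = u' y" using ze by eventually_elim (simp add: u'_def algebra_simps)
  have "(\<lambda>y. (u y - g y) + g y) \<in> borel_measurable lebesgue" using um gm by (rule borel_measurable_add)
  then have um': "u \<in> borel_measurable lebesgue" by simp
  have wu: "has_weak_deriv u v" using has_weak_deriv_cong_AE[OF primitive_has_weak_deriv[OF p] ue um'] .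
  have zm: "z \<in> borel_measurable lebesgue"
    using primitive_continuous[OF z] by (intro locally_integrable_measurable locally_integrable_continuous)
  have sqz: "integrable lebesgue (\<lambda>y. (norm (z y))\<^sup>2)"
    by (rule integrable_cong_AE_imp[OF sq]) (use zm ze in \<open>auto elim: eventually_mono\<close>)
  have H: "line_H W u = (\<integral>\<^sup>+ y. ennreal ((norm (v y))\<^sup>2 / 2 + W (u' y)) \<partial>lebesgue)"
    unfolding line_H_eq[OF wu]
    by (rule nn_integral_cong_AE) (use ue in \<open>eventually_elim, simp\<close>)
  define E0 where "E0 = enn2real (line_H W u) / sqrt 2"
  have "curve_E W \<gamma>s \<le> E0"
  proof (rule minimal_energy_le[OF W W0 min p])
    fix \<delta> :: real assume \<delta>: "\<delta> > 0"
    have "has_line_P u A" using u by (simp add: admissible_class_def)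
    then have "((\<lambda>(a, b). - (LINT y:{a..b}|lebesgue. u y $ 2 * v y $ 1)) \<longlongrightarrow> A) (at_bot \<times>\<^sub>F at_top)"
      by (simp add: has_line_P_iff[OF wu])
    from tendstoD[OF this \<delta>] obtain Pf Pg where P: "eventually Pf at_bot" "eventually Pg at_top"
      "\<And>a b. Pf a \<Longrightarrow> Pg b \<Longrightarrow> dist (- (LINT y:{a..b}|lebesgue. u y $ 2 * v y $ 1)) A < \<delta>"
      unfolding eventually_prod_filter by auto
    obtain a0 b0 where a0: "\<And>a. a \<le> a0 \<Longrightarrow> Pf a" and b0: "\<And>b. b \<ge> b0 \<Longrightarrow> Pg b"
      using P(1,2) by (auto simp: eventually_at_bot_linorder eventually_at_top_linorder)
    obtain a where a: "a \<le> min a0 (-R)" "norm (z a) < \<delta>" using square_integrable_small(2)[OF sqz \<delta>] by blast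
    obtain b where b: "b \<ge> max b0 R" "norm (z b) < \<delta>" using square_integrable_small(1)[OF sqz \<delta>] by blast
    have ab: "a < b" using a b g(3) by auto
    have v1: "(\<lambda>y. v y $ 1) absolutely_integrable_on {a..b}"
      using absolutely_integrable_linear[OF primitive_integrable(1)[OF p] bounded_linear_vec_nth] by (simp add: o_def)
    have ai: "(\<lambda>y. u' y $ 2 * v y $ 1) absolutely_integrable_on {a..b}"
      using absolutely_integrable_scaleR_continuous[OF _ v1, of "\<lambda>y. u' y $ 2"] primitive_continuous[OF p]
      by (auto intro!: continuous_intros)
    have "(LINT y:{a..b}|lebesgue. u y $ 2 * v y $ 1) = (LINT y:{a..b}|lebesgue. u' y $ 2 * v y $ 1)"
      unfolding set_lebesgue_integral_def
    proof (rule integral_cong_AE)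
      show m: "(\<lambda>y. indicator {a..b} y *\<^sub>R (u' y $ 2 * v y $ 1)) \<in> borel_measurable lebesgue"
        using ai unfolding set_integrable_def by (rule borel_measurable_integrable)
      show "AE y in lebesgue. indicator {a..b} y *\<^sub>R (u y $ 2 * v y $ 1) = indicator {a..b} y *\<^sub>R (u' y $ 2 * v y $ 1)"
        using ue by eventually_elim simp
      have vm: "v \<in> borel_measurable lebesgue" using wu by (auto simp: has_weak_deriv_def intro: locally_integrable_measurable)
      show "(\<lambda>y. indicator {a..b} y *\<^sub>R (u y $ 2 * v y $ 1)) \<in> borel_measurable lebesgue"
        using borel_measurable_component[OF um', of 2] borel_measurable_component[OF vm, of 1] by (intro borel_measurable_scaleR borel_measurable_times borel_measurable_indicator) auto
    qed
    also have "\<dots> = integral {a..b} (\<lambda>y. u' y $ 2 * v y $ 1)" by (rule set_lebesgue_integral_eq_integral(2)[OF ai])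
    finally have "\<bar>- integral {a..b} (\<lambda>y. u' y $ 2 * v y $ 1) - A\<bar> < \<delta>"
      using P(3)[OF a0 b0, of a b] a b by (simp add: dist_real_def)
    moreover have "norm (u' a - pm) < \<delta>" "norm (u' b - pp) < \<delta>" using a b g(4,5) by (auto simp: u'_def)
    ultimately show "\<exists>a b. a < b \<and> norm (u' a - pm) < \<delta> \<and> norm (u' b - pp) < \<delta> \<and>
        \<bar>- integral {a..b} (\<lambda>y. u' y $ 2 * v y $ 1) - A\<bar> < \<delta>" using ab by blast
  next
    fix a b :: real assume "a < b"
    have cW: "continuous_on {a..b} (\<lambda>y. sqrt (W (u' y)))"
      by (intro continuous_intros continuous_on_compose2[OF W primitive_continuous[OF p]]) auto
    have ai: "(\<lambda>y. sqrt (W (u' y)) * norm (v y)) absolutely_integrable_on {a..b}"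
      using absolutely_integrable_scaleR_continuous[OF cW absolutely_integrable_norm[OF primitive_integrable(1)[OF p]]]
      by (simp add: o_def)
    let ?f = "\<lambda>y. indicator {a..b} y *\<^sub>R (sqrt (W (u' y)) * norm (v y))"
    have i: "integrable lebesgue (\<lambda>y. sqrt 2 * ?f y)" using ai unfolding set_integrable_def by auto
    have "integral {a..b} (\<lambda>y. sqrt (W (u' y)) * norm (v y)) = (LINT y|lebesgue. ?f y)"
      using set_lebesgue_integral_eq_integral(2)[OF ai] by (simp add: set_lebesgue_integral_def)
    then have "ennreal (sqrt 2 * integral {a..b} (\<lambda>y. sqrt (W (u' y)) * norm (v y))) = ennreal (LINT y|lebesgue. sqrt 2 * ?f y)"
      by simp
    also have "\<dots> = (\<integral>\<^sup>+ y. ennreal (sqrt 2 * ?f y) \<partial>lebesgue)"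
      by (rule nn_integral_eq_integral[symmetric, OF i]) (auto simp: W0)
    also have "\<dots> \<le> line_H W u"
      unfolding H
    proof (rule nn_integral_mono)
      fix y
      have "sqrt 2 * (sqrt (W (u' y)) * norm (v y)) \<le> (norm (v y))\<^sup>2 / 2 + W (u' y)"
      proof -
        have "0 \<le> (norm (v y) / sqrt 2 - sqrt (W (u' y)))\<^sup>2" by simp
        also have "\<dots> = (norm (v y))\<^sup>2 / 2 + W (u' y) - 2 / sqrt 2 * (sqrt (W (u' y)) * norm (v y))"
          using W0 by (simp add: power2_diff power_divide)
        also have "2 / sqrt 2 = sqrt 2" by (simp add: real_div_sqrt)
        finally show ?thesis by simp
      qed
      then show "ennreal (sqrt 2 * ?f y) \<le> ennreal ((norm (v y))\<^sup>2 / 2 + W (u' y))"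
        by (intro ennreal_leI) (auto simp: indicator_def W0)
    qed
    also have "\<dots> = ennreal (sqrt 2 * E0)"
      using False by (simp add: E0_def ennreal_enn2real_if)
    finally have "sqrt 2 * integral {a..b} (\<lambda>y. sqrt (W (u' y)) * norm (v y)) \<le> sqrt 2 * E0"
      by (subst (asm) ennreal_le_iff) (auto simp: E0_def)
    then show "integral {a..b} (\<lambda>y. sqrt (W (u' y)) * norm (v y)) \<le> E0" by simp
  qed
  then have "ennreal (sqrt 2 * curve_E W \<gamma>s) \<le> ennreal (sqrt 2 * E0)" by (intro ennreal_leI) simp
  also have "\<dots> = line_H W u" using False by (simp add: E0_def ennreal_enn2real_if)
  finally show ?thesis .
qed simp


section \<open>Variations that preserve the area\<close>

text \<open>
  The variables \<open>s\<close> and \<open>t\<close> measure a variation along the constraint and one transversal to it. On the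
  solutions of the constraint with \<open>t\<close> of order \<open>s\<^sup>2\<close>, which exist by the intermediate value theorem for small \<open>s\<close> of either
  sign, the inequality reads \<open>s * p \<ge> - M * s\<^sup>2\<close>.
\<close>

lemma lagrange_multiplier_scalar:
  fixes a b c p q K \<sigma> :: real
  assumes \<sigma>: "\<sigma> > 0"
    and min: "\<And>s t. \<bar>s\<bar> \<le> \<sigma> \<Longrightarrow> \<bar>t\<bar> \<le> \<sigma> \<Longrightarrow> t + s\<^sup>2 * a + s * t * b + t\<^sup>2 * c = 0 \<Longrightarrow> 0 \<le> s * p + t * q + K * (s\<^sup>2 + t\<^sup>2)"
  shows "p = 0"
proof -
  \<comment> \<open>With this slope the term \<open>t\<close> dominates \<open>s\<^sup>2 * a\<close> at \<open>t = k * s\<^sup>2\<close> with \<open>s\<^sup>2\<close> to spare for the cubic and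
    quartic terms, and likewise at \<open>t = - k * s\<^sup>2\<close>.\<close>
  define k where "k = \<bar>a\<bar> + 1"
  define M where "M = k * \<bar>q\<bar> + \<bar>K\<bar> * (1 + k\<^sup>2)"
  define s0 where "s0 = min (min 1 \<sigma>) (min (\<sigma> / k) (1 / (\<bar>b\<bar> * k + k\<^sup>2 * \<bar>c\<bar> + 1)))"
  have k: "k > 0" "k \<ge> 1" by (auto simp: k_def)
  have den: "\<bar>b\<bar> * k + k\<^sup>2 * \<bar>c\<bar> + 1 > 0" using k by (auto intro!: add_nonneg_pos)
  have s0: "s0 > 0" unfolding s0_def using k \<sigma> den by auto
  have main: "s * p \<ge> - M * s\<^sup>2" if s: "\<bar>s\<bar> \<le> s0" for s
  proof -
    have s1: "\<bar>s\<bar> \<le> 1" "\<bar>s\<bar> \<le> \<sigma>" "\<bar>s\<bar> \<le> \<sigma> / k" "\<bar>s\<bar> \<le> 1 / (\<bar>b\<bar> * k + k\<^sup>2 * \<bar>c\<bar> + 1)"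
      using s by (auto simp: s0_def)
    have s2: "s\<^sup>2 \<le> \<bar>s\<bar>" using s1(1) by (metis abs_ge_zero mult_left_le_one_le power2_abs power2_eq_square)
    have small: "k * s\<^sup>2 \<le> \<sigma>"
    proof -
      have "k * s\<^sup>2 \<le> k * (\<sigma> / k)" using s2 s1(3) k by (intro mult_left_mono) auto
      then show ?thesis using k by simp
    qed
    have bc: "\<bar>s\<bar> * \<bar>b\<bar> * k + k\<^sup>2 * s\<^sup>2 * \<bar>c\<bar> \<le> 1"
    proof -
      have "\<bar>s\<bar> * \<bar>b\<bar> * k + k\<^sup>2 * s\<^sup>2 * \<bar>c\<bar> \<le> \<bar>s\<bar> * \<bar>b\<bar> * k + k\<^sup>2 * \<bar>s\<bar> * \<bar>c\<bar>"
        using s2 by (intro add_left_mono mult_right_mono mult_left_mono) auto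
      also have "\<dots> \<le> \<bar>s\<bar> * (\<bar>b\<bar> * k + k\<^sup>2 * \<bar>c\<bar> + 1)" by (simp add: algebra_simps)
      also have "\<dots> \<le> 1" using s1(4) den by (simp add: pos_le_divide_eq)
      finally show ?thesis .
    qed
    define f where "f t = t + s\<^sup>2 * a + s * t * b + t\<^sup>2 * c" for t
    have err: "\<bar>s * t * b + t\<^sup>2 * c\<bar> \<le> s\<^sup>2" if t: "\<bar>t\<bar> = k * s\<^sup>2" for t
    proof -
      have "\<bar>s * t * b + t\<^sup>2 * c\<bar> \<le> \<bar>s\<bar> * \<bar>t\<bar> * \<bar>b\<bar> + \<bar>t\<bar>\<^sup>2 * \<bar>c\<bar>"
        by (rule order_trans[OF abs_triangle_ineq]) (simp add: abs_mult)
      also have "\<dots> = s\<^sup>2 * (\<bar>s\<bar> * \<bar>b\<bar> * k + k\<^sup>2 * s\<^sup>2 * \<bar>c\<bar>)"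
        unfolding t by (simp add: algebra_simps power2_eq_square)
      also have "\<dots> \<le> s\<^sup>2 * 1" using bc by (rule mult_left_mono) simp
      finally show ?thesis by simp
    qed
    have ks: "k * s\<^sup>2 \<ge> 0" using k by simp
    have as: "\<bar>s\<^sup>2 * a\<bar> + s\<^sup>2 = k * s\<^sup>2" by (simp add: k_def abs_mult algebra_simps)
    have "f (k * s\<^sup>2) \<ge> 0" using err[of "k * s\<^sup>2"] ks as unfolding f_def by linarith
    moreover have "f (- (k * s\<^sup>2)) \<le> 0" using err[of "- (k * s\<^sup>2)"] ks as unfolding f_def by linarith
    moreover have "continuous_on {- (k * s\<^sup>2)..k * s\<^sup>2} f" unfolding f_def by (intro continuous_intros)
    ultimately obtain t where t: "- (k * s\<^sup>2) \<le> t" "t \<le> k * s\<^sup>2" "f t = 0"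
      using IVT'[of f "- (k * s\<^sup>2)" 0 "k * s\<^sup>2"] ks by auto
    have ta: "\<bar>t\<bar> \<le> k * s\<^sup>2" using t by auto
    have "0 \<le> s * p + t * q + K * (s\<^sup>2 + t\<^sup>2)"
      by (rule min) (use s1(2) ta small t(3) in \<open>auto simp: f_def\<close>)
    moreover have "t * q \<le> k * \<bar>q\<bar> * s\<^sup>2"
    proof -
      have "t * q \<le> \<bar>t\<bar> * \<bar>q\<bar>" by (metis abs_ge_self abs_mult)
      also have "\<dots> \<le> k * s\<^sup>2 * \<bar>q\<bar>" using ta by (rule mult_right_mono) simp
      finally show ?thesis by (simp add: mult_ac)
    qed
    moreover have "K * (s\<^sup>2 + t\<^sup>2) \<le> \<bar>K\<bar> * (1 + k\<^sup>2) * s\<^sup>2"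
    proof -
      have "t\<^sup>2 \<le> (k * s\<^sup>2)\<^sup>2" using ta by (metis abs_ge_zero power2_abs power_mono)
      also have "\<dots> = k\<^sup>2 * (s\<^sup>2 * s\<^sup>2)" by (simp add: power2_eq_square)
      also have "\<dots> \<le> k\<^sup>2 * (s\<^sup>2 * 1)" using s2 s1(1) by (intro mult_left_mono) auto
      finally have "s\<^sup>2 + t\<^sup>2 \<le> (1 + k\<^sup>2) * s\<^sup>2" by (simp add: algebra_simps)
      then have "\<bar>K\<bar> * (s\<^sup>2 + t\<^sup>2) \<le> \<bar>K\<bar> * ((1 + k\<^sup>2) * s\<^sup>2)" by (intro mult_left_mono) auto
      moreover have "K * (s\<^sup>2 + t\<^sup>2) \<le> \<bar>K\<bar> * (s\<^sup>2 + t\<^sup>2)" by (intro mult_right_mono) auto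
      ultimately show ?thesis by (simp add: mult.assoc)
    qed
    ultimately show ?thesis by (simp add: M_def algebra_simps)
  qed
  have M0: "M \<ge> 0" using k by (simp add: M_def)
  show "p = 0"
  proof (rule ccontr)
    assume p: "p \<noteq> 0"
    define s where "s = min s0 (\<bar>p\<bar> / (2 * (M + 1)))"
    have s: "s > 0" "s \<le> s0" using s0 p M0 by (auto simp: s_def)
    have "s * \<bar>p\<bar> \<le> M * s\<^sup>2"
    proof (cases "p > 0")
      case True
      then show ?thesis using main[of "- s"] s by simp
    next
      case False
      then show ?thesis using main[of s] s by simp
    qed
    then have "\<bar>p\<bar> \<le> M * s" using s(1) by (simp add: power2_eq_square)
    also have "\<dots> \<le> M * (\<bar>p\<bar> / (2 * (M + 1)))" using M0 by (intro mult_left_mono) (auto simp: s_def)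
    also have "\<dots> \<le> (M + 1) * (\<bar>p\<bar> / (2 * (M + 1)))" using M0 by (intro mult_right_mono) auto
    also have "\<dots> = \<bar>p\<bar> / 2"
    proof -
      have "m * (x / (2 * m)) = x / 2" if "m > 0" for m x :: real using that by simp
      from this[of "M + 1"] show ?thesis using M0 by simp
    qed
    finally show False using p by simp
  qed
qed

definition C1_compact :: "(real \<Rightarrow> real^2) \<Rightarrow> (real \<Rightarrow> real^2) \<Rightarrow> bool" where
  "C1_compact \<eta> \<eta>' \<longleftrightarrow> (\<forall>y. (\<eta> has_vector_derivative \<eta>' y) (at y)) \<and> continuous_on UNIV \<eta>' \<and>
     (\<exists>R. \<forall>y. y \<notin> {-R..R} \<longrightarrow> \<eta> y = 0 \<and> \<eta>' y = 0)"

lemma C1_compact_continuous: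
  assumes "C1_compact \<eta> \<eta>'"
  shows "continuous_on S \<eta>" "continuous_on S \<eta>'"
proof -
  have "continuous_on UNIV \<eta>"
    using assms by (auto simp: C1_compact_def intro!: continuous_at_imp_continuous_on
        intro: has_vector_derivative_continuous)
  then show "continuous_on S \<eta>" "continuous_on S \<eta>'"
    using assms by (auto simp: C1_compact_def intro: continuous_on_subset)
qed

lemma C1_compact_combination:
  assumes "C1_compact \<phi> \<phi>'" "C1_compact \<psi> \<psi>'"
  shows "C1_compact (\<lambda>y. s *\<^sub>R \<phi> y + t *\<^sub>R \<psi> y) (\<lambda>y. s *\<^sub>R \<phi>' y + t *\<^sub>R \<psi>' y)"
proof -
  obtain R1 where R1: "\<And>y. y \<notin> {-R1..R1} \<Longrightarrow> \<phi> y = 0 \<and> \<phi>' y = 0" using assms(1) by (auto simp: C1_compact_def)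
  obtain R2 where R2: "\<And>y. y \<notin> {-R2..R2} \<Longrightarrow> \<psi> y = 0 \<and> \<psi>' y = 0" using assms(2) by (auto simp: C1_compact_def)
  have "\<And>y. y \<notin> {- max R1 R2..max R1 R2} \<Longrightarrow> s *\<^sub>R \<phi> y + t *\<^sub>R \<psi> y = 0 \<and> s *\<^sub>R \<phi>' y + t *\<^sub>R \<psi>' y = 0"
  proof -
    fix y assume "y \<notin> {- max R1 R2..max R1 R2}"
    then have "y \<notin> {-R1..R1}" "y \<notin> {-R2..R2}" by auto
    then show "s *\<^sub>R \<phi> y + t *\<^sub>R \<psi> y = 0 \<and> s *\<^sub>R \<phi>' y + t *\<^sub>R \<psi>' y = 0" using R1 R2 by simp
  qed
  then show ?thesis
    using assms unfolding C1_compact_def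
    by (intro conjI allI continuous_intros exI[of _ "max R1 R2"]) (auto intro!: derivative_eq_intros)
qed

lemma C1_compact_test:
  assumes "test_function \<theta>"
  shows "C1_compact (\<lambda>y. \<theta> y *\<^sub>R e) (\<lambda>y. deriv \<theta> y *\<^sub>R e)"
proof -
  obtain R where R: "continuous_on UNIV (deriv \<theta>)" "\<And>y. (\<theta> has_vector_derivative deriv \<theta> y) (at y)"
    "\<And>y. y \<notin> {-R..R} \<Longrightarrow> \<theta> y = 0" "\<And>y. y \<notin> {-R..R} \<Longrightarrow> deriv \<theta> y = 0"
    using test_function_C1[OF assms] by metis
  have "((\<lambda>y. \<theta> y *\<^sub>R e) has_vector_derivative deriv \<theta> y *\<^sub>R e) (at y)" for y
    by (rule bounded_linear.has_vector_derivative[OF bounded_linear_scaleR_left R(2)])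
  then show ?thesis
    unfolding C1_compact_def using R by (auto intro!: continuous_intros exI[of _ R])
qed

lemma C1_compact_integrable:
  fixes f :: "real \<Rightarrow> 'b::euclidean_space"
  assumes "C1_compact \<eta> \<eta>'" "continuous_on UNIV f" "\<And>y. \<eta> y = 0 \<Longrightarrow> \<eta>' y = 0 \<Longrightarrow> f y = 0"
  shows "integrable lebesgue f"
proof -
  obtain R where "\<And>y. y \<notin> {-R..R} \<Longrightarrow> \<eta> y = 0 \<and> \<eta>' y = 0" using assms(1) by (auto simp: C1_compact_def)
  then show ?thesis using continuous_support_integrable[OF assms(2), of R] assms(3) by blast
qed

lemma J_mat_mult: "(J_mat *v x) $ 1 = x $ 2" "(J_mat *v x) $ 2 = - x $ 1"
  by (simp_all add: J_mat_def matrix_vector_mult_def sum_2)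

context reparametrized_curve
begin

lemma continuous_U: "continuous_on S U"
  using primitive_continuous[OF primitive_U] .

lemma C1_compact_integrable_V:
  fixes f :: "real \<Rightarrow> real"
  assumes "C1_compact \<eta> \<eta>'" "continuous_on UNIV f" "\<And>y. \<eta> y = 0 \<Longrightarrow> \<eta>' y = 0 \<Longrightarrow> f y = 0"
  shows "integrable lebesgue (\<lambda>y. f y * V y $ i)"
proof -
  obtain R where R: "\<And>y. y \<notin> {-R..R} \<Longrightarrow> \<eta> y = 0 \<and> \<eta>' y = 0" using assms(1) by (auto simp: C1_compact_def)
  have v: "(\<lambda>y. V y $ i) absolutely_integrable_on {-R..R}"
    using absolutely_integrable_linear[OF primitive_integrable(1)[OF primitive_U] bounded_linear_vec_nth] by (simp add: o_def)
  have "(\<lambda>y. f y * V y $ i) absolutely_integrable_on {-R..R}"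
    using absolutely_integrable_scaleR_continuous[OF continuous_on_subset[OF assms(2)] v] by simp
  then show ?thesis
    by (rule lebesgue_integral_eq_integral_support(1)) (use R assms(3) in auto)
qed

text \<open>
  The derivative of the area at \<open>U\<close> in the direction of a variation.
\<close>

definition dP :: "(real \<Rightarrow> real^2) \<Rightarrow> (real \<Rightarrow> real^2) \<Rightarrow> real" where
  "dP \<eta> \<eta>' = - (LINT y|lebesgue. U y $ 2 * \<eta>' y $ 1 + \<eta> y $ 2 * V y $ 1)"

text \<open>
  The derivative of \<open>H\<close> at \<open>U\<close> in the direction of a variation.
\<close>

definition dH :: "(real \<Rightarrow> real^2) \<Rightarrow> (real \<Rightarrow> real^2) \<Rightarrow> real" where
  "dH \<eta> \<eta>' = (LINT y|lebesgue. V y \<bullet> \<eta>' y + grad W (U y) \<bullet> \<eta> y)"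

lemma dP_integrable:
  assumes "C1_compact \<eta> \<eta>'"
  shows "integrable lebesgue (\<lambda>y. U y $ 2 * \<eta>' y $ 1)" "integrable lebesgue (\<lambda>y. \<eta> y $ 2 * V y $ 1)"
    "integrable lebesgue (\<lambda>y. U y $ 2 * \<eta>' y $ 1 + \<eta> y $ 2 * V y $ 1)"
proof -
  note c = C1_compact_continuous[OF assms]
  show 1: "integrable lebesgue (\<lambda>y. U y $ 2 * \<eta>' y $ 1)"
    by (rule C1_compact_integrable[OF assms]) (auto intro!: continuous_intros continuous_U c)
  show 2: "integrable lebesgue (\<lambda>y. \<eta> y $ 2 * V y $ 1)"
    by (rule C1_compact_integrable_V[OF assms]) (auto intro!: continuous_intros c)
  show "integrable lebesgue (\<lambda>y. U y $ 2 * \<eta>' y $ 1 + \<eta> y $ 2 * V y $ 1)" using 1 2 by (rule Bochner_Integration.integrable_add)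
qed

lemma dH_integrable:
  assumes "C1_compact \<eta> \<eta>'"
  shows "integrable lebesgue (\<lambda>y. V y \<bullet> \<eta>' y)" "integrable lebesgue (\<lambda>y. grad W (U y) \<bullet> \<eta> y)"
    "integrable lebesgue (\<lambda>y. V y \<bullet> \<eta>' y + grad W (U y) \<bullet> \<eta> y)"
proof -
  note c = C1_compact_continuous[OF assms]
  have "integrable lebesgue (\<lambda>y. \<eta>' y $ i * V y $ i)" for i
    by (rule C1_compact_integrable_V[OF assms]) (auto intro!: continuous_intros c)
  then have "integrable lebesgue (\<lambda>y. \<eta>' y $ 1 * V y $ 1 + \<eta>' y $ 2 * V y $ 2)" by (intro Bochner_Integration.integrable_add)
  then show 1: "integrable lebesgue (\<lambda>y. V y \<bullet> \<eta>' y)" by (simp add: inner_vec_def sum_2 mult.commute)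
  have "continuous_on UNIV (\<lambda>y. grad W (U y))"
    by (rule continuous_on_compose2[OF continuous_grad[of UNIV] continuous_U]) auto
  then show 2: "integrable lebesgue (\<lambda>y. grad W (U y) \<bullet> \<eta> y)"
    by (intro C1_compact_integrable[OF assms]) (auto intro!: continuous_intros c)
  show "integrable lebesgue (\<lambda>y. V y \<bullet> \<eta>' y + grad W (U y) \<bullet> \<eta> y)" using 1 2 by (rule Bochner_Integration.integrable_add)
qed

lemma dP_combination:
  assumes "C1_compact \<phi> \<phi>'" "C1_compact \<psi> \<psi>'"
  shows "dP (\<lambda>y. s *\<^sub>R \<phi> y + t *\<^sub>R \<psi> y) (\<lambda>y. s *\<^sub>R \<phi>' y + t *\<^sub>R \<psi>' y) = s * dP \<phi> \<phi>' + t * dP \<psi> \<psi>'"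
proof -
  have eq: "U y $ 2 * (s *\<^sub>R \<phi>' y + t *\<^sub>R \<psi>' y) $ 1 + (s *\<^sub>R \<phi> y + t *\<^sub>R \<psi> y) $ 2 * V y $ 1
     = s * (U y $ 2 * \<phi>' y $ 1 + \<phi> y $ 2 * V y $ 1) + t * (U y $ 2 * \<psi>' y $ 1 + \<psi> y $ 2 * V y $ 1)" for y
    by (simp add: algebra_simps)
  show ?thesis
    unfolding dP_def eq
    by (subst Bochner_Integration.integral_add)
       (simp_all only: integral_mult_right_zero integrable_mult_right dP_integrable(3)[OF assms(1)] dP_integrable(3)[OF assms(2)] minus_add_distrib mult_minus_right simp_thms)
qed

lemma dH_combination:
  assumes "C1_compact \<phi> \<phi>'" "C1_compact \<psi> \<psi>'"
  shows "dH (\<lambda>y. s *\<^sub>R \<phi> y + t *\<^sub>R \<psi> y) (\<lambda>y. s *\<^sub>R \<phi>' y + t *\<^sub>R \<psi>' y) = s * dH \<phi> \<phi>' + t * dH \<psi> \<psi>'"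
proof -
  have eq: "V y \<bullet> (s *\<^sub>R \<phi>' y + t *\<^sub>R \<psi>' y) + grad W (U y) \<bullet> (s *\<^sub>R \<phi> y + t *\<^sub>R \<psi> y)
     = s * (V y \<bullet> \<phi>' y + grad W (U y) \<bullet> \<phi> y) + t * (V y \<bullet> \<psi>' y + grad W (U y) \<bullet> \<psi> y)" for y
    by (simp add: inner_add_right algebra_simps)
  show ?thesis
    unfolding dH_def eq
    by (subst Bochner_Integration.integral_add)
       (simp_all only: integral_mult_right_zero integrable_mult_right dH_integrable(3)[OF assms(1)] dH_integrable(3)[OF assms(2)] simp_thms)
qed

lemma variation_primitive:
  assumes "C1_compact \<eta> \<eta>'"
  shows "primitive (\<lambda>y. U y + \<eta> y) (\<lambda>y. V y + \<eta>' y)"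
  by (intro primitive_add primitive_U primitive_C1) (use assms in \<open>auto simp: C1_compact_def\<close>)

text \<open>
  The area of \<open>U + \<eta>\<close> is exactly a polynomial of degree two in \<open>\<eta>\<close>.
\<close>

lemma variation_admissible:
  assumes g: "transition_function pp pm g" and \<eta>: "C1_compact \<eta> \<eta>'"
    and A: "curve_P \<gamma> + dP \<eta> \<eta>' - (LINT y|lebesgue. \<eta> y $ 2 * \<eta>' y $ 1) = A"
  shows "(\<lambda>y. U y + \<eta> y) \<in> admissible_class g A"
proof -
  note c = C1_compact_continuous[OF \<eta>]
  obtain g' R where g': "\<And>y. (g has_vector_derivative g' y) (at y)" "continuous_on UNIV g'" "R > 0"
    "\<And>y. y \<ge> R \<Longrightarrow> g y = pp" "\<And>y. y \<le> -R \<Longrightarrow> g y = pm" "\<And>y. y \<notin> {-R..R} \<Longrightarrow> g' y = 0"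
    using transition_function_facts[OF g] by blast
  have pg: "primitive g g'" using g'(1,2) by (rule primitive_C1)
  have p: "primitive (\<lambda>y. U y + \<eta> y) (\<lambda>y. V y + \<eta>' y)" by (rule variation_primitive[OF \<eta>])
  have sqd: "integrable lebesgue (\<lambda>y. (norm (f y - (- h y)))\<^sup>2)"
    if "integrable lebesgue (\<lambda>y. (norm (f y))\<^sup>2)" "f \<in> borel_measurable lebesgue" "continuous_on UNIV h"
      "\<And>y. \<eta> y = 0 \<Longrightarrow> \<eta>' y = 0 \<Longrightarrow> h y = 0" for f h :: "real \<Rightarrow> real^2"
  proof (rule integrable_norm2_diff)
    have "h \<in> borel_measurable lebesgue"
      using that(3) by (intro locally_integrable_measurable locally_integrable_continuous)
    then show "(\<lambda>y. - h y) \<in> borel_measurable lebesgue" by measurable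
    show "integrable lebesgue (\<lambda>y. (norm (- h y))\<^sup>2)"
      by (rule C1_compact_integrable[OF \<eta>]) (use that(3,4) in \<open>auto intro!: continuous_intros\<close>)
  qed (use that in auto)
  have H1: "(\<lambda>y. U y - g y) \<in> H1" using g by (rule U_minus_transition_H1)
  then have s1: "(\<lambda>y. U y - g y) \<in> borel_measurable lebesgue" "integrable lebesgue (\<lambda>y. (norm (U y - g y))\<^sup>2)"
    by (auto simp: H1_def square_integrable_def)
  have s2: "integrable lebesgue (\<lambda>y. (norm (V y - g' y))\<^sup>2)"
    by (rule V_minus_compact_square_integrable[OF g'(2,6)])
  have Vg: "(\<lambda>y. V y - g' y) \<in> borel_measurable lebesgue"
    using primitive_diff[OF primitive_U pg] by (auto simp: primitive_def intro: locally_integrable_measurable)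
  have "(\<lambda>y. U y + \<eta> y - g y) \<in> H1"
  proof (rule primitive_in_H1)
    show "primitive (\<lambda>y. U y + \<eta> y - g y) (\<lambda>y. V y + \<eta>' y - g' y)" using p pg by (rule primitive_diff)
    show "integrable lebesgue (\<lambda>y. (norm (U y + \<eta> y - g y))\<^sup>2)"
      using sqd[OF s1(2,1) c(1)] by (simp add: algebra_simps)
    show "integrable lebesgue (\<lambda>y. (norm (V y + \<eta>' y - g' y))\<^sup>2)"
      using sqd[OF s2 Vg c(2)] by (simp add: algebra_simps)
  qed
  moreover have "has_line_P (\<lambda>y. U y + \<eta> y) A"
  proof -
    have iq: "integrable lebesgue (\<lambda>y. \<eta> y $ 2 * \<eta>' y $ 1)"
      by (rule C1_compact_integrable[OF \<eta>]) (auto intro!: continuous_intros c)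
    have eq: "(U y + \<eta> y) $ 2 * (V y + \<eta>' y) $ 1
      = U y $ 2 * V y $ 1 + ((U y $ 2 * \<eta>' y $ 1 + \<eta> y $ 2 * V y $ 1) + \<eta> y $ 2 * \<eta>' y $ 1)" for y
      by (simp add: algebra_simps)
    have i2: "integrable lebesgue (\<lambda>y. (U y $ 2 * \<eta>' y $ 1 + \<eta> y $ 2 * V y $ 1) + \<eta> y $ 2 * \<eta>' y $ 1)"
      using dP_integrable(3)[OF \<eta>] iq by (rule Bochner_Integration.integrable_add)
    have i: "integrable lebesgue (\<lambda>y. (U y + \<eta> y) $ 2 * (V y + \<eta>' y) $ 1)"
      unfolding eq using area_U(1) i2 by (rule Bochner_Integration.integrable_add)
    have "- (LINT y|lebesgue. (U y + \<eta> y) $ 2 * (V y + \<eta>' y) $ 1) = A"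
      unfolding eq Bochner_Integration.integral_add[OF area_U(1) i2]
        Bochner_Integration.integral_add[OF dP_integrable(3)[OF \<eta>] iq]
      using A area_U(2) by (simp add: dP_def)
    moreover have "((\<lambda>x. - (case x of (a, b) \<Rightarrow> LINT y:{a..b}|lebesgue. (U y + \<eta> y) $ 2 * (V y + \<eta>' y) $ 1))
        \<longlongrightarrow> - (LINT y|lebesgue. (U y + \<eta> y) $ 2 * (V y + \<eta>' y) $ 1)) (at_bot \<times>\<^sub>F at_top)"
      by (intro tendsto_minus tendsto_improper_integral i)
    ultimately show ?thesis
      unfolding has_line_P_iff[OF primitive_has_weak_deriv[OF p]] by (simp add: case_prod_beta')
  qed
  ultimately show ?thesis by (simp add: admissible_class_def)
qed

text \<open>
  The difference of two values of \<open>H\<close>. It is formed below the integral sign because the values are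
  extended reals.
\<close>

lemma variation_energy:
  assumes \<eta>: "C1_compact \<eta> \<eta>'" and le: "line_H W U \<le> line_H W (\<lambda>y. U y + \<eta> y)"
  shows "0 \<le> (LINT y|lebesgue. V y \<bullet> \<eta>' y + (norm (\<eta>' y))\<^sup>2 / 2 + (W (U y + \<eta> y) - W (U y)))"
    and "integrable lebesgue (\<lambda>y. V y \<bullet> \<eta>' y + (norm (\<eta>' y))\<^sup>2 / 2 + (W (U y + \<eta> y) - W (U y)))"
proof -
  note c = C1_compact_continuous[OF \<eta>]
  let ?d = "\<lambda>y. V y \<bullet> \<eta>' y + (norm (\<eta>' y))\<^sup>2 / 2 + (W (U y + \<eta> y) - W (U y))"
  have cW: "continuous_on UNIV (\<lambda>y. W (U y + \<eta> y))" "continuous_on UNIV (\<lambda>y. W (U y))"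
    by (rule continuous_on_compose2[OF continuous_W[of UNIV]]; auto intro!: continuous_intros continuous_U c)+
  have "integrable lebesgue (\<lambda>y. (norm (\<eta>' y))\<^sup>2 / 2 + (W (U y + \<eta> y) - W (U y)))"
    by (rule C1_compact_integrable[OF \<eta>]) (auto intro!: continuous_intros c cW)
  from Bochner_Integration.integrable_add[OF dH_integrable(1)[OF \<eta>] this]
  show id: "integrable lebesgue ?d" by (simp add: add.assoc)
  have i0: "integrable lebesgue (\<lambda>y. (norm (V y))\<^sup>2 / 2 + W (U y))"
    using kinetic_energy(1) potential_energy(1) by auto
  have H0: "line_H W U = ennreal (LINT y|lebesgue. (norm (V y))\<^sup>2 / 2 + W (U y))"
    by (rule line_H_eq_integral[OF has_weak_deriv_U W_nonneg i0])
  have eq: "(norm (V y + \<eta>' y))\<^sup>2 / 2 + W (U y + \<eta> y) = ((norm (V y))\<^sup>2 / 2 + W (U y)) + ?d y" for y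
    by (simp add: power2_norm_eq_inner inner_add_left inner_add_right inner_commute algebra_simps add_divide_distrib)
  have i1: "integrable lebesgue (\<lambda>y. (norm (V y + \<eta>' y))\<^sup>2 / 2 + W (U y + \<eta> y))"
    unfolding eq using i0 id by (rule Bochner_Integration.integrable_add)
  have "line_H W (\<lambda>y. U y + \<eta> y) = ennreal (LINT y|lebesgue. (norm (V y + \<eta>' y))\<^sup>2 / 2 + W (U y + \<eta> y))"
    by (rule line_H_eq_integral[OF primitive_has_weak_deriv[OF variation_primitive[OF \<eta>]] W_nonneg i1])
  also have "(LINT y|lebesgue. (norm (V y + \<eta>' y))\<^sup>2 / 2 + W (U y + \<eta> y))
     = (LINT y|lebesgue. (norm (V y))\<^sup>2 / 2 + W (U y)) + (LINT y|lebesgue. ?d y)"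
    unfolding eq using i0 id by (rule Bochner_Integration.integral_add)
  finally have "ennreal (LINT y|lebesgue. (norm (V y))\<^sup>2 / 2 + W (U y))
     \<le> ennreal ((LINT y|lebesgue. (norm (V y))\<^sup>2 / 2 + W (U y)) + (LINT y|lebesgue. ?d y))"
    using le H0 by simp
  moreover have "0 \<le> (LINT y|lebesgue. (norm (V y + \<eta>' y))\<^sup>2 / 2 + W (U y + \<eta> y))"
    by (rule integral_nonneg_AE) (use W_nonneg in auto)
  then have "0 \<le> (LINT y|lebesgue. (norm (V y))\<^sup>2 / 2 + W (U y)) + (LINT y|lebesgue. ?d y)"
    unfolding eq Bochner_Integration.integral_add[OF i0 id] .
  ultimately show "0 \<le> (LINT y|lebesgue. ?d y)" by (simp add: ennreal_le_iff)
qed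

lemma C1_compact_bounded:
  assumes "C1_compact \<eta> \<eta>'"
  obtains B where "B > 0" "\<And>y. norm (\<eta> y) \<le> B"
proof -
  obtain R where R: "\<And>y. y \<notin> {-R..R} \<Longrightarrow> \<eta> y = 0 \<and> \<eta>' y = 0" using assms by (auto simp: C1_compact_def)
  have "bounded (\<eta> ` {-R..R})"
    by (intro compact_imp_bounded compact_continuous_image C1_compact_continuous[OF assms]) auto
  then obtain B where B: "B > 0" "\<And>y. y \<in> {-R..R} \<Longrightarrow> norm (\<eta> y) \<le> B" by (auto simp: bounded_pos)
  then have "norm (\<eta> y) \<le> B" for y using R[of y] by (cases "y \<in> {-R..R}") auto
  with B(1) that show thesis by blast
qed

lemma U_bounded: obtains B where "B > 0" "\<And>y. norm (U y) \<le> B"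
proof -
  have "bounded (\<gamma> ` {0..1})"
    by (intro compact_imp_bounded compact_continuous_image continuous_\<gamma>) auto
  then obtain B where "B > 0" "\<And>t. t \<in> {0..1} \<Longrightarrow> norm (\<gamma> t) \<le> B" by (auto simp: bounded_pos)
  moreover have "T y \<in> {0..1}" for y using T_bounds[of y] by auto
  ultimately show thesis using that[of B] by (simp add: U_eq)
qed

text \<open>
  In the variation \<open>s \<phi> + t \<psi>\<close> the parameter \<open>t\<close> compensates the second-order change of area that is
  caused by \<open>s \<phi>\<close>. The remainder in the expansion of \<open>W\<close> is quadratic in \<open>(s, t)\<close>.
\<close>

lemma first_variation_zero:
  assumes g: "transition_function pp pm g"
    and min: "\<And>u. u \<in> admissible_class g (curve_P \<gamma>) \<Longrightarrow> line_H W U \<le> line_H W u"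
    and \<phi>: "C1_compact \<phi> \<phi>'" and \<psi>: "C1_compact \<psi> \<psi>'"
    and dP: "dP \<phi> \<phi>' = 0" "dP \<psi> \<psi>' = 1"
  shows "dH \<phi> \<phi>' = 0"
proof -
  note c\<phi> = C1_compact_continuous[OF \<phi>] and c\<psi> = C1_compact_continuous[OF \<psi>]
  obtain B where B: "B > 0" "\<And>y. norm (U y) \<le> B" using U_bounded by blast
  obtain C where C: "C > 0" "\<And>x h. norm x \<le> B + 1 \<Longrightarrow> norm (x + h) \<le> B + 1 \<Longrightarrow> \<bar>W (x + h) - W x - grad W x \<bullet> h\<bar> \<le> C * (norm h)\<^sup>2"
    using taylor_bound by blast
  obtain B1 where B1: "B1 > 0" "\<And>y. norm (\<phi> y) \<le> B1" using C1_compact_bounded[OF \<phi>] by blast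
  obtain B2 where B2: "B2 > 0" "\<And>y. norm (\<psi> y) \<le> B2" using C1_compact_bounded[OF \<psi>] by blast
  \<comment> \<open>Within this range the variation has norm at most one, so the Taylor bound on the larger ball applies.\<close>
  define \<sigma> where "\<sigma> = 1 / (B1 + B2)"
  have \<sigma>: "\<sigma> > 0" using B1 B2 by (simp add: \<sigma>_def)
  have i\<phi>: "integrable lebesgue (\<lambda>y. (norm (\<phi>' y))\<^sup>2 + 2 * C * (norm (\<phi> y))\<^sup>2)"
    by (rule C1_compact_integrable[OF \<phi>]) (auto intro!: continuous_intros c\<phi>)
  have i\<psi>: "integrable lebesgue (\<lambda>y. (norm (\<psi>' y))\<^sup>2 + 2 * C * (norm (\<psi> y))\<^sup>2)"
    by (rule C1_compact_integrable[OF \<psi>]) (auto intro!: continuous_intros c\<psi>)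
  let ?r = "\<lambda>y. ((norm (\<phi>' y))\<^sup>2 + 2 * C * (norm (\<phi> y))\<^sup>2) + ((norm (\<psi>' y))\<^sup>2 + 2 * C * (norm (\<psi> y))\<^sup>2)"
  have ir: "integrable lebesgue ?r" using i\<phi> i\<psi> by (rule Bochner_Integration.integrable_add)
  define K where "K = (LINT y|lebesgue. ?r y)"
  define a where "a = - (LINT y|lebesgue. \<phi> y $ 2 * \<phi>' y $ 1)"
  define b where "b = - (LINT y|lebesgue. \<phi> y $ 2 * \<psi>' y $ 1 + \<psi> y $ 2 * \<phi>' y $ 1)"
  define c where "c = - (LINT y|lebesgue. \<psi> y $ 2 * \<psi>' y $ 1)"
  have ia: "integrable lebesgue (\<lambda>y. \<phi> y $ 2 * \<phi>' y $ 1)"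
    by (rule C1_compact_integrable[OF \<phi>]) (auto intro!: continuous_intros c\<phi>)
  have ib: "integrable lebesgue (\<lambda>y. \<phi> y $ 2 * \<psi>' y $ 1 + \<psi> y $ 2 * \<phi>' y $ 1)"
    by (rule C1_compact_integrable[OF \<phi>]) (auto intro!: continuous_intros c\<phi> c\<psi>)
  have ic: "integrable lebesgue (\<lambda>y. \<psi> y $ 2 * \<psi>' y $ 1)"
    by (rule C1_compact_integrable[OF \<psi>]) (auto intro!: continuous_intros c\<psi>)
  show ?thesis
  proof (rule lagrange_multiplier_scalar[OF \<sigma>])
    fix s t :: real
    assume st: "\<bar>s\<bar> \<le> \<sigma>" "\<bar>t\<bar> \<le> \<sigma>" and eq: "t + s\<^sup>2 * a + s * t * b + t\<^sup>2 * c = 0"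
    define \<eta> where "\<eta> y = s *\<^sub>R \<phi> y + t *\<^sub>R \<psi> y" for y
    define \<eta>' where "\<eta>' y = s *\<^sub>R \<phi>' y + t *\<^sub>R \<psi>' y" for y
    have \<eta>: "C1_compact \<eta> \<eta>'" unfolding \<eta>_def[abs_def] \<eta>'_def[abs_def] by (rule C1_compact_combination[OF \<phi> \<psi>])
    have dP\<eta>: "dP \<eta> \<eta>' = t" unfolding \<eta>_def[abs_def] \<eta>'_def[abs_def] dP_combination[OF \<phi> \<psi>] dP by simp
    have dH\<eta>: "dH \<eta> \<eta>' = s * dH \<phi> \<phi>' + t * dH \<psi> \<psi>'"
      unfolding \<eta>_def[abs_def] \<eta>'_def[abs_def] by (rule dH_combination[OF \<phi> \<psi>])
    have "(LINT y|lebesgue. \<eta> y $ 2 * \<eta>' y $ 1) = (LINT y|lebesgue. s\<^sup>2 * (\<phi> y $ 2 * \<phi>' y $ 1)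
        + (s * t * (\<phi> y $ 2 * \<psi>' y $ 1 + \<psi> y $ 2 * \<phi>' y $ 1) + t\<^sup>2 * (\<psi> y $ 2 * \<psi>' y $ 1)))"
      by (rule Bochner_Integration.integral_cong) (auto simp: \<eta>_def \<eta>'_def algebra_simps power2_eq_square)
    also have "\<dots> = - (s\<^sup>2 * a + (s * t * b + t\<^sup>2 * c))"
    proof -
      note i1 = integrable_mult_right[OF ia, of "s\<^sup>2"] and i2 = integrable_mult_right[OF ib, of "s * t"]
        and i3 = integrable_mult_right[OF ic, of "t\<^sup>2"]
      show ?thesis
        unfolding Bochner_Integration.integral_add[OF i1 Bochner_Integration.integrable_add[OF i2 i3]]
          Bochner_Integration.integral_add[OF i2 i3] integral_mult_right_zero
        by (simp add: a_def b_def c_def)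
    qed
    finally have "curve_P \<gamma> + dP \<eta> \<eta>' - (LINT y|lebesgue. \<eta> y $ 2 * \<eta>' y $ 1) = curve_P \<gamma>"
      using eq dP\<eta> by simp
    from min[OF variation_admissible[OF g \<eta> this]]
    have le: "line_H W U \<le> line_H W (\<lambda>y. U y + \<eta> y)" .
    have "0 \<le> (LINT y|lebesgue. V y \<bullet> \<eta>' y + (norm (\<eta>' y))\<^sup>2 / 2 + (W (U y + \<eta> y) - W (U y)))"
      by (rule variation_energy(1)[OF \<eta> le])
    also have "\<dots> \<le> (LINT y|lebesgue. (V y \<bullet> \<eta>' y + grad W (U y) \<bullet> \<eta> y) + (s\<^sup>2 + t\<^sup>2) * ?r y)"
    proof (rule integral_mono[OF variation_energy(2)[OF \<eta> le]])
      show "integrable lebesgue (\<lambda>y. (V y \<bullet> \<eta>' y + grad W (U y) \<bullet> \<eta> y) + (s\<^sup>2 + t\<^sup>2) * ?r y)"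
        by (intro Bochner_Integration.integrable_add[OF dH_integrable(3)[OF \<eta>]] integrable_mult_right ir)
      fix y
      have comb: "(norm (s *\<^sub>R x + t *\<^sub>R x'))\<^sup>2 \<le> 2 * (s\<^sup>2 + t\<^sup>2) * ((norm x)\<^sup>2 + (norm x')\<^sup>2)" for x x' :: "real^2"
      proof -
        have "(norm (s *\<^sub>R x + t *\<^sub>R x'))\<^sup>2 \<le> (\<bar>s\<bar> * norm x + \<bar>t\<bar> * norm x')\<^sup>2"
          by (intro power_mono norm_triangle_le) auto
        also have "\<dots> \<le> 2 * (s\<^sup>2 * (norm x)\<^sup>2) + 2 * (t\<^sup>2 * (norm x')\<^sup>2)"
          using sum_squares_bound[of "\<bar>s\<bar> * norm x" "\<bar>t\<bar> * norm x'"] by (simp add: power2_sum power_mult_distrib)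
        also have "\<dots> \<le> 2 * (s\<^sup>2 + t\<^sup>2) * ((norm x)\<^sup>2 + (norm x')\<^sup>2)"
          by (simp add: algebra_simps)
        finally show ?thesis .
      qed
      have "norm (\<eta> y) \<le> \<bar>s\<bar> * norm (\<phi> y) + \<bar>t\<bar> * norm (\<psi> y)" unfolding \<eta>_def by (intro norm_triangle_le) auto
      also have "\<dots> \<le> \<sigma> * B1 + \<sigma> * B2" using st B1 B2 \<sigma> by (intro add_mono mult_mono) auto
      also have "\<dots> = \<sigma> * (B1 + B2)" by (simp add: distrib_left)
      also have "\<dots> = 1" using B1 B2 by (simp add: \<sigma>_def)
      finally have \<eta>1: "norm (\<eta> y) \<le> 1" .
      have "\<bar>W (U y + \<eta> y) - W (U y) - grad W (U y) \<bullet> \<eta> y\<bar> \<le> C * (norm (\<eta> y))\<^sup>2"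
        using B(2)[of y] \<eta>1 norm_triangle_ineq[of "U y" "\<eta> y"] by (intro C(2)) linarith+
      also have "\<dots> \<le> C * (2 * (s\<^sup>2 + t\<^sup>2) * ((norm (\<phi> y))\<^sup>2 + (norm (\<psi> y))\<^sup>2))"
        unfolding \<eta>_def using C(1) comb by (intro mult_left_mono) auto
      finally have 1: "W (U y + \<eta> y) - W (U y) \<le> grad W (U y) \<bullet> \<eta> y + C * (2 * (s\<^sup>2 + t\<^sup>2) * ((norm (\<phi> y))\<^sup>2 + (norm (\<psi> y))\<^sup>2))"
        by linarith
      have 2: "(norm (\<eta>' y))\<^sup>2 / 2 \<le> (s\<^sup>2 + t\<^sup>2) * ((norm (\<phi>' y))\<^sup>2 + (norm (\<psi>' y))\<^sup>2)"
        using comb[of "\<phi>' y" "\<psi>' y"] unfolding \<eta>'_def mult.assoc by linarith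
      have "(s\<^sup>2 + t\<^sup>2) * ?r y = (s\<^sup>2 + t\<^sup>2) * ((norm (\<phi>' y))\<^sup>2 + (norm (\<psi>' y))\<^sup>2)
          + C * (2 * (s\<^sup>2 + t\<^sup>2) * ((norm (\<phi> y))\<^sup>2 + (norm (\<psi> y))\<^sup>2))"
        by (simp add: algebra_simps)
      then show "V y \<bullet> \<eta>' y + (norm (\<eta>' y))\<^sup>2 / 2 + (W (U y + \<eta> y) - W (U y))
         \<le> (V y \<bullet> \<eta>' y + grad W (U y) \<bullet> \<eta> y) + (s\<^sup>2 + t\<^sup>2) * ?r y"
        using 1 2 by linarith
    qed
    also have "\<dots> = dH \<eta> \<eta>' + (s\<^sup>2 + t\<^sup>2) * K"
      unfolding dH_def K_def
      by (subst Bochner_Integration.integral_add[OF dH_integrable(3)[OF \<eta>] integrable_mult_right[OF ir]])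
         (simp only: integral_mult_right_zero)
    finally show "0 \<le> s * dH \<phi> \<phi>' + t * dH \<psi> \<psi>' + K * (s\<^sup>2 + t\<^sup>2)"
      by (simp add: dH\<eta> mult.commute)
  qed
qed

end


section \<open>The Euler-Lagrange equation\<close>

lemma primitive_has_vector_derivative:
  assumes p: "primitive u v" and c: "continuous_on UNIV v"
  shows "(u has_vector_derivative v y) (at y)"
proof -
  have "((\<lambda>x. u (y - 1) + integral {y - 1..x} v) has_vector_derivative v y) (at y within {y - 1..y + 1})"
    by (auto intro!: derivative_eq_intros integral_has_vector_derivative continuous_on_subset[OF c])
  then have "((\<lambda>x. u (y - 1) + integral {y - 1..x} v) has_vector_derivative v y) (at y)"
    by (subst (asm) at_within_interior) auto
  then show ?thesis
  proof (rule has_vector_derivative_transform_within_open[of _ _ _ "{y - 1<..<y + 1}"])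
    show "u (y - 1) + integral {y - 1..x} v = u x" if "x \<in> {y - 1<..<y + 1}" for x
      using that by (intro primitive_eq[OF p, symmetric]) auto
  qed auto
qed

lemma primitive_cong_AE:
  assumes p: "primitive u v" and ae: "AE y in lebesgue. v y = v' y" and l: "locally_integrable v'"
  shows "primitive u v'"
proof -
  obtain N where N: "N \<in> null_sets lebesgue" "{y. v y \<noteq> v' y} \<subseteq> N"
    using ae by (auto simp: eventually_ae_filter)
  then have "negligible N" by (simp add: negligible_iff_null_sets)
  then have "integral {a..b} v = integral {a..b} v'" for a b
  proof (rule integral_spike)
    show "v' y = v y" if "y \<in> {a..b} - N" for y using N(2) that by (cases "v y = v' y") auto
  qed
  then show ?thesis using p l by (simp add: primitive_def)
qed

lemma vec_nth_lebesgue_integral: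
  fixes f :: "real \<Rightarrow> real^2"
  assumes "integrable lebesgue f"
  shows "(LINT y|lebesgue. f y) $ i = (LINT y|lebesgue. f y $ i)"
  by (rule integral_bounded_linear[OF bounded_linear_vec_nth assms, symmetric])

lemma continuous_J: "continuous_on UNIV (\<lambda>x. J_mat *v x)"
  by (simp add: linear_continuous_on matrix_vector_mul_bounded_linear)

context reparametrized_curve
begin

text \<open>
  The gradient of the area at \<open>U\<close>, in the sense of \<open>L\<^sup>2\<close>.
\<close>

definition JV :: "real \<Rightarrow> real^2" where "JV y = J_mat *v V y"

lemma locally_integrable_V: "locally_integrable V"
  using primitive_U by (simp add: primitive_def)

lemma locally_integrable_JV: "locally_integrable JV"
  unfolding locally_integrable_def JV_def
proof (intro allI)
  fix a b
  show "(\<lambda>y. J_mat *v V y) absolutely_integrable_on {a..b}"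
    using absolutely_integrable_linear[OF locally_integrable_absolutely[OF locally_integrable_V]
        matrix_vector_mul_bounded_linear[of J_mat]] by (simp add: o_def)
qed

lemma locally_integrable_grad: "locally_integrable (\<lambda>y. grad W (U y))"
  by (intro locally_integrable_continuous continuous_on_compose2[OF continuous_grad[of UNIV] continuous_U]) auto

text \<open>
  The derivative of the first component of the variation is moved onto \<open>U\<close> by the definition of the weak
  derivative.
\<close>

lemma dP_test:
  assumes \<theta>: "test_function \<theta>"
  shows "dP (\<lambda>y. \<theta> y *\<^sub>R axis i 1) (\<lambda>y. deriv \<theta> y *\<^sub>R axis i 1) = (LINT y|lebesgue. \<theta> y *\<^sub>R JV y) $ i"
proof -
  have lU: "locally_integrable U" by (rule locally_integrable_continuous[OF continuous_U])
  have iU: "integrable lebesgue (\<lambda>y. deriv \<theta> y *\<^sub>R U y)"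
    by (rule test_function_integrable(2)[OF \<theta> lU])
  have iV: "integrable lebesgue (\<lambda>y. \<theta> y *\<^sub>R V y)"
    by (rule test_function_integrable(1)[OF \<theta> locally_integrable_V])
  have iJ: "integrable lebesgue (\<lambda>y. \<theta> y *\<^sub>R JV y)"
    by (rule test_function_integrable(1)[OF \<theta> locally_integrable_JV])
  have J: "(LINT y|lebesgue. \<theta> y *\<^sub>R JV y) $ i = (LINT y|lebesgue. \<theta> y * JV y $ i)"
    using vec_nth_lebesgue_integral[OF iJ, of i] by simp
  have weak: "(LINT y|lebesgue. deriv \<theta> y * U y $ 2) = - (LINT y|lebesgue. \<theta> y * V y $ 2)"
  proof -
    have "(LINT y|lebesgue. deriv \<theta> y *\<^sub>R U y) = - (LINT y|lebesgue. \<theta> y *\<^sub>R V y)"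
      using has_weak_deriv_U \<theta> by (simp add: has_weak_deriv_def)
    then have "(LINT y|lebesgue. deriv \<theta> y *\<^sub>R U y) $ 2 = - ((LINT y|lebesgue. \<theta> y *\<^sub>R V y) $ 2)" by simp
    then show ?thesis using vec_nth_lebesgue_integral[OF iU, of 2] vec_nth_lebesgue_integral[OF iV, of 2] by simp
  qed
  consider "i = 1" | "i = 2" using exhaust_2 by blast
  then show ?thesis
  proof cases
    case 1
    have "dP (\<lambda>y. \<theta> y *\<^sub>R axis i 1) (\<lambda>y. deriv \<theta> y *\<^sub>R axis i 1) = - (LINT y|lebesgue. deriv \<theta> y * U y $ 2)"
      unfolding dP_def 1 by (simp add: axis_def mult.commute)
    then show ?thesis unfolding J weak by (simp add: JV_def J_mat_mult 1)
  next
    case 2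
    have "dP (\<lambda>y. \<theta> y *\<^sub>R axis i 1) (\<lambda>y. deriv \<theta> y *\<^sub>R axis i 1) = - (LINT y|lebesgue. \<theta> y * V y $ 1)"
      unfolding dP_def 2 by (simp add: axis_def)
    then show ?thesis unfolding J by (simp add: JV_def J_mat_mult 2)
  qed
qed

lemma dH_test:
  assumes \<theta>: "test_function \<theta>"
  shows "dH (\<lambda>y. \<theta> y *\<^sub>R axis i 1) (\<lambda>y. deriv \<theta> y *\<^sub>R axis i 1)
     = ((LINT y|lebesgue. deriv \<theta> y *\<^sub>R V y) + (LINT y|lebesgue. \<theta> y *\<^sub>R grad W (U y))) $ i"
proof -
  have iV: "integrable lebesgue (\<lambda>y. deriv \<theta> y *\<^sub>R V y)"
    by (rule test_function_integrable(2)[OF \<theta> locally_integrable_V])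
  have iG: "integrable lebesgue (\<lambda>y. \<theta> y *\<^sub>R grad W (U y))"
    by (rule test_function_integrable(1)[OF \<theta> locally_integrable_grad])
  have "V y \<bullet> (deriv \<theta> y *\<^sub>R axis i 1) + grad W (U y) \<bullet> (\<theta> y *\<^sub>R axis i 1)
     = (deriv \<theta> y *\<^sub>R V y + \<theta> y *\<^sub>R grad W (U y)) $ i" for y
    by (simp add: inner_axis)
  then show ?thesis
    unfolding dH_def
    by (simp only: vec_nth_lebesgue_integral[OF Bochner_Integration.integrable_add[OF iV iG], symmetric]
        Bochner_Integration.integral_add[OF iV iG])
qed

text \<open>
  Otherwise \<open>J U'\<close> would vanish almost everywhere and \<open>U\<close> would be constant, although its limits at the two
  ends differ.
\<close>

lemma nontrivial_area_variation:
  obtains \<psi> \<psi>' where "C1_compact \<psi> \<psi>'" "dP \<psi> \<psi>' = 1"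
proof -
  have "\<exists>\<theta> i. test_function \<theta> \<and> dP (\<lambda>y. \<theta> y *\<^sub>R axis i 1) (\<lambda>y. deriv \<theta> y *\<^sub>R axis i 1) \<noteq> 0"
  proof (rule ccontr)
    assume no: "\<not> ?thesis"
    have "(LINT y|lebesgue. \<theta> y *\<^sub>R JV y) = 0" if "test_function \<theta>" for \<theta>
      using no that dP_test[OF that] by (simp add: vec_eq_iff)
    then have "AE y in lebesgue. JV y = 0"
      by (rule fundamental_lemma_test_functions[OF locally_integrable_JV])
    then have "AE y in lebesgue. V y = 0"
    proof (rule eventually_mono)
      fix y assume "JV y = 0"
      then show "V y = 0" using J_mat_mult[of "V y"] by (simp add: JV_def vec_eq_iff forall_2)
    qed
    then have p: "primitive U (\<lambda>_. 0)"
      by (rule primitive_cong_AE[OF primitive_U]) (auto intro: locally_integrable_continuous)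
    have "U a = U b" if "a \<le> b" for a b using primitive_eq[OF p that] by simp
    then have const: "U y = U 0" for y by (metis linear)
    have "U = (\<lambda>_. U 0)" by (rule ext) (rule const)
    then obtain c where c: "U = (\<lambda>_. c)" by blast
    have "c = pp" "c = pm"
      using U_tendsto unfolding c by (simp_all add: tendsto_const_iff)
    then show False using wells_distinct by simp
  qed
  then obtain \<theta> i where \<theta>: "test_function \<theta>" "dP (\<lambda>y. \<theta> y *\<^sub>R axis i 1) (\<lambda>y. deriv \<theta> y *\<^sub>R axis i 1) \<noteq> 0" by blast
  define c where "c = dP (\<lambda>y. \<theta> y *\<^sub>R axis i 1) (\<lambda>y. deriv \<theta> y *\<^sub>R axis i 1)"
  note C = C1_compact_test[OF \<theta>(1), of "axis i 1"]
  show thesis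
  proof (rule that)
    show "C1_compact (\<lambda>y. (1 / c) *\<^sub>R (\<theta> y *\<^sub>R axis i 1) + 0 *\<^sub>R (\<theta> y *\<^sub>R axis i 1))
       (\<lambda>y. (1 / c) *\<^sub>R (deriv \<theta> y *\<^sub>R axis i 1) + 0 *\<^sub>R (deriv \<theta> y *\<^sub>R axis i 1))"
      by (rule C1_compact_combination[OF C C])
    show "dP (\<lambda>y. (1 / c) *\<^sub>R (\<theta> y *\<^sub>R axis i 1) + 0 *\<^sub>R (\<theta> y *\<^sub>R axis i 1))
       (\<lambda>y. (1 / c) *\<^sub>R (deriv \<theta> y *\<^sub>R axis i 1) + 0 *\<^sub>R (deriv \<theta> y *\<^sub>R axis i 1)) = 1"
      unfolding dP_combination[OF C C] using \<theta>(2) by (simp add: c_def)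
  qed
qed

text \<open>
  The multiplier is the value of \<open>dH\<close> on a variation \<open>\<psi>\<close> that is normalized by \<open>dP = 1\<close>: subtracting
  a multiple of \<open>\<psi>\<close> makes any variation tangent to the constraint.
\<close>

lemma euler_lagrange_weak:
  assumes g: "transition_function pp pm g"
    and min: "\<And>u. u \<in> admissible_class g (curve_P \<gamma>) \<Longrightarrow> line_H W U \<le> line_H W u"
  obtains \<nu> where "has_weak_deriv V (\<lambda>y. grad W (U y) - \<nu> *\<^sub>R JV y)"
proof -
  obtain \<psi> \<psi>' where \<psi>: "C1_compact \<psi> \<psi>'" "dP \<psi> \<psi>' = 1" using nontrivial_area_variation .
  define \<nu> where "\<nu> = dH \<psi> \<psi>'"
  have mult: "dH \<phi> \<phi>' = \<nu> * dP \<phi> \<phi>'" if \<phi>: "C1_compact \<phi> \<phi>'" for \<phi> \<phi>'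
  proof -
    let ?s = "- dP \<phi> \<phi>'"
    have z: "dP (\<lambda>y. 1 *\<^sub>R \<phi> y + ?s *\<^sub>R \<psi> y) (\<lambda>y. 1 *\<^sub>R \<phi>' y + ?s *\<^sub>R \<psi>' y) = 0"
      unfolding dP_combination[OF \<phi> \<psi>(1)] \<psi>(2) by simp
    have "dH (\<lambda>y. 1 *\<^sub>R \<phi> y + ?s *\<^sub>R \<psi> y) (\<lambda>y. 1 *\<^sub>R \<phi>' y + ?s *\<^sub>R \<psi>' y) = 0"
      by (rule first_variation_zero[OF g _ C1_compact_combination[OF \<phi> \<psi>(1)] \<psi>(1) z \<psi>(2)]) (rule min)
    then show ?thesis unfolding dH_combination[OF \<phi> \<psi>(1)] by (simp add: \<nu>_def)
  qed
  have "has_weak_deriv V (\<lambda>y. grad W (U y) - \<nu> *\<^sub>R JV y)"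
    unfolding has_weak_deriv_def
  proof (intro conjI allI impI)
    show "locally_integrable V" by (rule locally_integrable_V)
    have lJ: "locally_integrable (\<lambda>y. \<nu> *\<^sub>R JV y)" using locally_integrable_JV by (simp add: locally_integrable_def)
    show "locally_integrable (\<lambda>y. grad W (U y) - \<nu> *\<^sub>R JV y)"
      by (rule locally_integrable_diff[OF locally_integrable_grad lJ])
    fix \<theta> assume \<theta>: "test_function \<theta>"
    have iG: "integrable lebesgue (\<lambda>y. \<theta> y *\<^sub>R grad W (U y))"
      by (rule test_function_integrable(1)[OF \<theta> locally_integrable_grad])
    have iJ: "integrable lebesgue (\<lambda>y. \<theta> y *\<^sub>R JV y)"
      by (rule test_function_integrable(1)[OF \<theta> locally_integrable_JV])
    have "(LINT y|lebesgue. \<theta> y *\<^sub>R (grad W (U y) - \<nu> *\<^sub>R JV y))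
       = (LINT y|lebesgue. \<theta> y *\<^sub>R grad W (U y) - \<nu> *\<^sub>R (\<theta> y *\<^sub>R JV y))"
      by (simp add: scaleR_diff_right mult.commute)
    also have "\<dots> = (LINT y|lebesgue. \<theta> y *\<^sub>R grad W (U y)) - \<nu> *\<^sub>R (LINT y|lebesgue. \<theta> y *\<^sub>R JV y)"
      by (subst Bochner_Integration.integral_diff[OF iG Bochner_Integration.integrable_scaleR_right[OF iJ]])
         (simp only: Bochner_Integration.integral_scaleR_right)
    finally have 1: "(LINT y|lebesgue. \<theta> y *\<^sub>R (grad W (U y) - \<nu> *\<^sub>R JV y))
       = (LINT y|lebesgue. \<theta> y *\<^sub>R grad W (U y)) - \<nu> *\<^sub>R (LINT y|lebesgue. \<theta> y *\<^sub>R JV y)" .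
    have "((LINT y|lebesgue. deriv \<theta> y *\<^sub>R V y) + (LINT y|lebesgue. \<theta> y *\<^sub>R grad W (U y))) $ i
       = (\<nu> *\<^sub>R (LINT y|lebesgue. \<theta> y *\<^sub>R JV y)) $ i" for i
      using mult[OF C1_compact_test[OF \<theta>, of "axis i 1"]] unfolding dP_test[OF \<theta>] dH_test[OF \<theta>] by simp
    then have "(LINT y|lebesgue. deriv \<theta> y *\<^sub>R V y) + (LINT y|lebesgue. \<theta> y *\<^sub>R grad W (U y))
       = \<nu> *\<^sub>R (LINT y|lebesgue. \<theta> y *\<^sub>R JV y)" by (intro vec_eq_iff[THEN iffD2] allI)
    then show "(LINT y|lebesgue. deriv \<theta> y *\<^sub>R V y) = - (LINT y|lebesgue. \<theta> y *\<^sub>R (grad W (U y) - \<nu> *\<^sub>R JV y))"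
      unfolding 1 by (simp add: algebra_simps)
  qed
  then show thesis by (rule that)
qed

text \<open>
  The equation bootstraps: \<open>U'\<close> has a weak derivative, hence is continuous up to a null set; then the
  right-hand side is continuous, and \<open>U'\<close> is of class \<open>C\<^sup>1\<close>.
\<close>

lemma minimizer_travelling_wave:
  assumes g: "transition_function pp pm g"
    and min: "\<And>u. u \<in> admissible_class g (curve_P \<gamma>) \<Longrightarrow> line_H W U \<le> line_H W u"
  obtains \<nu> where "travelling_wave W pp pm \<nu> U"
proof -
  obtain \<nu> where wd: "has_weak_deriv V (\<lambda>y. grad W (U y) - \<nu> *\<^sub>R JV y)"
    using euler_lagrange_weak[OF g min] by blast
  obtain V' where V': "primitive V' (\<lambda>y. grad W (U y) - \<nu> *\<^sub>R JV y)" "AE y in lebesgue. V y = V' y"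
    using has_weak_deriv_imp_primitive[OF wd] .
  have cV': "continuous_on S V'" for S using primitive_continuous[OF V'(1)] .
  have "primitive U V'"
    by (rule primitive_cong_AE[OF primitive_U V'(2) locally_integrable_continuous[OF cV']])
  then have dU: "(U has_vector_derivative V' y) (at y)" for y
    by (rule primitive_has_vector_derivative[OF _ cV'])
  define G where "G y = grad W (U y) - \<nu> *\<^sub>R (J_mat *v V' y)" for y
  have cG: "continuous_on UNIV G"
    unfolding G_def
    by (intro continuous_intros continuous_on_compose2[OF continuous_grad[of UNIV] continuous_U]
        continuous_on_compose2[OF continuous_J cV']) auto
  have "AE y in lebesgue. grad W (U y) - \<nu> *\<^sub>R JV y = G y"
    using V'(2) by eventually_elim (simp add: JV_def G_def)
  then have "primitive V' G"
    by (rule primitive_cong_AE[OF V'(1) _ locally_integrable_continuous[OF cG]])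
  then have dV: "(V' has_vector_derivative G y) (at y)" for y
    by (rule primitive_has_vector_derivative[OF _ cG])
  have "travelling_wave W pp pm \<nu> U"
    unfolding travelling_wave_def
    using dU dV U_tendsto by (intro conjI exI[of _ V'] exI[of _ G] allI) (auto simp: G_def)
  then show thesis by (rule that)
qed

end

theorem theorem4p2:
  fixes W :: "real^2 \<Rightarrow> real" and pp pm :: "real^2" and rp rm \<epsilon>0 \<epsilon> :: real
    and \<gamma>0 \<gamma>s g :: "real \<Rightarrow> real^2"
  assumes "higher_differentiable_on UNIV W 3"
    and "standing_conditions W pp pm rp rm"
    and "E_minimizer W pm pp \<gamma>0"
    and "no_bubbling_threshold W pp pm \<gamma>0 \<epsilon>0"
    and "transition_function pp pm g"
    and "\<epsilon> \<noteq> 0" and "\<epsilon> \<in> {-\<epsilon>0<..<\<epsilon>0}"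
    and "constrained_E_minimizer W pm pp (curve_P \<gamma>0 + \<epsilon>) \<gamma>s"
    and "constant_speed \<gamma>s"
  shows "(U_of_curve W \<gamma>s \<in> admissible_class g (curve_P \<gamma>0 + \<epsilon>) \<and>
          line_H W (U_of_curve W \<gamma>s) = (INF u \<in> admissible_class g (curve_P \<gamma>0 + \<epsilon>). line_H W u)) \<and>
         ((\<forall>U \<in> heteroclinics W pp pm. \<not> has_line_P U (curve_P \<gamma>0 + \<epsilon>)) \<longrightarrow>
          (\<exists>\<nu>. \<nu> \<noteq> 0 \<and> travelling_wave W pp pm \<nu> (U_of_curve W \<gamma>s)))"
proof -
  let ?A = "curve_P \<gamma>0 + \<epsilon>"
  let ?U = "U_of_curve W \<gamma>s"
  have C2: "higher_differentiable_on UNIV W 2"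
    using assms(1) higher_differentiable_on_SucD[of W 2] by (simp add: eval_nat_numeral)
  have st: "continuous_on UNIV W" "\<And>x. W x \<ge> 0" "pp \<noteq> pm" "{x. W x = 0} = {pp, pm}"
    "hessian_pos_def W pp" "hessian_pos_def W pm"
    using assms(2) by (auto simp: standing_conditions_def)
  have \<gamma>s: "\<gamma>s \<in> connecting_curves pm pp" "curve_P \<gamma>s = ?A"
    using assms(8) by (auto simp: constrained_E_minimizer_def is_arg_min_def)
  have bubble: "\<gamma>s t \<notin> {pm, pp}" if "t \<in> {0<..<1}" for t
  proof -
    have "0 < \<bar>\<epsilon>\<bar>" "\<bar>\<epsilon>\<bar> < \<epsilon>0" using assms(6,7) by auto
    then show ?thesis using assms(4,8,9) that unfolding no_bubbling_threshold_def by blast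
  qed
  obtain L where L: "L-lipschitz_on {0..1} \<gamma>s"
  proof (rule locally_lipschitz_on_imp_lipschitz)
    show "locally_lipschitz_on {0..1} \<gamma>s" using \<gamma>s(1) by (simp add: connecting_curves_def)
  qed
  obtain N where N: "N \<in> null_sets lebesgue"
    "{t. \<not> (t \<in> {0..1} \<longrightarrow> (\<exists>v. (\<gamma>s has_vector_derivative v) (at t within {0..1}) \<and> norm v = arclength \<gamma>s))} \<subseteq> N"
    using assms(9) unfolding constant_speed_def by (auto simp: eventually_ae_filter)
  have der: "(\<gamma>s has_vector_derivative curve_deriv \<gamma>s t) (at t within {0..1}) \<and> norm (curve_deriv \<gamma>s t) = arclength \<gamma>s"
    if t: "t \<in> {0..1} - N" for t
  proof -
    obtain v where v: "(\<gamma>s has_vector_derivative v) (at t within {0..1})" "norm v = arclength \<gamma>s"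
      using N(2) t by blast
    have "curve_deriv \<gamma>s t = v"
      using v(1) t by (intro vector_derivative_within_cbox[of 0 1, simplified]) auto
    then show ?thesis using v by simp
  qed
  interpret reparametrized_curve W pp pm \<gamma>s "arclength \<gamma>s" N L
  proof unfold_locales
    show "higher_differentiable_on UNIV W 2" by (rule C2)
    show "W x = 0 \<longleftrightarrow> x = pp \<or> x = pm" for x using st(4) by blast
    show "negligible N" using N(1) by (simp add: negligible_iff_null_sets)
    show "\<gamma>s t \<noteq> pm \<and> \<gamma>s t \<noteq> pp" if "0 < t" "t < 1" for t using bubble[of t] that by auto
  qed (use st L \<gamma>s(1) der in \<open>auto simp: connecting_curves_def\<close>)
  have adm: "?U \<in> admissible_class g ?A"
    using U_minus_transition_H1[OF assms(5)] has_line_P_U \<gamma>s(2) by (simp add: admissible_class_def)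
  have min: "line_H W ?U \<le> line_H W u" if "u \<in> admissible_class g ?A" for u
    unfolding line_H_U by (rule line_H_ge_minimal_energy[OF st(1,2) assms(8,5) that])
  have "line_H W ?U = (INF u \<in> admissible_class g ?A. line_H W u)"
    by (intro antisym INF_greatest INF_lower min adm)
  moreover have "\<exists>\<nu>. \<nu> \<noteq> 0 \<and> travelling_wave W pp pm \<nu> ?U"
    if no: "\<forall>U \<in> heteroclinics W pp pm. \<not> has_line_P U ?A"
  proof -
    obtain \<nu> where \<nu>: "travelling_wave W pp pm \<nu> ?U"
      using minimizer_travelling_wave[OF assms(5)] min unfolding \<gamma>s(2) by blast
    have "\<nu> \<noteq> 0"
    proof
      assume "\<nu> = 0"
      then have "?U \<in> heteroclinics W pp pm" using \<nu> by (simp add: heteroclinics_def)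
      then show False using no has_line_P_U \<gamma>s(2) by simp
    qed
    with \<nu> show ?thesis by blast
  qed
  ultimately show ?thesis using adm by blast
qed

end
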